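(* Let $d\ge 1$, let $G_0\subset\mathbb{R}^d$ be a bounded open interval if $d=1$, or a bounded $C^{1,1}$ open set if $d\geq 2$. Let $R_1,\dots,R_N$ be similitudes of $\mathbb{R}^d$ with coefficients $r_1,\dots,r_N>0$ satisfying $\sum_{j=1}^N r_j^d<1<\sum_{j=1}^N r_j^{d-1}$, let $$G=\bigg(\bigcup_{n=1}^\infty\ \bigcup_{(j_1,\dots,j_n)\in\{1,\dots,N\}^n}R_{j_1}\circ\cdots\circ R_{j_n}(G_0)\bigg)\cup G_0,$$ and assume that the sets $R_1G,\dots,R_NG,G_0$ are pairwise disjoint. Let $\mathfrak{b}\in(d-1,d)$ be the unique number with $\sum_{j=1}^N r_j^{\mathfrak{b}}=1$, and let $\alpha=d-\mathfrak{b}\in(0,1)$. Assume that $\{\ln(1/r_j)\}_{j=1}^N$ is non-arithmetic. Then $$\lim_{t\to0}\frac{|G|-\tilde{Q}_{G}^{(d-\mathfrak{b})}(t)}{t\ln(1/t)}=\frac{1}{2\,\Gamma\big(1-\frac{d-\mathfrak{b}}{2}\big)\sum_{j=1}^{N}r_{j}^{\mathfrak{b}}\ln(1/r_{j})}\int_{0}^{\infty}\left(|G_{0}|-Q_{G_{0}}^{(2)}(u)\right)u^{-1-\frac{d-\mathfrak{b}}{2}}du.$$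
   Context: A map $R:\mathbb{R}^d\to\mathbb{R}^d$ is a similitude with coefficient $r>0$ if $|Rx-Ry|=r|x-y|$ for all $x,y\in\mathbb{R}^d$. $|A|$ denotes the $d$-dimensional Lebesgue measure of a set $A$; $\Gamma$ is the Gamma function. The set $G$ satisfies $G=(\bigcup_{j=1}^N R_jG)\cup G_0$ and has finite volume. A finite set of real numbers $\{\gamma_1,\dots,\gamma_N\}$ is arithmetic if $\gamma_i/\gamma_j\in\mathbb{Q}$ for all $i,j$; otherwise it is non-arithmetic. Let $W=\{W_t\}_{t\ge0}$ be Brownian motion in $\mathbb{R}^d$, with $\mathbb{P}_x$ the law under which it starts at $x$, and let $S^{(\alpha/2)}=\{S^{(\alpha/2)}_t\}_{t\ge0}$ be an $(\alpha/2)$-stable subordinator (started at $0$), independent of $W$, with $\mathbb{E}[e^{-\lambda S_t^{(\alpha/2)}}]=e^{-t\lambda^{\alpha/2}}$ for $\lambda>0$. For an open set $D\subset\mathbb{R}^d$ put $\tau_D^{(2)}=\inf\{t>0: W_t\notin D\}$. The spectral heat content of $D$ for Brownian motion is $Q_D^{(2)}(t)=\int_D\mathbb{P}_x(\tau_D^{(2)}>t)\,dx$, and the spectral heat content of $D$ for the subordinate killed Brownian motion is $$\tilde{Q}_{D}^{(\alpha)}(t)=\int_{D}\mathbb{P}_{x}\big(\tau_{D}^{(2)} > S_{t}^{(\alpha/2)}\big)dx.$$ *)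

theory Defs
  imports "HOL-Probability.Probability"
begin

section \<open>Similitudes and the self-similar set\<close>

definition similitude :: "real \<Rightarrow> ('a::euclidean_space \<Rightarrow> 'a) \<Rightarrow> bool" where
  "similitude r R \<longleftrightarrow> r > 0 \<and> (\<forall>x y. dist (R x) (R y) = r * dist x y)"

text \<open>A word \<open>[j\<^sub>1, \<dots>, j\<^sub>n]\<close> stands for the map \<open>R j\<^sub>1 \<circ> \<dots> \<circ> R j\<^sub>n\<close>.\<close>

definition word_map :: "(nat \<Rightarrow> 'a \<Rightarrow> 'a) \<Rightarrow> nat list \<Rightarrow> 'a \<Rightarrow> 'a" where
  "word_map R js = foldr (\<lambda>j f. R j \<circ> f) js id"

definition self_similar_set :: "nat \<Rightarrow> (nat \<Rightarrow> 'a \<Rightarrow> 'a) \<Rightarrow> 'a set \<Rightarrow> 'a set" where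
  "self_similar_set N R G0 =
     (\<Union>n\<in>{1..}. \<Union>js\<in>{js. length js = n \<and> set js \<subseteq> {1..N}}. word_map R js ` G0) \<union> G0"

definition arithmetic :: "real set \<Rightarrow> bool" where
  "arithmetic A \<longleftrightarrow> (\<forall>x\<in>A. \<forall>y\<in>A. x / y \<in> \<rat>)"


section \<open>Open sets of class C11\<close>

text \<open>
  \<open>\<rho>\<close> is the localisation radius and \<open>\<Lambda>\<close> the C11 constant, both uniform over the boundary.
  The orthonormal coordinate system at the boundary point \<open>z\<close> is given by its origin \<open>z\<close> and
  its last axis, the unit vector \<open>e\<close>. A function of the first \<open>d - 1\<close> coordinates is
  represented by a function \<open>\<phi>\<close> on the whole space that is constant along \<open>e\<close>; its gradient
  \<open>g\<close> is then orthogonal to \<open>e\<close>.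
\<close>

definition C11_open :: "'a::euclidean_space set \<Rightarrow> bool" where
  "C11_open D \<longleftrightarrow> open D \<and>
     (\<exists>\<rho>>0. \<exists>\<Lambda>>0. \<forall>z\<in>frontier D. \<exists>e \<phi> g.
        norm e = 1 \<and>
        (\<forall>y s. \<phi> (y + s *\<^sub>R e) = \<phi> y) \<and>
        (\<forall>y. GDERIV \<phi> y :> g y) \<and>
        \<phi> 0 = 0 \<and> g 0 = 0 \<and>
        (\<forall>y. norm (g y) \<le> \<Lambda>) \<and>
        (\<forall>y w. norm (g y - g w) \<le> \<Lambda> * norm (y - w)) \<and>
        ball z \<rho> \<inter> D = ball z \<rho> \<inter> {y. (y - z) \<bullet> e > \<phi> (y - z)})"


section \<open>Brownian motion and stable subordinators\<close>

text \<open>Processes are functions of a real time; only times \<open>t \<ge> 0\<close> matter.\<close>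

definition independent_increments ::
  "'w measure \<Rightarrow> (real \<Rightarrow> 'w \<Rightarrow> 'b::euclidean_space) \<Rightarrow> bool" where
  "independent_increments M X \<longleftrightarrow>
     (\<forall>n::nat. \<forall>s::nat \<Rightarrow> real. 0 \<le> s 0 \<and> (\<forall>i<n. s i \<le> s (Suc i)) \<longrightarrow>
        prob_space.indep_vars M (\<lambda>_. borel) (\<lambda>i \<omega>. X (s (Suc i)) \<omega> - X (s i) \<omega>) {..<n})"

text \<open>
  Standard normalisation: the increment over \<open>[s, t]\<close> is centred Gaussian with covariance
  \<open>(t - s)\<close> times the identity. The starting point is prescribed almost surely only, so that
  one process can be a Brownian motion from \<open>x\<close> under a law \<open>P x\<close> for every \<open>x\<close>.
\<close>

definition brownian_motion ::
  "'w measure \<Rightarrow> 'a::euclidean_space \<Rightarrow> (real \<Rightarrow> 'w \<Rightarrow> 'a) \<Rightarrow> bool" where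
  "brownian_motion M x W \<longleftrightarrow>
     prob_space M \<and>
     (\<forall>t\<ge>0. W t \<in> borel_measurable M) \<and>
     (AE \<omega> in M. W 0 \<omega> = x) \<and>
     (\<forall>\<omega>\<in>space M. continuous_on {0..} (\<lambda>t. W t \<omega>)) \<and>
     independent_increments M W \<and>
     (\<forall>s t. 0 \<le> s \<and> s < t \<longrightarrow>
        distributed M lborel (\<lambda>\<omega>. W t \<omega> - W s \<omega>)
          (\<lambda>y. ennreal ((2 * pi * (t - s)) powr (- real DIM('a) / 2)
                         * exp (- (norm y)\<^sup>2 / (2 * (t - s))))))"

text \<open>The \<open>\<gamma>\<close>-stable subordinator with Laplace exponent \<open>\<theta> powr \<gamma>\<close>, started at 0.\<close>

definition stable_subordinator ::
  "'w measure \<Rightarrow> real \<Rightarrow> (real \<Rightarrow> 'w \<Rightarrow> real) \<Rightarrow> bool" where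
  "stable_subordinator M \<gamma> S \<longleftrightarrow>
     prob_space M \<and>
     (\<forall>t\<ge>0. S t \<in> borel_measurable M) \<and>
     (AE \<omega> in M. S 0 \<omega> = 0) \<and>
     (\<forall>\<omega>\<in>space M. mono_on {0..} (\<lambda>t. S t \<omega>) \<and>
                  (\<forall>t\<ge>0. continuous (at_right t) (\<lambda>s. S s \<omega>))) \<and>
     independent_increments M S \<and>
     (\<forall>s t. 0 \<le> s \<and> s \<le> t \<longrightarrow>
        distr M borel (\<lambda>\<omega>. S t \<omega> - S s \<omega>) = distr M borel (S (t - s))) \<and>
     (\<forall>t\<ge>0. \<forall>\<theta>>0. integral\<^sup>L M (\<lambda>\<omega>. exp (- \<theta> * S t \<omega>)) = exp (- t * \<theta> powr \<gamma>))"

definition process_events ::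
  "'w measure \<Rightarrow> (real \<Rightarrow> 'w \<Rightarrow> 'b::euclidean_space) \<Rightarrow> 'w set set" where
  "process_events M X =
     sigma_sets (space M) {X t -` A \<inter> space M | t A. 0 \<le> t \<and> A \<in> sets borel}"

definition independent_processes ::
  "'w measure \<Rightarrow> (real \<Rightarrow> 'w \<Rightarrow> 'b::euclidean_space) \<Rightarrow> (real \<Rightarrow> 'w \<Rightarrow> 'c::euclidean_space) \<Rightarrow> bool"
where
  "independent_processes M X Y \<longleftrightarrow>
     prob_space.indep_set M (process_events M X) (process_events M Y)"


section \<open>Spectral heat content\<close>

text \<open>Extended-real valued: the infimum is \<open>\<infinity>\<close> if the path never leaves \<open>D\<close>.\<close>

definition exit_time :: "(real \<Rightarrow> 'w \<Rightarrow> 'a) \<Rightarrow> 'a set \<Rightarrow> 'w \<Rightarrow> ereal" where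
  "exit_time W D \<omega> = (INF t\<in>{t. t > 0 \<and> W t \<omega> \<notin> D}. ereal t)"

definition heat_content_BM ::
  "('a::euclidean_space \<Rightarrow> 'w measure) \<Rightarrow> (real \<Rightarrow> 'w \<Rightarrow> 'a) \<Rightarrow> 'a set \<Rightarrow> real \<Rightarrow> real" where
  "heat_content_BM P W D t =
     (LINT x:D|lborel. measure (P x) {\<omega> \<in> space (P x). exit_time W D \<omega> > ereal t})"

definition heat_content_SKBM ::
  "('a::euclidean_space \<Rightarrow> 'w measure) \<Rightarrow> (real \<Rightarrow> 'w \<Rightarrow> 'a) \<Rightarrow> (real \<Rightarrow> 'w \<Rightarrow> real) \<Rightarrow>
   'a set \<Rightarrow> real \<Rightarrow> real" where
  "heat_content_SKBM P W S D t =
     (LINT x:D|lborel. measure (P x) {\<omega> \<in> space (P x). exit_time W D \<omega> > ereal (S t \<omega>)})"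

end

theory Submission
  imports Defs
begin

text \<open>
  Let \<open>H t\<close> be the heat loss \<open>\<bar>G\<bar>\<close> minus the heat content of \<open>G\<close> at time \<open>t\<close>, and \<open>H\<^sub>0\<close> the same for \<open>G\<^sub>0\<close>.
  Paths are continuous, so the pieces \<open>R\<^sub>j G\<close> and \<open>G\<^sub>0\<close> do not interact, and the scaling of Brownian
  motion and of the subordinator gives \<open>H t = (\<Sum>j. r\<^sub>j\<^sup>d H (t r\<^sub>j powr - \<alpha>)) + H\<^sub>0 t\<close> with \<open>\<alpha> = d - b\<close>. With
  \<open>x = ln (1 / t)\<close>, the function \<open>g x = H t / t\<close> solves a renewal equation with weights \<open>r\<^sub>j powr b\<close>, delays
  \<open>\<alpha> ln (1 / r\<^sub>j)\<close> and source \<open>H\<^sub>0 t / t\<close>. The source tends to a constant \<open>c\<close>, so \<open>g x / x\<close> tends to \<open>c\<close> divided by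
  the mean delay; this only needs comparison with linear functions.

  The constant \<open>c\<close> exists because the law of \<open>S t\<close> divided by \<open>t\<close> converges to the Levy measure, with density
  proportional to \<open>u powr (- 1 - \<alpha> / 2)\<close>. The Brownian heat loss of \<open>G\<^sub>0\<close> is \<open>O (sqrt u)\<close>, by a maximal inequality and the
  linear volume of boundary layers, and \<open>\<alpha> / 2 < 1 / 2\<close>, so small \<open>u\<close> are harmless.
\<close>

section \<open>A renewal equation with convergent source\<close>

text \<open>The law of \<open>S t\<close> divided by \<open>t\<close> has mass 1 / t and the Levy
  measure has infinite mass near 0, so weak convergence does not apply to them as they stand. Both
  are tilted by \<open>sqrt_weight\<close> into probability measures; the Levy measure gives this
  weight a finite integral because the index \<gamma> = \<alpha> / 2 lies below 1 / 2. The weight is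
  a series in 1 - exp (- 4^k u), which makes the Laplace transforms of the tilted laws explicit
  series in the Laplace exponent. The heat loss is monotone in time. Its discontinuities are
  therefore countable, hence null for the tilted limit, and its continuity in time never has to be
  proved. As for the constant: the source limit carries \<gamma> / Gamma (1 - \<gamma>) and the mean
  delay carries 2 \<gamma>, because the subordinator turns a spatial ratio r into the time ratio
  r^(2 \<gamma>). The \<gamma> cancels and the 2 of the statement is left.\<close>

lemma renewal_upper_bound:
  fixes g g0 :: "real \<Rightarrow> real" and p a :: "'i \<Rightarrow> real"
  assumes J: "finite J" "J \<noteq> {}"
    and p: "\<And>j. j \<in> J \<Longrightarrow> p j \<ge> 0" "(\<Sum>j\<in>J. p j) = 1"
    and a: "\<And>j. j \<in> J \<Longrightarrow> a j > 0"
    and \<mu>: "(\<Sum>j\<in>J. p j * a j) = \<mu>" "\<mu> > 0"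
    and eq: "\<And>x. g x = (\<Sum>j\<in>J. p j * g (x - a j)) + g0 x"
    and le: "\<And>x. x \<ge> x0 \<Longrightarrow> g0 x \<le> c"
    and bdd: "\<And>x y. \<exists>K. \<forall>z\<in>{x..y}. g z \<le> K"
  shows "\<exists>K. \<forall>x\<ge>x0. g x \<le> c / \<mu> * x + K"
proof -
  define k where "k x = g x - c / \<mu> * x" for x
  define m where "m = Min (a ` J)"
  define m' where "m' = Max (a ` J)"
  have m: "m > 0" "\<And>j. j \<in> J \<Longrightarrow> m \<le> a j" "\<And>j. j \<in> J \<Longrightarrow> a j \<le> m'"
    using J a unfolding m_def m'_def by auto
  \<comment> \<open>Shifting the linear part by the delays produces \<open>c / \<mu>\<close> times
    the mean delay, which is exactly \<open>c\<close> and absorbs the source. So \<open>k\<close>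
    satisfies the homogeneous inequality.\<close>
  have step: "k x \<le> (\<Sum>j\<in>J. p j * k (x - a j))" if "x \<ge> x0" for x
  proof -
    have "(\<Sum>j\<in>J. p j * k (x - a j)) =
        (\<Sum>j\<in>J. p j * g (x - a j)) - (\<Sum>j\<in>J. p j * (c / \<mu> * x)) + c / \<mu> * (\<Sum>j\<in>J. p j * a j)"
      unfolding k_def sum_distrib_left sum.distrib [symmetric] sum_subtractf [symmetric]
      by (intro sum.cong) (auto simp: algebra_simps)
    also have "\<dots> = (g x - g0 x) - c / \<mu> * x + c"
    proof -
      have "(\<Sum>j\<in>J. p j * (c / \<mu> * x)) = c / \<mu> * x"
        by (simp only: sum_distrib_right [symmetric] p(2) mult_1)
      then show ?thesis using \<mu> eq[of x] by simp
    qed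
    also have "\<dots> \<ge> k x" using le[OF that] by (simp add: k_def)
    finally show ?thesis .
  qed
  obtain K0 where K0: "\<And>z. z \<in> {x0 - m'..x0} \<Longrightarrow> g z \<le> K0" using bdd by meson
  define K where "K = K0 + \<bar>c / \<mu>\<bar> * (\<bar>x0 - m'\<bar> + \<bar>x0\<bar>)"
  have base: "k z \<le> K" if "z \<in> {x0 - m'..x0}" for z
  proof -
    have "\<bar>c / \<mu> * z\<bar> \<le> \<bar>c / \<mu>\<bar> * (\<bar>x0 - m'\<bar> + \<bar>x0\<bar>)"
      unfolding abs_mult using that by (intro mult_left_mono) auto
    then show ?thesis using K0[OF that] unfolding k_def K_def by linarith
  qed
  \<comment> \<open>The bound spreads in blocks of length \<open>m\<close>, the least delay: for
    \<open>x\<close> in the next block every \<open>x - a j\<close> lies in the part already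
    covered, and not to the left of the initial window because no delay exceeds \<open>m'\<close>.
    As the weights sum to 1, \<open>K\<close> does not grow.\<close>
  have "\<forall>x\<in>{x0 - m'..x0 + real n * m}. k x \<le> K" for n
  proof (induction n)
    case 0
    then show ?case using base by simp
  next
    case (Suc n)
    show ?case
    proof
      fix x assume x: "x \<in> {x0 - m'..x0 + real (Suc n) * m}"
      show "k x \<le> K"
      proof (cases "x \<le> x0")
        case True
        then show ?thesis using x base by auto
      next
        case False
        have "k x \<le> (\<Sum>j\<in>J. p j * k (x - a j))" using step False by simp
        also have "\<dots> \<le> (\<Sum>j\<in>J. p j * K)"
        proof (intro sum_mono mult_left_mono p)
          fix j assume j: "j \<in> J"
          have "x - a j \<le> x0 + real n * m" using x m(2)[OF j] by (simp add: algebra_simps)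
          then show "k (x - a j) \<le> K" using Suc False m(3)[OF j] by auto
        qed
        also have "\<dots> = K" using p by (simp flip: sum_distrib_right)
        finally show ?thesis .
      qed
    qed
  qed
  note * = this
  have "k x \<le> K" if "x \<ge> x0" for x
  proof -
    obtain n :: nat where "(x - x0) / m \<le> real n" using real_arch_simple by blast
    then have "x \<le> x0 + real n * m" using m(1) by (simp add: field_simps)
    moreover have "m' \<ge> 0" using m J by (metis all_not_in_conv order_less_le_trans order_less_imp_le)
    ultimately show ?thesis using *[of n] that by auto
  qed
  then show ?thesis unfolding k_def by (intro exI[of _ K]) (auto simp: algebra_simps)
qed

text \<open>The one-sided bound is applied to \<open>g\<close> with source bound
  \<open>c + \<delta>\<close> and to \<open>- g\<close> with \<open>- c + \<delta>\<close>. Both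
  additive constants disappear after division by \<open>x\<close>, so local boundedness is the only
  regularity asked of \<open>g\<close>.\<close>

lemma renewal_linear_growth:
  fixes g g0 :: "real \<Rightarrow> real" and p a :: "'i \<Rightarrow> real"
  assumes J: "finite J" "J \<noteq> {}"
    and p: "\<And>j. j \<in> J \<Longrightarrow> p j > 0" "(\<Sum>j\<in>J. p j) = 1"
    and a: "\<And>j. j \<in> J \<Longrightarrow> a j > 0"
    and eq: "\<And>x. g x = (\<Sum>j\<in>J. p j * g (x - a j)) + g0 x"
    and lim: "(g0 \<longlongrightarrow> c) at_top"
    and bdd: "\<And>x y. \<exists>K. \<forall>z\<in>{x..y}. \<bar>g z\<bar> \<le> K"
  shows "((\<lambda>x. g x / x) \<longlongrightarrow> c / (\<Sum>j\<in>J. p j * a j)) at_top"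
proof (rule tendstoI)
  fix e :: real assume e: "e > 0"
  define \<mu> where "\<mu> = (\<Sum>j\<in>J. p j * a j)"
  have \<mu>: "\<mu> > 0" unfolding \<mu>_def using J p a by (intro sum_pos) auto
  \<comment> \<open>With this choice \<open>\<delta>\<close> costs \<open>e / 2\<close> in the
    slope; the other half of \<open>e\<close> absorbs the additive constant once \<open>x\<close>
    exceeds \<open>2 * K / e\<close>.\<close>
  define \<delta> where "\<delta> = e * \<mu> / 2"
  have \<delta>: "\<delta> > 0" using e \<mu> by (simp add: \<delta>_def)
  have "eventually (\<lambda>x. dist (g0 x) c < \<delta>) at_top" using lim \<delta> tendstoD by blast
  then obtain x0 where x0: "\<And>x. x \<ge> x0 \<Longrightarrow> \<bar>g0 x - c\<bar> < \<delta>"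
    unfolding eventually_at_top_linorder dist_real_def by auto
  have "\<exists>K. \<forall>x\<ge>x0. g x \<le> (c + \<delta>) / \<mu> * x + K"
  proof (rule renewal_upper_bound[OF J _ p(2) a \<mu>_def[symmetric] \<mu> eq])
    show "g0 x \<le> c + \<delta>" if "x \<ge> x0" for x using x0[OF that] by linarith
    show "\<exists>K. \<forall>z\<in>{x..y}. g z \<le> K" for x y using bdd[of x y] abs_le_D1 by blast
  qed (use p in \<open>auto intro: less_imp_le\<close>)
  then obtain K1 where K1: "\<And>x. x \<ge> x0 \<Longrightarrow> g x \<le> (c + \<delta>) / \<mu> * x + K1" by blast
  have "\<exists>K. \<forall>x\<ge>x0. - g x \<le> (- c + \<delta>) / \<mu> * x + K"
  proof (rule renewal_upper_bound[OF J _ p(2) a \<mu>_def[symmetric] \<mu>, where ?g0.0="\<lambda>x. - g0 x"])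
    show "- g x = (\<Sum>j\<in>J. p j * - g (x - a j)) + - g0 x" for x
      by (subst eq) (simp add: sum_negf)
    show "- g0 x \<le> - c + \<delta>" if "x \<ge> x0" for x using x0[OF that] by linarith
    show "\<exists>K. \<forall>z\<in>{x..y}. - g z \<le> K" for x y using bdd[of x y] abs_le_D2 by blast
  qed (use p in \<open>auto intro: less_imp_le\<close>)
  then obtain K2 where K2: "\<And>x. x \<ge> x0 \<Longrightarrow> - g x \<le> (- c + \<delta>) / \<mu> * x + K2" by blast
  define K where "K = \<bar>K1\<bar> + \<bar>K2\<bar> + 1"
  show "eventually (\<lambda>x. dist (g x / x) (c / (\<Sum>j\<in>J. p j * a j)) < e) at_top"
    unfolding eventually_at_top_dense
  proof (intro exI[of _ "max (max x0 1) (2 * K / e)"] allI impI)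
    fix x assume x: "x > max (max x0 1) (2 * K / e)"
    have "K < e / 2 * x" using x e by (simp add: field_simps)
    moreover have "g x - c / \<mu> * x \<le> e / 2 * x + K" "- (e / 2 * x + K) \<le> g x - c / \<mu> * x"
    proof -
      have "\<delta> / \<mu> = e / 2" using \<mu> by (simp add: \<delta>_def)
      then have *: "(c + \<delta>) / \<mu> = c / \<mu> + e / 2" "(- c + \<delta>) / \<mu> = - (c / \<mu>) + e / 2"
        by (simp_all add: add_divide_distrib diff_divide_distrib)
      have "g x \<le> c / \<mu> * x + e / 2 * x + K1" "- g x \<le> - (c / \<mu> * x) + e / 2 * x + K2"
        using K1[of x] K2[of x] x unfolding * by (simp_all add: distrib_right left_diff_distrib)
      then show "g x - c / \<mu> * x \<le> e / 2 * x + K" "- (e / 2 * x + K) \<le> g x - c / \<mu> * x"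
        unfolding K_def by linarith+
    qed
    ultimately have "\<bar>g x - c / \<mu> * x\<bar> < e * x" by linarith
    moreover have "g x / x - c / \<mu> = (g x - c / \<mu> * x) / x" using x by (simp add: field_simps)
    ultimately show "dist (g x / x) (c / (\<Sum>j\<in>J. p j * a j)) < e"
      unfolding \<mu>_def[symmetric] dist_real_def using x by (simp add: divide_less_eq)
  qed
qed

section \<open>Laplace transforms and the stable subordinator at small times\<close>

text \<open>Under z = exp (- x) the half line becomes (0, 1] and the transforms at integers become
  moments. A continuous step function becomes a continuous function on [0, 1], which
  Stone-Weierstrass approximates by polynomials in z; hence integer arguments suffice.\<close>

lemma laplace_conv_imp_weak_conv:
  fixes M :: "nat \<Rightarrow> real measure"
  assumes M: "\<And>k. real_distribution (M k)" "real_distribution M'"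
    and nonneg: "\<And>k. AE x in M k. 0 \<le> x" "AE x in M'. 0 \<le> x"
    and conv: "\<And>n::nat. (\<lambda>k. \<integral>x. exp (- (real n * x)) \<partial>M k) \<longlonglongrightarrow> (\<integral>x. exp (- (real n * x)) \<partial>M')"
  shows "weak_conv_m M M'"
proof (rule integral_cts_step_conv_imp_weak_conv[OF M])
  fix a b :: real assume ab: "a < b"
  \<comment> \<open>The \<open>max\<close> replaces x = - ln z by min x b. This keeps the logarithm
    away from z = 0 and changes no value, since \<open>cts_step a b\<close> vanishes from
    \<open>b\<close> on.\<close>
  define f where "f z = cts_step a b (- ln (max z (exp (- b))))" for z
  have f_exp: "f (exp (- x)) = cts_step a b x" for x
    using ab by (auto simp: f_def max_def cts_step_def)
  have "max z (exp (- b)) \<noteq> 0" for z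
    by (metis exp_gt_zero less_max_iff_disj less_irrefl)
  then have cont: "continuous_on {0..1} f"
    unfolding f_def
    by (intro continuous_on_compose2[OF uniformly_continuous_imp_continuous[OF cts_step_uniformly_continuous[OF ab]]]
          continuous_intros) auto
  show "(\<lambda>n. integral\<^sup>L (M n) (cts_step a b)) \<longlonglongrightarrow> integral\<^sup>L M' (cts_step a b)"
  proof (rule tendstoI)
    fix e :: real assume e: "e > 0"
    obtain q where q: "real_polynomial_function q" "\<And>x. x \<in> {0..1} \<Longrightarrow> \<bar>f x - q x\<bar> < e / 4"
      using Stone_Weierstrass_real_polynomial_function[OF _ cont, of "e / 4"] e by auto
    then obtain c n where qeq: "q = (\<lambda>x. \<Sum>i\<le>n. c i * x ^ i)"
      unfolding real_polynomial_function_iff_sum by blast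
    have mom: "integrable N (\<lambda>x. exp (- (real i * x)))"
      if "real_distribution N" "AE x in N. 0 \<le> x" for N :: "real measure" and i
    proof -
      interpret N: real_distribution N by fact
      show ?thesis
        by (rule N.integrable_const_bound[where B=1]) (use that in \<open>auto elim!: eventually_mono\<close>)
    qed
    have poly: "integrable N (\<lambda>x. q (exp (- x)))"
        "(\<integral>x. q (exp (- x)) \<partial>N) = (\<Sum>i\<le>n. c i * (\<integral>x. exp (- (real i * x)) \<partial>N))"
      if "real_distribution N" "AE x in N. 0 \<le> x" for N :: "real measure"
      using mom[OF that] unfolding qeq exp_of_nat_mult[symmetric] mult_minus_right[symmetric]
      by (auto simp: Bochner_Integration.integral_sum)
    have approx: "\<bar>integral\<^sup>L N (cts_step a b) - (\<integral>x. q (exp (- x)) \<partial>N)\<bar> \<le> e / 4"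
      if N: "real_distribution N" "AE x in N. 0 \<le> x" for N :: "real measure"
    proof -
      interpret N: real_distribution N by fact
      have "\<bar>integral\<^sup>L N (cts_step a b) - (\<integral>x. q (exp (- x)) \<partial>N)\<bar> =
          \<bar>\<integral>x. (cts_step a b x - q (exp (- x))) \<partial>N\<bar>"
        by (subst Bochner_Integration.integral_diff) (auto intro: N.integrable_cts_step ab poly N)
      also have "\<dots> \<le> (\<integral>x. \<bar>cts_step a b x - q (exp (- x))\<bar> \<partial>N)"
        by (rule integral_abs_bound)
      also have "\<dots> \<le> (\<integral>x. e / 4 \<partial>N)"
      proof (rule integral_mono_AE)
        show "AE x in N. \<bar>cts_step a b x - q (exp (- x))\<bar> \<le> e / 4"
          using N(2)
        proof eventually_elim
          case (elim x)
          then show ?case using q(2)[of "exp (- x)"] by (simp add: f_exp)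
        qed
      qed (auto intro!: N.integrable_cts_step ab poly N)
      finally show ?thesis using N.prob_space by simp
    qed
    have "(\<lambda>k. \<integral>x. q (exp (- x)) \<partial>M k) \<longlonglongrightarrow> (\<integral>x. q (exp (- x)) \<partial>M')"
      using M nonneg by (simp add: poly) (intro tendsto_intros conv)
    then have "eventually (\<lambda>k. dist (\<integral>x. q (exp (- x)) \<partial>M k) (\<integral>x. q (exp (- x)) \<partial>M') < e / 4) sequentially"
      using e by (intro tendstoD) auto
    then show "eventually (\<lambda>k. dist (integral\<^sup>L (M k) (cts_step a b)) (integral\<^sup>L M' (cts_step a b)) < e) sequentially"
    proof eventually_elim
      case (elim k)
      then show ?case
        using approx[OF M(1) nonneg(1), of k] approx[OF M(2) nonneg(2)] e
        unfolding dist_real_def by linarith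
    qed
  qed
qed

text \<open>The equality of transforms makes the constant sequence \<open>M\<close> converge weakly
  to \<open>M'\<close>, and the characteristic functions then agree. The argument 0 is covered by
  total mass 1.\<close>

lemma laplace_unique:
  fixes M M' :: "real measure"
  assumes M: "real_distribution M" "real_distribution M'"
    and nonneg: "AE x in M. 0 \<le> x" "AE x in M'. 0 \<le> x"
    and eq: "\<And>\<theta>. \<theta> > 0 \<Longrightarrow> (\<integral>x. exp (- \<theta> * x) \<partial>M) = (\<integral>x. exp (- \<theta> * x) \<partial>M')"
  shows "M = M'"
proof -
  interpret M: real_distribution M by fact
  interpret M': real_distribution M' by fact
  have "(\<integral>x. exp (- (real n * x)) \<partial>M) = (\<integral>x. exp (- (real n * x)) \<partial>M')" for n
    using eq[of "real n"] M.prob_space M'.prob_space by (cases "n = 0") auto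
  then have "weak_conv_m (\<lambda>_. M) M'"
    by (intro laplace_conv_imp_weak_conv M nonneg) simp
  from levy_continuity1[OF M this] have "char M = char M'"
    by (auto simp: LIMSEQ_const_iff)
  with M show ?thesis by (intro Levy_uniqueness)
qed

section \<open>The Levy measure of the stable subordinator and its Laplace exponent\<close>

definition stable_levy_measure :: "real \<Rightarrow> real measure" where
  "stable_levy_measure \<gamma> =
     density lborel (\<lambda>u. ennreal (indicator {0<..} u * (\<gamma> / Gamma (1 - \<gamma>) * u powr (- 1 - \<gamma>))))"

lemma nn_integral_powr_tail:
  fixes \<gamma> v :: real
  assumes "\<gamma> > 0" "v > 0"
  shows "(\<integral>\<^sup>+u. ennreal (u powr (- 1 - \<gamma>)) * indicator {v..} u \<partial>lborel) = ennreal (v powr (- \<gamma>) / \<gamma>)"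
proof -
  have "(\<integral>\<^sup>+u. ennreal (u powr (- 1 - \<gamma>)) * indicator {v..} u \<partial>lborel) =
      ennreal (0 - (- (v powr (- \<gamma>) / \<gamma>)))"
  proof (rule nn_integral_FTC_atLeast)
    show "((\<lambda>u. - (u powr (- \<gamma>) / \<gamma>)) \<longlongrightarrow> 0) at_top"
    proof -
      have "((\<lambda>u. u powr (- \<gamma>)) \<longlongrightarrow> 0) at_top"
        using assms by (intro tendsto_neg_powr filterlim_ident) auto
      from tendsto_minus[OF tendsto_divide[OF this tendsto_const[of \<gamma>]]] show ?thesis
        using assms by simp
    qed
    show "((\<lambda>u. - (u powr (- \<gamma>) / \<gamma>)) has_real_derivative u powr (- 1 - \<gamma>)) (at u)" if "v \<le> u" for u
      using that assms by (auto intro!: derivative_eq_intros arg_cong[where f="(powr) u"] simp: field_simps)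
  qed auto
  then show ?thesis by simp
qed

text \<open>Writing 1 - exp (- \<theta> u) as the integral of \<theta> exp (- \<theta> v) over v in
  [0, u] and exchanging integrals leaves the tail v^(- \<gamma>) / \<gamma> under the v-integral.
  What remains is the Gamma integral with parameter 1 - \<gamma>; the constant in
  \<open>stable_levy_measure\<close> is chosen to cancel it.\<close>

lemma stable_levy_measure_laplace:
  assumes \<gamma>: "0 < \<gamma>" "\<gamma> < 1" and \<theta>: "\<theta> \<ge> 0"
  shows "has_bochner_integral (stable_levy_measure \<gamma>) (\<lambda>u. 1 - exp (- \<theta> * u)) (\<theta> powr \<gamma>)"
proof (cases "\<theta> = 0")
  case True
  then show ?thesis using \<gamma> by (simp add: has_bochner_integral_zero)
next
  case False
  with \<theta> have \<theta>: "\<theta> > 0" by simp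
  have G: "Gamma (1 - \<gamma>) > 0" using \<gamma> by (intro Gamma_real_pos) auto
  define c where "c = \<gamma> / Gamma (1 - \<gamma>)"
  have c: "c > 0" using G \<gamma> by (simp add: c_def)
  have exp_int: "ennreal (1 - exp (- \<theta> * u)) = (\<integral>\<^sup>+v. ennreal (\<theta> * exp (- \<theta> * v)) * indicator {0..u} v \<partial>lborel)"
    if "u > 0" for u
  proof -
    have "(\<integral>\<^sup>+v. ennreal (\<theta> * exp (- \<theta> * v)) * indicator {0..u} v \<partial>lborel) =
        ennreal (- exp (- \<theta> * u) - (- exp (- \<theta> * 0)))"
      using \<theta> that by (intro nn_integral_FTC_Icc) (auto intro!: derivative_eq_intros)
    then show ?thesis by simp
  qed
  have "(\<integral>\<^sup>+u. ennreal (1 - exp (- \<theta> * u)) \<partial>stable_levy_measure \<gamma>) =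
      (\<integral>\<^sup>+u. ennreal (indicator {0<..} u * (c * u powr (- 1 - \<gamma>))) * ennreal (1 - exp (- \<theta> * u)) \<partial>lborel)"
    unfolding stable_levy_measure_def c_def by (subst nn_integral_density) auto
  also have "\<dots> = (\<integral>\<^sup>+u. (\<integral>\<^sup>+v. ennreal (indicator {0<..} u * (c * u powr (- 1 - \<gamma>))) *
      (ennreal (\<theta> * exp (- \<theta> * v)) * indicator {0..u} v) \<partial>lborel) \<partial>lborel)"
  proof (intro nn_integral_cong)
    fix u :: real
    show "ennreal (indicator {0<..} u * (c * u powr (- 1 - \<gamma>))) * ennreal (1 - exp (- \<theta> * u)) =
      (\<integral>\<^sup>+v. ennreal (indicator {0<..} u * (c * u powr (- 1 - \<gamma>))) *
        (ennreal (\<theta> * exp (- \<theta> * v)) * indicator {0..u} v) \<partial>lborel)"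
    proof (cases "u > 0")
      case True
      show ?thesis by (subst nn_integral_cmult, simp, subst exp_int[OF True], rule refl)
    qed simp
  qed
  also have "\<dots> = (\<integral>\<^sup>+v. (\<integral>\<^sup>+u. ennreal (indicator {0<..} u * (c * u powr (- 1 - \<gamma>))) *
      (ennreal (\<theta> * exp (- \<theta> * v)) * indicator {0..u} v) \<partial>lborel) \<partial>lborel)"
    unfolding indicator_def atLeastAtMost_iff by (rule lborel_pair.Fubini') simp
  also have "\<dots> = (\<integral>\<^sup>+v. ennreal (\<theta> powr \<gamma> / Gamma (1 - \<gamma>) * \<theta>) *
      ennreal (indicator {0..} (\<theta> * v) * (\<theta> * v) powr (1 - \<gamma> - 1) / exp (\<theta> * v)) \<partial>lborel)"
  proof (rule nn_integral_cong_AE)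
    \<comment> \<open>At v = 0 the tail integral is infinite, while \<open>0 powr\<close> makes the
      right-hand side 0; this single point is discarded. For negative v both sides vanish.\<close>
    have "AE v in lborel. v \<noteq> (0::real)"
      by (rule AE_lborel_singleton)
    then show "AE v in lborel. (\<integral>\<^sup>+u. ennreal (indicator {0<..} u * (c * u powr (- 1 - \<gamma>))) *
      (ennreal (\<theta> * exp (- \<theta> * v)) * indicator {0..u} v) \<partial>lborel) = ennreal (\<theta> powr \<gamma> / Gamma (1 - \<gamma>) * \<theta>) *
      ennreal (indicator {0..} (\<theta> * v) * (\<theta> * v) powr (1 - \<gamma> - 1) / exp (\<theta> * v))"
    proof eventually_elim
      case (elim v)
      show ?case
      proof (cases "v > 0")
        case True
        have "(\<integral>\<^sup>+u. ennreal (indicator {0<..} u * (c * u powr (- 1 - \<gamma>))) *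
            (ennreal (\<theta> * exp (- \<theta> * v)) * indicator {0..u} v) \<partial>lborel) =
          (\<integral>\<^sup>+u. ennreal (c * \<theta> * exp (- \<theta> * v)) * (ennreal (u powr (- 1 - \<gamma>)) * indicator {v..} u) \<partial>lborel)"
          using True c \<theta> by (intro nn_integral_cong) (auto split: split_indicator simp: ennreal_mult'[symmetric] mult_ac)
        also have "\<dots> = ennreal (c * \<theta> * exp (- \<theta> * v) * (v powr (- \<gamma>) / \<gamma>))"
          using True c \<theta> \<gamma> by (subst nn_integral_cmult) (auto simp: nn_integral_powr_tail ennreal_mult'[symmetric])
        also have "c * \<theta> * exp (- \<theta> * v) * (v powr (- \<gamma>) / \<gamma>) =
            \<theta> powr \<gamma> / Gamma (1 - \<gamma>) * \<theta> * ((\<theta> * v) powr (1 - \<gamma> - 1) / exp (\<theta> * v))"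
          using True \<theta> \<gamma> G by (simp add: c_def powr_mult powr_minus exp_minus field_simps)
        finally show ?thesis using True \<theta> \<gamma> G by (simp add: ennreal_mult'[symmetric])
      next
        case False
        then have "v < 0" using elim by simp
        then have "\<not> 0 \<le> \<theta> * v" using \<theta> by (simp add: mult_less_0_iff not_le)
        with \<open>v < 0\<close> show ?thesis by simp
      qed
    qed
  qed
  also have "\<dots> = ennreal (\<theta> powr \<gamma> / Gamma (1 - \<gamma>)) * (ennreal \<bar>\<theta>\<bar> *
      (\<integral>\<^sup>+v. ennreal (indicator {0..} (0 + \<theta> * v) * (0 + \<theta> * v) powr (1 - \<gamma> - 1) / exp (0 + \<theta> * v)) \<partial>lborel))"
  proof -
    have "ennreal (\<theta> powr \<gamma> / Gamma (1 - \<gamma>) * \<theta>) = ennreal (\<theta> powr \<gamma> / Gamma (1 - \<gamma>)) * ennreal \<bar>\<theta>\<bar>"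
      using \<theta> G by (subst ennreal_mult [symmetric]) auto
    then show ?thesis by (subst nn_integral_cmult) (auto simp: mult.assoc)
  qed
  also have "\<dots> = ennreal (\<theta> powr \<gamma> / Gamma (1 - \<gamma>)) *
      (\<integral>\<^sup>+v. ennreal (indicator {0..} v * v powr (1 - \<gamma> - 1) / exp v) \<partial>lborel)"
    using \<theta> by (subst nn_integral_real_affine[of _ \<theta> 0, symmetric]) auto
  also have "\<dots> = ennreal (\<theta> powr \<gamma>)"
    using \<gamma> less_imp_neq[OF G, THEN not_sym] by (subst Gamma_conv_nn_integral_real[symmetric]) (auto simp flip: ennreal_mult')
  finally have nn: "(\<integral>\<^sup>+u. ennreal (1 - exp (- \<theta> * u)) \<partial>stable_levy_measure \<gamma>) = ennreal (\<theta> powr \<gamma>)" .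
  have "AE u in stable_levy_measure \<gamma>. 0 \<le> 1 - exp (- \<theta> * u)"
    unfolding stable_levy_measure_def using \<theta> by (subst AE_density) (auto split: split_indicator)
  with nn show ?thesis
    by (intro has_bochner_integral_nn_integral) (auto simp: stable_levy_measure_def)
qed

text \<open>
  A weight comparable to \<open>min (sqrt u) 1\<close> whose integrals against \<open>exp (- n u)\<close> are explicit in
  terms of the Laplace exponent.
\<close>

definition sqrt_weight :: "real \<Rightarrow> real" where
  "sqrt_weight u = (\<Sum>k. (1/2) ^ k * (1 - exp (- (4 ^ k) * max 0 u)))"

lemma sqrt_weight_term_bounds:
  "0 \<le> (1/2) ^ k * (1 - exp (- (4 ^ k) * max 0 u))" "(1/2) ^ k * (1 - exp (- (4 ^ k) * max 0 u)) \<le> (1/2::real) ^ k"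
proof -
  have "exp (- (4 ^ k) * max 0 u) \<le> 1" by simp
  then show "0 \<le> (1/2) ^ k * (1 - exp (- (4 ^ k) * max 0 u))" by simp
  show "(1/2) ^ k * (1 - exp (- (4 ^ k) * max 0 u)) \<le> (1/2::real) ^ k"
    by (intro mult_left_le) auto
qed

lemma summable_sqrt_weight: "summable (\<lambda>k. (1/2) ^ k * (1 - exp (- (4 ^ k) * max 0 u)) :: real)"
  by (rule summable_comparison_test'[of "\<lambda>k. (1/2) ^ k" 0])
    (use sqrt_weight_term_bounds in \<open>auto simp: abs_mult\<close>)

lemma sqrt_weight_nonneg: "0 \<le> sqrt_weight u"
  unfolding sqrt_weight_def by (intro suminf_nonneg summable_sqrt_weight sqrt_weight_term_bounds)

text \<open>Clipping by \<open>max 0 u\<close> keeps the terms below (1/2)^k for negative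
  \<open>u\<close> too, so the Weierstrass test works on the whole line.\<close>

lemma continuous_sqrt_weight: "continuous_on UNIV sqrt_weight"
proof -
  have "uniform_limit UNIV (\<lambda>n u. \<Sum>k<n. (1/2) ^ k * (1 - exp (- (4 ^ k) * max 0 u)))
      (\<lambda>u. \<Sum>k. (1/2) ^ k * (1 - exp (- (4 ^ k) * max 0 u) :: real)) sequentially"
    by (rule Weierstrass_m_test[of _ _ "\<lambda>k. (1/2) ^ k"])
      (use sqrt_weight_term_bounds in \<open>auto simp: abs_mult\<close>)
  then show ?thesis
    unfolding sqrt_weight_def
    by (rule uniform_limit_theorem [rotated]) (auto intro!: continuous_intros always_eventually)
qed

text \<open>One term is enough. For the first k with 4^k u at least 1 the k-th term is at least
  (1/2)^k / 2, while minimality of k gives sqrt u at most 2 (1/2)^k. The quotient is the factor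
  4.\<close>

lemma sqrt_le_sqrt_weight:
  assumes "0 < u"
  shows "min (sqrt u) 1 \<le> 4 * sqrt_weight u"
proof -
  have half: "exp (- 1) \<le> (1/2 :: real)"
    using exp_ge_add_one_self[of "1::real"] by (simp add: exp_minus field_simps)
  have ge: "(1/2) ^ k * (1 / 2) \<le> sqrt_weight u" if "1 \<le> 4 ^ k * u" for k
  proof -
    have "exp (- (4 ^ k) * max 0 u) \<le> exp (- 1)" using that assms by simp
    then have "1 / 2 \<le> 1 - exp (- (4 ^ k) * max 0 u)" using half by linarith
    then have "(1/2) ^ k * (1 / 2) \<le> (1/2) ^ k * (1 - exp (- (4 ^ k) * max 0 u))"
      by (rule mult_left_mono) simp
    also have "\<dots> = (\<Sum>j\<in>{k}. (1/2) ^ j * (1 - exp (- (4 ^ j) * max 0 u)))" by simp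
    also have "\<dots> \<le> sqrt_weight u"
      unfolding sqrt_weight_def
      by (rule sum_le_suminf[OF summable_sqrt_weight]) (use sqrt_weight_term_bounds in auto)
    finally show ?thesis .
  qed
  show ?thesis
  proof (cases "u \<ge> 1")
    case True
    with ge[of 0] show ?thesis by simp
  next
    case False
    have "\<exists>k. 1 \<le> 4 ^ k * u"
      using real_arch_pow[of 4 "1 / u"] assms by (auto simp: field_simps intro: less_imp_le)
    define k where "k = (LEAST k. 1 \<le> 4 ^ k * u)"
    have k: "1 \<le> 4 ^ k * u" unfolding k_def using \<open>\<exists>k. _\<close> by (rule LeastI_ex)
    have "k \<noteq> 0" using k False by (metis mult_1 power_0)
    then obtain l where l: "k = Suc l" by (cases k) auto
    have "\<not> 1 \<le> 4 ^ l * u" using not_less_Least[of l "\<lambda>k. 1 \<le> 4 ^ k * u"] l unfolding k_def by auto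
    then have "u \<le> 1 / 4 ^ l" by (simp add: field_simps)
    then have "sqrt u \<le> sqrt (1 / 4 ^ l)" by simp
    also have "\<dots> = (1 / 2) ^ l"
      using power_mult_distrib[of 2 "2::real" l] by (intro real_sqrt_unique) (auto simp: power2_eq_square power_divide)
    finally show ?thesis using ge[OF k] by (simp add: l)
  qed
qed

text \<open>The product of exp (- n u) with 1 - exp (- 4^k u) is a difference of two functions 1 -
  exp (- \<theta> u), at \<theta> = n + 4^k and at \<theta> = n. The exponent \<open_psi> is left
  abstract so that one computation serves both the law at a fixed time and the Levy measure.\<close>

lemma has_bochner_integral_sqrt_weight:
  fixes \<nu> :: "real measure"
  assumes nonneg: "AE u in \<nu>. 0 \<le> u" and sets: "sets \<nu> = sets borel"
    and lap: "\<And>\<theta>. \<theta> \<ge> 0 \<Longrightarrow> has_bochner_integral \<nu> (\<lambda>u. 1 - exp (- \<theta> * u)) (\<psi> \<theta>)"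
    and summ: "summable (\<lambda>k. (1/2) ^ k * (\<psi> (real n + 4 ^ k) - \<psi> (real n)))"
  shows "has_bochner_integral \<nu> (\<lambda>u. exp (- real n * u) * sqrt_weight u)
    (\<Sum>k. (1/2) ^ k * (\<psi> (real n + 4 ^ k) - \<psi> (real n)))"
proof -
  define F where "F k u = (1/2) ^ k * ((1 - exp (- (real n + 4 ^ k) * u)) - (1 - exp (- real n * u)))" for k u
  have F: "has_bochner_integral \<nu> (F k) ((1/2) ^ k * (\<psi> (real n + 4 ^ k) - \<psi> (real n)))" for k
    unfolding F_def by (intro has_bochner_integral_mult_right has_bochner_integral_diff lap) auto
  have F_meas [measurable]: "F k \<in> borel_measurable \<nu>" for k
    using F by (rule borel_measurable_has_bochner_integral)
  have F_eq: "F k u = exp (- real n * u) * ((1/2) ^ k * (1 - exp (- (4 ^ k) * max 0 u)))" if "u \<ge> 0" for k u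
    using that by (simp add: F_def ring_distribs exp_add[symmetric] exp_diff[symmetric])
  have F_nonneg: "F k u \<ge> 0" if "u \<ge> 0" for k u
    unfolding F_eq[OF that] using sqrt_weight_term_bounds(1)[of k u] by (intro mult_nonneg_nonneg) auto
  have abs: "(\<integral>u. norm (F k u) \<partial>\<nu>) = (1/2) ^ k * (\<psi> (real n + 4 ^ k) - \<psi> (real n))" for k
  proof -
    have "(\<integral>u. norm (F k u) \<partial>\<nu>) = (\<integral>u. F k u \<partial>\<nu>)"
    proof (rule integral_cong_AE)
      show "AE u in \<nu>. norm (F k u) = F k u"
        using nonneg by eventually_elim (simp add: F_nonneg)
    qed auto
    then show ?thesis using F by (simp add: has_bochner_integral_iff)
  qed
  have sF: "summable (\<lambda>k. F k u)" "(\<Sum>k. F k u) = exp (- real n * u) * sqrt_weight u" if "u \<ge> 0" for u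
    unfolding F_eq[OF that] sqrt_weight_def
    by (intro summable_mult summable_sqrt_weight) (rule suminf_mult[OF summable_sqrt_weight])
  have *: "integrable \<nu> (\<lambda>u. \<Sum>k. F k u)" "integral\<^sup>L \<nu> (\<lambda>u. \<Sum>k. F k u) = (\<Sum>k. integral\<^sup>L \<nu> (F k))"
  proof -
    have i: "\<And>k. integrable \<nu> (F k)" using F by (auto simp: has_bochner_integral_iff)
    have s: "AE u in \<nu>. summable (\<lambda>k. norm (F k u))"
      using nonneg by eventually_elim (use sF F_nonneg in simp)
    have s': "summable (\<lambda>k. \<integral>u. norm (F k u) \<partial>\<nu>)" unfolding abs by (rule summ)
    show "integrable \<nu> (\<lambda>u. \<Sum>k. F k u)" by (rule integrable_suminf[OF i s s'])
    show "integral\<^sup>L \<nu> (\<lambda>u. \<Sum>k. F k u) = (\<Sum>k. integral\<^sup>L \<nu> (F k))" by (rule integral_suminf[OF i s s'])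
  qed
  have "has_bochner_integral \<nu> (\<lambda>u. \<Sum>k. F k u) (\<Sum>k. (1/2) ^ k * (\<psi> (real n + 4 ^ k) - \<psi> (real n)))"
    using * F by (simp add: has_bochner_integral_iff)
  moreover have "AE u in \<nu>. (\<Sum>k. F k u) = exp (- real n * u) * sqrt_weight u"
    using nonneg by eventually_elim (simp add: sF)
  ultimately show ?thesis
    using borel_measurable_continuous_onI[OF continuous_sqrt_weight] sets
    by (subst has_bochner_integral_cong_AE[symmetric]) (auto intro: borel_measurable_has_bochner_integral cong: measurable_cong_sets)
qed

section \<open>The small-time limit of the stable law against monotone functions\<close>

lemma weight_ratio_measurable:
  fixes h :: "real \<Rightarrow> real"
  assumes "mono h"
  shows "(\<lambda>u. if u \<le> 0 then 0 else h u / sqrt_weight u) \<in> borel_measurable borel"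
  using borel_measurable_mono[OF assms] borel_measurable_continuous_onI[OF continuous_sqrt_weight]
  by measurable

text \<open>Tilted by the weight and normalised, the law at time \<open>t i\<close> and the Levy
  measure become probability measures. Their Laplace transforms at n are quotients of the series at
  n by the series at 0, which converge by dominated summation. The resulting weak convergence is
  tested on \<open>h\<close> divided by the weight, a bounded function because \<open>h\<close> is
  at most C min (sqrt u) 1.\<close>

lemma stable_small_time_seq:
  fixes \<mu> :: "real \<Rightarrow> real measure" and h :: "real \<Rightarrow> real" and t :: "nat \<Rightarrow> real"
  assumes \<gamma>: "0 < \<gamma>" "\<gamma> < 1 / 2"
    and t: "\<And>i. t i > 0" "t \<longlonglongrightarrow> 0"
    and \<mu>: "\<And>t. t > 0 \<Longrightarrow> real_distribution (\<mu> t)" "\<And>t. t > 0 \<Longrightarrow> AE x in \<mu> t. 0 \<le> x"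
    and lap: "\<And>t \<theta>. t > 0 \<Longrightarrow> \<theta> > 0 \<Longrightarrow> (\<integral>x. exp (- \<theta> * x) \<partial>\<mu> t) = exp (- t * \<theta> powr \<gamma>)"
    and h: "mono h" "\<And>x. x \<le> 0 \<Longrightarrow> h x = 0" "\<And>x. h x \<le> C" "\<And>x. x \<ge> 0 \<Longrightarrow> h x \<le> C * sqrt x"
  shows "(\<lambda>i. (\<integral>x. h x \<partial>\<mu> (t i)) / t i)
      \<longlonglongrightarrow> \<gamma> / Gamma (1 - \<gamma>) * (LINT u:{0<..}|lborel. h u * u powr (- 1 - \<gamma>))"
proof -
  \<comment> \<open>The ratio of the dominating geometric series: the weight contributes (1/2)^k and
    the exponent at 4^k contributes (4^\<gamma>)^k. It is below 1 precisely for \<gamma> < 1 /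
    2.\<close>
  define \<rho> where "\<rho> = 4 powr \<gamma> / (2::real)"
  have "4 powr \<gamma> < (4::real) powr (1 / 2)" using \<gamma> by (intro powr_less_mono) auto
  then have \<rho>: "0 < \<rho>" "\<rho> < 1" by (auto simp: \<rho>_def powr_half_sqrt)
  define \<psi> where "\<psi> t \<theta> = 1 - exp (- t * \<theta> powr \<gamma>)" for t \<theta>
  \<comment> \<open>\<open>B n k\<close> and \<open>A s n k\<close> are the integrals of exp (- n u)
    times the k-th term of the weight, against the Levy measure and against the law at time s
    respectively.\<close>
  define B where "B n k = (1/2) ^ k * ((real n + 4 ^ k) powr \<gamma> - real n powr \<gamma>)" for n k
  define A where "A t n k = (1/2) ^ k * (\<psi> t (real n + 4 ^ k) - \<psi> t (real n))" for t n k
  have B_le: "0 \<le> B n k" "B n k \<le> (real n + 1) powr \<gamma> * \<rho> ^ k" for n k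
  proof -
    have "(real n + 4 ^ k) powr \<gamma> - real n powr \<gamma> \<le> (real n + 4 ^ k) powr \<gamma>" by simp
    also have "\<dots> \<le> ((real n + 1) * 4 ^ k) powr \<gamma>"
      using \<gamma> by (intro powr_mono2) (auto simp: distrib_right mult_le_cancel_left1)
    also have "\<dots> = (real n + 1) powr \<gamma> * (4 powr \<gamma>) ^ k"
      by (simp add: powr_mult powr_powr mult.commute flip: powr_realpow)
    finally have "B n k \<le> (1/2) ^ k * ((real n + 1) powr \<gamma> * (4 powr \<gamma>) ^ k)"
      unfolding B_def by (intro mult_left_mono) auto
    then show "B n k \<le> (real n + 1) powr \<gamma> * \<rho> ^ k"
      by (simp add: \<rho>_def power_divide)
    show "0 \<le> B n k" unfolding B_def using \<gamma> by (intro mult_nonneg_nonneg) (auto intro!: powr_mono2)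
  qed
  have summ_bound: "summable (\<lambda>k. (real n + 1) powr \<gamma> * \<rho> ^ k)" for n :: nat
    using \<rho> by (intro summable_mult summable_geometric) auto
  have summB: "summable (B n)" for n
    by (rule summable_comparison_test'[OF summ_bound[of n], of 0]) (use B_le in auto)
  \<comment> \<open>The inequality 1 - exp (- x) \<le> x bounds the quotient by its limit for every
    s, which is the domination that Tannery's theorem asks for.\<close>
  have A_le: "0 \<le> A s n k" "A s n k / s \<le> B n k" if "s > 0" for s n k
  proof -
    define a where "a = real n powr \<gamma>"
    define b where "b = (real n + 4 ^ k) powr \<gamma>"
    have ab: "0 \<le> a" "a \<le> b" unfolding a_def b_def using \<gamma> by (auto intro!: powr_mono2)
    have eq: "\<psi> s (real n + 4 ^ k) - \<psi> s (real n) = exp (- s * a) * (1 - exp (- s * (b - a)))"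
      by (simp add: \<psi>_def a_def b_def ring_distribs exp_add[symmetric])
    have le: "1 - exp (- s * (b - a)) \<le> s * (b - a)"
      using exp_ge_add_one_self[of "- s * (b - a)"] by simp
    have "0 \<le> 1 - exp (- s * (b - a))" using that ab by simp
    then show "0 \<le> A s n k" unfolding A_def eq by simp
    have "exp (- s * a) * (1 - exp (- s * (b - a))) \<le> 1 * (s * (b - a))"
      using le ab that by (intro mult_mono) auto
    then have "A s n k \<le> (1/2) ^ k * (s * (b - a))"
      unfolding A_def eq by (intro mult_left_mono) auto
    then show "A s n k / s \<le> B n k" using that by (simp add: B_def a_def b_def field_simps)
  qed
  have A_lim: "(\<lambda>i. A (t i) n k / t i) \<longlonglongrightarrow> B n k" for n k
  proof -
    have "(\<lambda>i. (1 - exp (- t i * a)) / t i) \<longlonglongrightarrow> a" for a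
    proof -
      have "((\<lambda>s. 1 - exp (- s * a)) has_real_derivative a) (at 0)"
        by (auto intro!: derivative_eq_intros)
      then have "((\<lambda>s. (1 - exp (- s * a)) / s) \<longlongrightarrow> a) (at 0)"
        by (simp add: has_field_derivative_iff)
      moreover have "filterlim t (at 0) sequentially"
        using t by (auto simp: filterlim_at less_imp_neq[THEN not_sym])
      ultimately show ?thesis by (rule filterlim_compose)
    qed
    note * = this
    have "(\<lambda>i. (1/2) ^ k * ((1 - exp (- t i * (real n + 4 ^ k) powr \<gamma>)) / t i - (1 - exp (- t i * real n powr \<gamma>)) / t i))
        \<longlonglongrightarrow> B n k"
      unfolding B_def by (intro tendsto_intros *)
    then show ?thesis by (simp add: A_def \<psi>_def diff_divide_distrib right_diff_distrib)
  qed
  have tannery: "(\<lambda>i. (\<Sum>k. A (t i) n k / t i)) \<longlonglongrightarrow> (\<Sum>k. B n k)" for n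
  proof -
    have "eventually (\<lambda>(k, i). norm (A (t i) n k / t i) \<le> (real n + 1) powr \<gamma> * \<rho> ^ k) (at_top \<times>\<^sub>F sequentially)"
    proof (rule always_eventually, clarify)
      fix k i
      show "norm (A (t i) n k / t i) \<le> (real n + 1) powr \<gamma> * \<rho> ^ k"
        using A_le[OF t(1), of i n k] B_le[of n k] t(1)[of i] by simp
    qed
    from tannerys_theorem[OF A_lim this summ_bound] show ?thesis by simp
  qed
  have summA: "summable (A s n)" if "s > 0" for s n
  proof (rule summable_comparison_test'[OF summable_mult[OF summB[of n], of s], of 0])
    fix k show "norm (A s n k) \<le> s * B n k" using A_le[OF that, of n k] that by (simp add: field_simps)
  qed
  have int\<mu>: "has_bochner_integral (\<mu> s) (\<lambda>u. exp (- real n * u) * sqrt_weight u) (\<Sum>k. A s n k)"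
    if s: "s > 0" for s n
    unfolding A_def
  proof (rule has_bochner_integral_sqrt_weight[OF \<mu>(2)[OF s]])
    interpret M: real_distribution "\<mu> s" using \<mu>(1)[OF s] .
    show "sets (\<mu> s) = sets borel" by simp
    show "summable (\<lambda>k. (1 / 2) ^ k * (\<psi> s (real n + 4 ^ k) - \<psi> s (real n)))"
      using summA[OF s, of n] by (simp add: A_def[abs_def])
    fix \<theta> :: real assume \<theta>: "\<theta> \<ge> 0"
    have "integrable (\<mu> s) (\<lambda>u. exp (- \<theta> * u))"
      by (rule M.integrable_const_bound[where B=1])
        (use \<mu>(2)[OF s] \<theta> in \<open>auto elim!: eventually_mono\<close>)
    moreover have "(\<integral>u. exp (- \<theta> * u) \<partial>\<mu> s) = exp (- s * \<theta> powr \<gamma>)"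
      using lap[OF s, of \<theta>] \<theta> M.prob_space by (cases "\<theta> = 0") auto
    ultimately show "has_bochner_integral (\<mu> s) (\<lambda>u. 1 - exp (- \<theta> * u)) (\<psi> s \<theta>)"
      using M.prob_space by (simp add: has_bochner_integral_iff \<psi>_def)
  qed
  define \<nu> where "\<nu> = stable_levy_measure \<gamma>"
  have sets\<nu> [measurable_cong, simp]: "sets \<nu> = sets borel" and space\<nu> [simp]: "space \<nu> = UNIV"
    by (simp_all add: \<nu>_def stable_levy_measure_def)
  have \<nu>_pos: "AE u in \<nu>. 0 < u"
    unfolding \<nu>_def stable_levy_measure_def by (subst AE_density) (auto split: split_indicator)
  have int\<nu>: "has_bochner_integral \<nu> (\<lambda>u. exp (- real n * u) * sqrt_weight u) (\<Sum>k. B n k)" for n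
    unfolding B_def
  proof (rule has_bochner_integral_sqrt_weight)
    show "AE u in \<nu>. 0 \<le> u" using \<nu>_pos by eventually_elim simp
    show "summable (\<lambda>k. (1 / 2) ^ k * ((real n + 4 ^ k) powr \<gamma> - real n powr \<gamma>))"
      using summB[of n] by (simp add: B_def[abs_def])
    show "has_bochner_integral \<nu> (\<lambda>u. 1 - exp (- \<theta> * u)) (\<theta> powr \<gamma>)" if "\<theta> \<ge> 0" for \<theta>
      unfolding \<nu>_def using \<gamma> that by (intro stable_levy_measure_laplace) auto
  qed simp
  \<comment> \<open>The case n = 0 gives the total mass of the weight, which is the normalising
    constant of the tilt.\<close>
  define a where "a s = (\<Sum>k. A s 0 k)" for s
  define a' where "a' = (\<Sum>k. B 0 k)"
  have a_pos: "a s > 0" if s: "s > 0" for s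
  proof -
    have "0 < A s 0 0" using s by (simp add: A_def \<psi>_def)
    then show ?thesis unfolding a_def
      by (intro suminf_pos2[OF summA[OF s], of _ 0]) (use A_le s in auto)
  qed
  have a'_pos: "a' > 0"
  proof -
    have "0 < B 0 0" by (simp add: B_def)
    then show ?thesis unfolding a'_def
      by (intro suminf_pos2[OF summB, of _ 0]) (use B_le in auto)
  qed
  have w_meas [measurable]: "sqrt_weight \<in> borel_measurable borel"
    by (rule borel_measurable_continuous_onI[OF continuous_sqrt_weight])
  define M where "M s = density (\<mu> s) (\<lambda>u. ennreal (sqrt_weight u / a s))" for s
  define M' where "M' = density \<nu> (\<lambda>u. ennreal (sqrt_weight u / a'))"
  have distr: "real_distribution (density N (\<lambda>u. ennreal (sqrt_weight u / c)))"
    if "sets N = sets borel" "has_bochner_integral N (\<lambda>u. exp (- real 0 * u) * sqrt_weight u) c" "c > 0"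
    for N :: "real measure" and c
  proof -
    have [measurable_cong]: "sets N = sets borel" by fact
    have "emeasure (density N (\<lambda>u. ennreal (sqrt_weight u / c))) (space N) = (\<integral>\<^sup>+u. ennreal (sqrt_weight u / c) \<partial>N)"
      by (subst emeasure_density) (auto intro!: nn_integral_cong)
    also have "\<dots> = ennreal (c / c)"
      using that by (subst nn_integral_eq_integral) (auto simp: has_bochner_integral_iff sqrt_weight_nonneg)
    finally have "prob_space (density N (\<lambda>u. ennreal (sqrt_weight u / c)))"
      using that(3) by (intro prob_spaceI) simp
    then show ?thesis using that(1)
      by (auto simp: real_distribution_def real_distribution_axioms_def)
  qed
  have M: "real_distribution (M s)" if "s > 0" for s
    unfolding M_def using \<mu>(1)[OF that] int\<mu>[OF that, of 0] a_pos[OF that]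
    by (intro distr) (auto simp: a_def real_distribution.events_eq_borel)
  have M': "real_distribution M'"
    unfolding M'_def using int\<nu>[of 0] a'_pos by (intro distr) (auto simp: a'_def)
  have weak: "weak_conv_m (\<lambda>i. M (t i)) M'"
  proof (rule laplace_conv_imp_weak_conv)
    show "AE x in M (t i). 0 \<le> x" for i
      using \<mu>(2)[OF t(1), of i] real_distribution.events_eq_borel[OF \<mu>(1)[OF t(1), of i]] unfolding M_def
      by (subst AE_density) (auto elim!: eventually_mono cong: measurable_cong_sets)
    show "AE x in M'. 0 \<le> x"
      using \<nu>_pos unfolding M'_def by (subst AE_density) (auto elim!: eventually_mono)
    fix n
    have 1: "(\<integral>x. exp (- (real n * x)) \<partial>M (t i)) = (\<Sum>k. A (t i) n k / t i) / (\<Sum>k. A (t i) 0 k / t i)" for i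
    proof -
      note ti = t(1)[of i]
      have [measurable_cong]: "sets (\<mu> (t i)) = sets borel" using \<mu>(1)[OF ti] by (rule real_distribution.events_eq_borel)
      have "(\<integral>x. exp (- (real n * x)) \<partial>M (t i)) = (\<integral>x. (exp (- real n * x) * sqrt_weight x) / a (t i) \<partial>\<mu> (t i))"
        unfolding M_def using a_pos[OF ti] by (subst integral_density) (auto simp: sqrt_weight_nonneg mult.commute)
      also have "\<dots> = (\<Sum>k. A (t i) n k) / a (t i)"
        using int\<mu>[OF ti, of n] by (simp add: has_bochner_integral_iff)
      finally show ?thesis using ti summA[OF ti] by (simp add: a_def suminf_divide)
    qed
    have 2: "(\<integral>x. exp (- (real n * x)) \<partial>M') = (\<Sum>k. B n k) / (\<Sum>k. B 0 k)"
    proof -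
      have "(\<integral>x. exp (- (real n * x)) \<partial>M') = (\<integral>x. (exp (- real n * x) * sqrt_weight x) / a' \<partial>\<nu>)"
        unfolding M'_def using a'_pos by (subst integral_density) (auto simp: sqrt_weight_nonneg mult.commute)
      also have "\<dots> = (\<Sum>k. B n k) / a'"
        using int\<nu>[of n] by (simp add: has_bochner_integral_iff)
      finally show ?thesis by (simp add: a'_def)
    qed
    show "(\<lambda>i. \<integral>x. exp (- (real n * x)) \<partial>M (t i)) \<longlonglongrightarrow> (\<integral>x. exp (- (real n * x)) \<partial>M')"
      unfolding 1 2 using a'_pos by (intro tendsto_divide tannery) (auto simp: a'_def)
  qed (use M M' t in auto)
  \<comment> \<open>The weight vanishes at 0, so the quotient is set to 0 there; \<open>f_w\<close>
    shows that multiplying back recovers \<open>h\<close> on the half line, since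
    \<open>h 0 = 0\<close>.\<close>
  define f where "f u = (if u \<le> 0 then 0 else h u / sqrt_weight u)" for u
  have h_nonneg: "0 \<le> h u" for u using h(1,2) by (metis linear monoD order_refl)
  have f_bound: "norm (f u) \<le> 4 * C" for u
  proof (cases "u > 0")
    case True
    have "0 \<le> C" using h_nonneg h(3) order_trans by blast
    have "0 < min (sqrt u) 1" using True by simp
    then have w: "sqrt_weight u > 0" using sqrt_le_sqrt_weight[OF True] by linarith
    have "h u \<le> C * min (sqrt u) 1" using h(3)[of u] h(4)[of u] True by (auto simp: min_def)
    also have "\<dots> \<le> C * (4 * sqrt_weight u)"
      using sqrt_le_sqrt_weight[OF True] \<open>0 \<le> C\<close> by (intro mult_left_mono)
    finally show ?thesis using True h_nonneg[of u] w by (simp add: f_def field_simps)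
  next
    case False
    have "0 \<le> C" using h_nonneg h(3) order_trans by blast
    then show ?thesis using False by (simp add: f_def)
  qed
  have f_w: "f u * sqrt_weight u = h u" if "u \<ge> 0" for u
  proof (cases "u = 0")
    case False
    with that have "0 < u" by simp
    then have "0 < min (sqrt u) 1" by simp
    then have "sqrt_weight u > 0" using sqrt_le_sqrt_weight[OF \<open>0 < u\<close>] by linarith
    then show ?thesis using \<open>0 < u\<close> by (simp add: f_def)
  qed (use h in \<open>simp add: f_def\<close>)
  have f_meas [measurable]: "f \<in> borel_measurable borel"
    unfolding f_def using weight_ratio_measurable[OF h(1)] .
  have h_meas [measurable]: "h \<in> borel_measurable borel" using h(1) by (rule borel_measurable_mono)
  \<comment> \<open>Away from 0 the quotient is continuous wherever \<open>h\<close> is. A monotone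
    \<open>h\<close> has countably many discontinuities, and the limit has a Lebesgue density, so
    the exceptional set is null.\<close>
  have null: "emeasure M' {x. \<not> isCont f x} = 0"
  proof -
    have sub: "{x. \<not> isCont f x} \<subseteq> insert 0 {x. \<not> isCont h x}"
    proof (rule subsetI, rule ccontr)
      fix x assume "x \<in> {x. \<not> isCont f x}" "x \<notin> insert 0 {x. \<not> isCont h x}"
      then have x: "x \<noteq> 0" "\<not> isCont f x" "isCont h x" by auto
      have "isCont f x"
      proof (cases "x < 0")
        case True
        then have "eventually (\<lambda>y. f y = 0) (nhds x)"
          by (intro eventually_mono[OF eventually_nhds_in_open[of "{..<0}"]]) (auto simp: f_def)
        then show ?thesis by (subst isCont_cong) auto
      next
        case False
        with x have "0 < x" by simp
        then have "0 < min (sqrt x) 1" by simp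
        then have "sqrt_weight x \<noteq> 0" using sqrt_le_sqrt_weight[OF \<open>0 < x\<close>] by linarith
        moreover have "isCont sqrt_weight x" using continuous_sqrt_weight by (simp add: continuous_on_eq_continuous_at)
        ultimately have "isCont (\<lambda>u. h u / sqrt_weight u) x" using x by (intro continuous_divide) auto
        moreover have "eventually (\<lambda>y. f y = h y / sqrt_weight y) (nhds x)"
          using \<open>0 < x\<close> by (intro eventually_mono[OF eventually_nhds_in_open[of "{0<..}"]]) (auto simp: f_def)
        ultimately show ?thesis by (subst isCont_cong) auto
      qed
      with x show False by simp
    qed
    have ctbl: "countable {x. \<not> isCont f x}"
      by (rule countable_subset[OF sub]) (use mono_ctble_discont[OF h(1)] in simp)
    then have lb: "{x. \<not> isCont f x} \<in> null_sets lborel" by (rule countable_imp_null_set_lborel)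
    then have "{x. \<not> isCont f x} \<in> null_sets \<nu>"
      unfolding \<nu>_def stable_levy_measure_def
      by (rule absolutely_continuousI_density[unfolded absolutely_continuous_def, THEN subsetD, rotated]) simp
    then have "{x. \<not> isCont f x} \<in> null_sets M'"
      unfolding M'_def
      by (rule absolutely_continuousI_density[unfolded absolutely_continuous_def, THEN subsetD, rotated]) simp
    then show ?thesis by auto
  qed
  have lim_f: "(\<lambda>i. \<integral>u. f u \<partial>M (t i)) \<longlonglongrightarrow> (\<integral>u. f u \<partial>M')"
    by (rule weak_conv_imp_bdd_ae_continuous_conv[where B="4 * C"])
      (use M M' t weak null f_bound in auto)
  \<comment> \<open>The tilt is undone: the integral of \<open>h\<close> over \<open>t\<close> is
    the mass of the weight over \<open>t\<close>, which converges by itself, times an integral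
    against a tilted probability law.\<close>
  have 1: "(\<integral>u. h u \<partial>\<mu> (t i)) / t i = (\<Sum>k. A (t i) 0 k / t i) * (\<integral>u. f u \<partial>M (t i))" for i
  proof -
    note ti = t(1)[of i]
    have [measurable_cong]: "sets (\<mu> (t i)) = sets borel" using \<mu>(1)[OF ti] by (rule real_distribution.events_eq_borel)
    have "(\<integral>u. f u \<partial>M (t i)) = (\<integral>u. (f u * sqrt_weight u) / a (t i) \<partial>\<mu> (t i))"
      unfolding M_def using a_pos[OF ti] by (subst integral_density) (auto simp: sqrt_weight_nonneg mult.commute)
    also have "\<dots> = (\<integral>u. h u / a (t i) \<partial>\<mu> (t i))"
    proof (rule integral_cong_AE)
      show "AE u in \<mu> (t i). f u * sqrt_weight u / a (t i) = h u / a (t i)"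
        using \<mu>(2)[OF ti] by eventually_elim (simp add: f_w)
    qed auto
    finally show ?thesis using ti summA[OF ti] a_pos[OF ti] by (simp add: a_def suminf_divide)
  qed
  have 2: "\<gamma> / Gamma (1 - \<gamma>) * (LINT u:{0<..}|lborel. h u * u powr (- 1 - \<gamma>)) = (\<Sum>k. B 0 k) * (\<integral>u. f u \<partial>M')"
  proof -
    have G: "Gamma (1 - \<gamma>) > 0" using \<gamma> by (intro Gamma_real_pos) auto
    have "(\<integral>u. f u \<partial>M') = (\<integral>u. (f u * sqrt_weight u) / a' \<partial>\<nu>)"
      unfolding M'_def using a'_pos by (subst integral_density) (auto simp: sqrt_weight_nonneg mult.commute)
    also have "\<dots> = (\<integral>u. h u / a' \<partial>\<nu>)"
    proof (rule integral_cong_AE)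
      show "AE u in \<nu>. f u * sqrt_weight u / a' = h u / a'"
        using \<nu>_pos by eventually_elim (simp add: f_w)
    qed auto
    also have "\<dots> = (\<integral>u. h u \<partial>\<nu>) / a'" by simp
    also have "(\<integral>u. h u \<partial>\<nu>) = (\<integral>u. (\<gamma> / Gamma (1 - \<gamma>)) * (indicator {0<..} u * (h u * u powr (- 1 - \<gamma>))) \<partial>lborel)"
      unfolding \<nu>_def stable_levy_measure_def using G \<gamma>
      by (subst integral_density) (auto simp: mult_ac intro!: Bochner_Integration.integral_cong)
    also have "\<dots> = \<gamma> / Gamma (1 - \<gamma>) * (LINT u:{0<..}|lborel. h u * u powr (- 1 - \<gamma>))"
      unfolding set_lebesgue_integral_def by simp
    finally show ?thesis using a'_pos by (simp add: a'_def)
  qed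
  show ?thesis unfolding 1 2 by (intro tendsto_mult tannery lim_f)
qed

lemma stable_small_time:
  fixes \<mu> :: "real \<Rightarrow> real measure" and h :: "real \<Rightarrow> real"
  assumes \<gamma>: "0 < \<gamma>" "\<gamma> < 1 / 2"
    and \<mu>: "\<And>t. t > 0 \<Longrightarrow> real_distribution (\<mu> t)" "\<And>t. t > 0 \<Longrightarrow> AE x in \<mu> t. 0 \<le> x"
    and lap: "\<And>t \<theta>. t > 0 \<Longrightarrow> \<theta> > 0 \<Longrightarrow> (\<integral>x. exp (- \<theta> * x) \<partial>\<mu> t) = exp (- t * \<theta> powr \<gamma>)"
    and h: "mono h" "\<And>x. x \<le> 0 \<Longrightarrow> h x = 0" "\<And>x. h x \<le> C" "\<And>x. x \<ge> 0 \<Longrightarrow> h x \<le> C * sqrt x"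
  shows "((\<lambda>t. (\<integral>x. h x \<partial>\<mu> t) / t)
      \<longlongrightarrow> \<gamma> / Gamma (1 - \<gamma>) * (LINT u:{0<..}|lborel. h u * u powr (- 1 - \<gamma>))) (at_right 0)"
  by (rule tendsto_at_right_sequentially[of _ 1], simp)
    (rule stable_small_time_seq[OF \<gamma> _ _ \<mu> lap h])

section \<open>Similitudes and Lebesgue measure\<close>

text \<open>
  Translation invariance and Fubini give \<open>(\<integral>f \<circ> Q) (\<integral>g) = (\<integral>g \<circ> Q) (\<integral>f)\<close>; for \<open>g\<close> the indicator of the unit
  ball, \<open>g \<circ> Q = g\<close> cancels.
\<close>

lemma lborel_distr_orthogonal:
  fixes Q :: "'a::euclidean_space \<Rightarrow> 'a"
  assumes Q: "orthogonal_transformation Q"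
  shows "distr lborel borel Q = lborel"
proof -
  have lin: "linear Q" and norm: "\<And>x. norm (Q x) = norm x"
    using Q by (auto simp: orthogonal_transformation_linear orthogonal_transformation_norm)
  have [measurable]: "Q \<in> borel \<rightarrow>\<^sub>M borel"
    using lin by (intro borel_measurable_continuous_onI linear_continuous_on) (simp add: linear_conv_bounded_linear)
  have shift: "(\<integral>\<^sup>+y. f (c + y) \<partial>lborel) = (\<integral>\<^sup>+y. f y \<partial>lborel)"
    if "f \<in> borel_measurable borel" for f :: "'a \<Rightarrow> ennreal" and c
    using that by (subst (2) lborel_distr_plus[of c, symmetric]) (simp add: nn_integral_distr)
  have reflect: "(\<integral>\<^sup>+y. f (c - y) \<partial>lborel) = (\<integral>\<^sup>+y. f y \<partial>lborel)"
    if [measurable]: "f \<in> borel_measurable borel" for f :: "'a \<Rightarrow> ennreal" and c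
    by (subst (2) lborel_affine[of "-1" c]) (simp_all add: nn_integral_distr nn_integral_density)
  have key: "(\<integral>\<^sup>+x. f (Q x) \<partial>lborel) * (\<integral>\<^sup>+y. g y \<partial>lborel) = (\<integral>\<^sup>+x. g (Q x) \<partial>lborel) * (\<integral>\<^sup>+y. f y \<partial>lborel)"
    if [measurable]: "f \<in> borel_measurable borel" "g \<in> borel_measurable borel" for f g :: "'a \<Rightarrow> ennreal"
  proof -
    have "(\<integral>\<^sup>+x. f (Q x) \<partial>lborel) * (\<integral>\<^sup>+y. g y \<partial>lborel) = (\<integral>\<^sup>+x. (\<integral>\<^sup>+y. f (Q x) * g (Q x + y) \<partial>lborel) \<partial>lborel)"
      by (simp add: nn_integral_cmult nn_integral_multc shift)
    also have "\<dots> = (\<integral>\<^sup>+y. (\<integral>\<^sup>+x. f (Q x) * g (Q x + y) \<partial>lborel) \<partial>lborel)"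
      by (rule lborel_pair.Fubini') simp
    also have "\<dots> = (\<integral>\<^sup>+y. (\<integral>\<^sup>+x. f (Q x - y) * g (Q x) \<partial>lborel) \<partial>lborel)"
    proof (rule nn_integral_cong)
      fix y
      \<comment> \<open>The inner integral is translated by the preimage of \<open>y\<close>, and
        linearity turns this into a translation by \<open>y\<close> after \<open>Q\<close>.\<close>
      obtain z where z: "y = Q z" using orthogonal_transformation_surj[OF Q] by (metis surjD)
      have "(\<integral>\<^sup>+x. f (Q x) * g (Q x + y) \<partial>lborel) = (\<integral>\<^sup>+x. f (Q (- z + x)) * g (Q (- z + x) + y) \<partial>lborel)"
        by (rule shift[symmetric]) simp
      also have "\<dots> = (\<integral>\<^sup>+x. f (Q x - y) * g (Q x) \<partial>lborel)"
        unfolding z using lin by (simp add: linear_add linear_neg linear_diff)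
      finally show "(\<integral>\<^sup>+x. f (Q x) * g (Q x + y) \<partial>lborel) = (\<integral>\<^sup>+x. f (Q x - y) * g (Q x) \<partial>lborel)" .
    qed
    also have "\<dots> = (\<integral>\<^sup>+x. (\<integral>\<^sup>+y. f (Q x - y) * g (Q x) \<partial>lborel) \<partial>lborel)"
      by (rule lborel_pair.Fubini') simp
    also have "\<dots> = (\<integral>\<^sup>+x. g (Q x) \<partial>lborel) * (\<integral>\<^sup>+y. f y \<partial>lborel)"
      by (simp add: nn_integral_cmult nn_integral_multc reflect mult.commute)
    finally show ?thesis .
  qed
  have "(\<integral>\<^sup>+x. f (Q x) \<partial>lborel) = (\<integral>\<^sup>+y. f y \<partial>lborel)"
    if [measurable]: "f \<in> borel_measurable borel" for f :: "'a \<Rightarrow> ennreal"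
  proof -
    define c where "c = emeasure lborel (ball (0::'a) 1)"
    have c: "c \<noteq> \<top>" "c \<noteq> 0"
      using emeasure_lborel_ball_finite[of "0::'a" 1] content_ball_pos[of 1 "0::'a"]
      by (auto simp: c_def measure_def)
    have "(\<integral>\<^sup>+x. indicator (ball 0 1) (Q x) \<partial>lborel) = c"
    proof -
      have "(\<integral>\<^sup>+x. indicator (ball 0 1) (Q x) \<partial>lborel) = (\<integral>\<^sup>+x. indicator (ball (0::'a) 1) x \<partial>lborel)"
        by (intro nn_integral_cong) (auto simp: norm indicator_def)
      then show ?thesis by (simp add: c_def)
    qed
    then have "(\<integral>\<^sup>+x. f (Q x) \<partial>lborel) * c = c * (\<integral>\<^sup>+y. f y \<partial>lborel)"
      using key[OF that borel_measurable_indicator[of "ball 0 1"]] by (simp add: c_def)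
    then have "c * (\<integral>\<^sup>+x. f (Q x) \<partial>lborel) = c * (\<integral>\<^sup>+y. f y \<partial>lborel)" by (simp add: mult.commute)
    then show ?thesis using c by (simp add: ennreal_mult_cancel_left)
  qed
  note inv = this
  show ?thesis
  proof (rule measure_eqI)
    fix A assume "A \<in> sets (distr lborel borel Q)"
    then have [measurable]: "A \<in> sets borel" by simp
    have "emeasure (distr lborel borel Q) A = (\<integral>\<^sup>+x. indicator A x \<partial>distr lborel borel Q)"
      by simp
    also have "\<dots> = emeasure lborel A" by (subst nn_integral_distr) (auto simp: inv)
    finally show "emeasure (distr lborel borel Q) A = emeasure lborel A" .
  qed simp
qed

lemma similitude_pos: "similitude r R \<Longrightarrow> r > 0"
  by (simp add: similitude_def)

lemma similitude_dist: "similitude r R \<Longrightarrow> dist (R x) (R y) = r * dist x y"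
  by (simp add: similitude_def)

text \<open>Dividing R x - R 0 by r gives an isometry that fixes the origin, and such maps are
  orthogonal.\<close>

lemma similitude_affine:
  assumes "similitude r R"
  obtains Q where "orthogonal_transformation Q" "\<And>x. R x = R 0 + r *\<^sub>R Q x"
proof
  have r: "r > 0" using assms by (rule similitude_pos)
  define Q where "Q x = (1 / r) *\<^sub>R (R x - R 0)" for x
  have "dist (Q x) (Q y) = dist x y" for x y
  proof -
    have "Q x - Q y = (1 / r) *\<^sub>R (R x - R y)" by (simp add: Q_def algebra_simps)
    then have "dist (Q x) (Q y) = (1 / r) * dist (R x) (R y)" using r by (simp add: dist_norm)
    then show ?thesis using r by (simp add: similitude_dist[OF assms])
  qed
  then show "orthogonal_transformation Q" by (simp add: orthogonal_transformation_isometry Q_def)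
  show "R x = R 0 + r *\<^sub>R Q x" for x using r by (simp add: Q_def)
qed

lemma similitude_bij:
  assumes "similitude r R"
  shows "bij R"
proof -
  from assms obtain Q where Q: "orthogonal_transformation Q" "\<And>x. R x = R 0 + r *\<^sub>R Q x"
    using similitude_affine[OF assms] by metis
  have r: "r > 0" using assms by (rule similitude_pos)
  show ?thesis
  proof (rule bijI)
    show "inj R" using r by (intro injI) (metis assms dist_eq_0_iff mult_eq_0_iff less_irrefl similitude_dist)
    show "surj R"
    proof (rule surjI)
      fix y
      have "R (inv Q ((1 / r) *\<^sub>R (y - R 0))) = R 0 + r *\<^sub>R ((1 / r) *\<^sub>R (y - R 0))"
        using Q(2) surj_f_inv_f[OF orthogonal_transformation_surj[OF Q(1)]] by metis
      then show "R (inv Q ((1 / r) *\<^sub>R (y - R 0))) = y" using r by simp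
    qed
  qed
qed

lemma similitude_inv:
  assumes "similitude r R"
  shows "similitude (1 / r) (inv R)"
proof -
  have "dist (inv R x) (inv R y) = 1 / r * dist x y" for x y
    using similitude_dist[OF assms, of "inv R x" "inv R y"] similitude_pos[OF assms]
      surj_f_inv_f[OF bij_is_surj[OF similitude_bij[OF assms]]]
    by (simp add: field_simps)
  then show ?thesis using similitude_pos[OF assms] by (simp add: similitude_def)
qed

lemma similitude_continuous:
  assumes "similitude r R"
  shows "continuous_on S R"
  unfolding continuous_on_iff
proof (intro ballI allI impI)
  fix x e assume e: "(0::real) < e"
  show "\<exists>d>0. \<forall>x'\<in>S. dist x' x < d \<longrightarrow> dist (R x') (R x) < e"
    using e similitude_pos[OF assms] by (intro exI[of _ "e / r"]) (auto simp: similitude_dist[OF assms] field_simps)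
qed

lemma similitude_image_eq_vimage:
  assumes "similitude r R"
  shows "R ` A = inv R -` A"
  using bij_vimage_eq_inv_image[OF bij_imp_bij_inv[OF similitude_bij[OF assms]], of A]
  by (simp add: inv_inv_eq[OF similitude_bij[OF assms]])

lemma similitude_open_image:
  assumes "similitude r R" "open A"
  shows "open (R ` A)"
  unfolding similitude_image_eq_vimage[OF assms(1)]
  using assms(2) similitude_continuous[OF similitude_inv[OF assms(1)]] by (rule open_vimage)

lemma similitude_measurable [measurable_dest]: "similitude r R \<Longrightarrow> R \<in> borel \<rightarrow>\<^sub>M borel"
  by (intro borel_measurable_continuous_onI similitude_continuous)

text \<open>The orthogonal part preserves Lebesgue measure, so only the scaling by r contributes. As
  an identity of measures it yields the change of variables for both kinds of integral.\<close>

lemma lborel_similitude: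
  fixes R :: "'a::euclidean_space \<Rightarrow> 'a"
  assumes "similitude r R"
  shows "lborel = density (distr lborel borel R) (\<lambda>_. ennreal (r ^ DIM('a)))"
proof -
  from assms obtain Q where Q: "orthogonal_transformation Q" "\<And>x. R x = R 0 + r *\<^sub>R Q x"
    using similitude_affine[OF assms] by metis
  have r: "r > 0" using assms by (rule similitude_pos)
  have [measurable]: "Q \<in> borel \<rightarrow>\<^sub>M borel"
    using orthogonal_transformation_linear[OF Q(1)]
    by (intro borel_measurable_continuous_onI linear_continuous_on) (simp add: linear_conv_bounded_linear)
  have "distr lborel borel R = distr (distr lborel borel Q) borel (\<lambda>x. R 0 + r *\<^sub>R x)"
    by (subst distr_distr) (auto simp: comp_def Q(2)[symmetric])
  then show ?thesis
    using lborel_affine[of r "R 0"] r by (simp add: lborel_distr_orthogonal[OF Q(1)])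
qed

lemma lborel_integral_similitude:
  fixes R :: "'a::euclidean_space \<Rightarrow> 'a" and f :: "'a \<Rightarrow> real"
  assumes R: "similitude r R" and [measurable]: "f \<in> borel_measurable borel"
  shows "(\<integral>x. f x \<partial>lborel) = r ^ DIM('a) * (\<integral>x. f (R x) \<partial>lborel)"
proof -
  note [measurable] = similitude_measurable[OF R]
  show ?thesis
    using similitude_pos[OF R]
    by (subst lborel_similitude[OF R]) (simp add: integral_density integral_distr)
qed

lemma nn_integral_similitude:
  fixes R :: "'a::euclidean_space \<Rightarrow> 'a"
  assumes R: "similitude r R" and [measurable]: "f \<in> borel_measurable borel"
  shows "(\<integral>\<^sup>+x. f x \<partial>lborel) = ennreal (r ^ DIM('a)) * (\<integral>\<^sup>+x. f (R x) \<partial>lborel)"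
proof -
  note [measurable] = similitude_measurable[OF R]
  show ?thesis
    using similitude_pos[OF R]
    by (subst lborel_similitude[OF R]) (simp add: nn_integral_density nn_integral_distr nn_integral_cmult)
qed

section \<open>Brownian motion staying in an open set\<close>

definition gauss :: "real \<Rightarrow> 'a::euclidean_space \<Rightarrow> real" where
  "gauss v y = (2 * pi * v) powr (- real DIM('a) / 2) * exp (- (norm y)\<^sup>2 / (2 * v))"

lemma gauss_measurable [measurable]: "gauss v \<in> borel_measurable borel"
  unfolding gauss_def[abs_def] by measurable

lemma gauss_nonneg: "0 \<le> gauss v y"
  by (simp add: gauss_def)

context
  fixes M :: "'w measure" and x :: "'a::euclidean_space" and X :: "real \<Rightarrow> 'w \<Rightarrow> 'a"
  assumes BM: "brownian_motion M x X"
begin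

lemma bm_prob_space: "prob_space M"
  and bm_measurable: "t \<ge> 0 \<Longrightarrow> X t \<in> borel_measurable M"
  and bm_start: "AE w in M. X 0 w = x"
  and bm_continuous: "w \<in> space M \<Longrightarrow> continuous_on {0..} (\<lambda>t. X t w)"
  and bm_indep: "independent_increments M X"
  and bm_increment: "0 \<le> s \<Longrightarrow> s < t \<Longrightarrow> distributed M lborel (\<lambda>w. X t w - X s w) (\<lambda>y. ennreal (gauss (t - s) y))"
  using BM unfolding brownian_motion_def gauss_def by auto

lemma bm_increment_distr:
  assumes "0 \<le> s" "s < t"
  shows "distr M borel (\<lambda>w. X t w - X s w) = density lborel (\<lambda>y. ennreal (gauss (t - s) y))"
  using distributed_distr_eq_density[OF bm_increment[OF assms]] by (simp cong: distr_cong)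

text \<open>Over equal time steps the increments are independent with one common law, so their joint
  law is a product. Writing the number of steps as \<open>Suc n\<close> keeps the index set
  nonempty.\<close>

lemma bm_increments_distr:
  assumes h: "h > 0"
  shows "distr M (PiM {..<Suc n} (\<lambda>_. borel)) (\<lambda>w. \<lambda>i\<in>{..<Suc n}. X (real (Suc i) * h) w - X (real i * h) w) =
    PiM {..<Suc n} (\<lambda>_. density lborel (\<lambda>y. ennreal (gauss h y)))"
proof -
  interpret prob_space M by (rule bm_prob_space)
  have [measurable]: "X (real i * h) \<in> borel_measurable M" for i
    using h by (intro bm_measurable) simp
  have 1: "distr M borel (\<lambda>w. X (real (Suc i) * h) w - X (real i * h) w) = density lborel (\<lambda>y. ennreal (gauss h y))" for i
    using bm_increment_distr[of "real i * h" "real (Suc i) * h"] h by (simp add: algebra_simps)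
  have "indep_vars (\<lambda>_. borel) (\<lambda>i w. X (real (Suc i) * h) w - X (real i * h) w) {..<Suc n}"
    using bm_indep[unfolded independent_increments_def, rule_format, of "\<lambda>i. real i * h" "Suc n"] h
    by (simp add: mult_right_mono)
  then show ?thesis
    by (subst (asm) indep_vars_iff_distr_eq_PiM) (auto simp: 1 simp del: of_nat_Suc)
qed

text \<open>The right-hand side mentions neither \<open>M\<close> nor \<open>X\<close>: the
  probability of staying in \<open>K\<close> at grid times depends only on the starting point. This
  is how Brownian motions on different spaces are compared.\<close>

lemma bm_grid_law:
  assumes h: "h > 0" and [measurable]: "K \<in> sets borel"
  shows "measure M {w\<in>space M. \<forall>i\<in>{..Suc n}. X (real i * h) w \<in> K} =
    measure (PiM {..<Suc n} (\<lambda>_. density lborel (\<lambda>y. ennreal (gauss h y))))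
      {f \<in> space (PiM {..<Suc n} (\<lambda>_. borel)). \<forall>i\<in>{..Suc n}. x + (\<Sum>j<i. f j) \<in> K}"
proof -
  interpret prob_space M by (rule bm_prob_space)
  have [measurable]: "X (real i * h) \<in> borel_measurable M" for i
    using h by (intro bm_measurable) simp
  define A where "A = {f \<in> space (PiM {..<Suc n} (\<lambda>_. borel)). \<forall>i\<in>{..Suc n}. x + (\<Sum>j<i. f j) \<in> K}"
  have A [measurable]: "A \<in> sets (PiM {..<Suc n} (\<lambda>_. borel))"
    unfolding A_def
  proof (rule sets.sets_Collect_finite_All)
    fix i assume "i \<in> {..Suc n}"
    then have [measurable]: "(\<lambda>f. f j) \<in> borel_measurable (PiM {..<Suc n} (\<lambda>_. borel :: 'a measure))" if "j < i" for j
      using that by (intro measurable_component_singleton) auto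
    have "(\<lambda>f. \<Sum>j<i. f j) \<in> borel_measurable (PiM {..<Suc n} (\<lambda>_. borel :: 'a measure))"
      by (intro borel_measurable_sum) auto
    then show "{f \<in> space (PiM {..<Suc n} (\<lambda>_. borel)). x + (\<Sum>j<i. f j) \<in> K} \<in> sets (PiM {..<Suc n} (\<lambda>_. borel))"
      by measurable
  qed auto
  define D where "D = (\<lambda>w. \<lambda>i\<in>{..<Suc n}. X (real (Suc i) * h) w - X (real i * h) w)"
  have D [measurable]: "D \<in> M \<rightarrow>\<^sub>M PiM {..<Suc n} (\<lambda>_. borel)"
    unfolding D_def by (intro measurable_restrict) (simp del: of_nat_Suc)
  have "measure M {w\<in>space M. \<forall>i\<in>{..Suc n}. X (real i * h) w \<in> K} = measure M (D -` A \<inter> space M)"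
  proof (rule finite_measure_eq_AE)
    show "AE w in M. w \<in> {w\<in>space M. \<forall>i\<in>{..Suc n}. X (real i * h) w \<in> K} \<longleftrightarrow> w \<in> D -` A \<inter> space M"
      using bm_start
    proof (rule AE_mp, intro AE_I2 impI)
      fix w assume w: "w \<in> space M" "X 0 w = x"
      have "x + (\<Sum>j<i. D w j) = X (real i * h) w" if "i \<in> {..Suc n}" for i
      proof -
        have "(\<Sum>j<i. D w j) = (\<Sum>j<i. X (real (Suc j) * h) w - X (real j * h) w)"
          using that by (intro sum.cong) (auto simp: D_def)
        also have "\<dots> = X (real i * h) w - X (real 0 * h) w" by (rule sum_lessThan_telescope)
        finally show ?thesis using w by simp
      qed
      then show "w \<in> {w\<in>space M. \<forall>i\<in>{..Suc n}. X (real i * h) w \<in> K} \<longleftrightarrow> w \<in> D -` A \<inter> space M"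
        using w measurable_space[OF D w(1)] by (auto simp: A_def)
    qed
  qed measurable
  also have "\<dots> = measure (distr M (PiM {..<Suc n} (\<lambda>_. borel)) D) A"
    by (rule measure_distr[symmetric]) auto
  finally show ?thesis unfolding D_def bm_increments_distr[OF h] A_def .
qed

end

section \<open>The event that a path stays in an open set, and its probability\<close>

abbreviation stays :: "'w measure \<Rightarrow> (real \<Rightarrow> 'w \<Rightarrow> 'a) \<Rightarrow> 'a set \<Rightarrow> real \<Rightarrow> 'w set" where
  "stays M X D u \<equiv> {w \<in> space M. \<forall>t\<in>{0..u}. X t w \<in> D}"

text \<open>Closed sets exhausting an open \<open>D\<close>: a compact path inside \<open>D\<close>
  lies in one of them, and closedness carries membership from dyadic times to all times. For
  \<open>D = UNIV\<close> the distance to the empty complement is 0 by convention and every inner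
  set is empty, hence the condition \<open>D \<noteq> UNIV\<close> below.\<close>

definition inner_set :: "'a::metric_space set \<Rightarrow> nat \<Rightarrow> 'a set" where
  "inner_set D k = {y. inverse (real (Suc k)) \<le> infdist y (- D)}"

lemma inner_set_measurable [measurable]: "inner_set D k \<in> sets borel"
proof -
  have "closed {y. inverse (real (Suc k)) \<le> infdist y (- D)}"
    by (intro closed_Collect_le continuous_intros)
  then show ?thesis by (simp add: inner_set_def)
qed

lemma inner_set_mono: "k \<le> l \<Longrightarrow> inner_set D k \<subseteq> inner_set D l"
proof -
  assume "k \<le> l"
  then have "inverse (real (Suc l)) \<le> inverse (real (Suc k))" by (intro le_imp_inverse_le) auto
  then show ?thesis unfolding inner_set_def using order_trans by blast
qed

text \<open>Forwards, compactness of [0, u] gives a positive least distance to the complement, hence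
  one level \<open>k\<close> for all times. Backwards, dyadic times are dense and the distance is
  continuous, so the same level holds at every time.\<close>

lemma path_stays_iff_grid:
  fixes f :: "real \<Rightarrow> 'a::euclidean_space"
  assumes f: "continuous_on {0..u} f" and u: "u > 0" and D: "open D" "D \<noteq> UNIV"
  shows "(\<forall>t\<in>{0..u}. f t \<in> D) \<longleftrightarrow> (\<exists>k. \<forall>m. \<forall>i\<in>{..2 ^ m}. f (real i * (u / 2 ^ m)) \<in> inner_set D k)"
proof
  assume *: "\<forall>t\<in>{0..u}. f t \<in> D"
  have D': "closed (- D)" "- D \<noteq> {}" using D by auto
  have "continuous_on {0..u} (\<lambda>t. infdist (f t) (- D))" using f by (intro continuous_intros)
  then obtain t0 where t0: "t0 \<in> {0..u}" "\<And>t. t \<in> {0..u} \<Longrightarrow> infdist (f t0) (- D) \<le> infdist (f t) (- D)"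
    using continuous_attains_inf[of "{0..u}" "\<lambda>t. infdist (f t) (- D)"] u by fastforce
  have "infdist (f t0) (- D) \<noteq> 0" using in_closed_iff_infdist_zero[OF D', of "f t0"] * t0 by auto
  then have "0 < infdist (f t0) (- D)" using infdist_nonneg[of "f t0" "- D"] by linarith
  then obtain k where k: "inverse (real (Suc k)) < infdist (f t0) (- D)" using reals_Archimedean by blast
  show "\<exists>k. \<forall>m. \<forall>i\<in>{..2 ^ m}. f (real i * (u / 2 ^ m)) \<in> inner_set D k"
  proof (intro exI allI ballI)
    fix m i assume i: "i \<in> {..(2::nat) ^ m}"
    then have "real i \<le> 2 ^ m" using of_nat_le_iff[of i "2 ^ m", where 'a=real] by simp
    then have "real i * (u / 2 ^ m) \<in> {0..u}" using u by (auto simp: field_simps)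
    from t0(2)[OF this] k show "f (real i * (u / 2 ^ m)) \<in> inner_set D k" by (simp add: inner_set_def)
  qed
next
  assume "\<exists>k. \<forall>m. \<forall>i\<in>{..2 ^ m}. f (real i * (u / 2 ^ m)) \<in> inner_set D k"
  then obtain k where k: "\<And>m i. i \<le> 2 ^ m \<Longrightarrow> f (real i * (u / 2 ^ m)) \<in> inner_set D k" by auto
  show "\<forall>t\<in>{0..u}. f t \<in> D"
  proof
    fix t assume t: "t \<in> {0..u}"
    \<comment> \<open>\<open>s m\<close> is the last grid time of mesh u / 2^m not after
      \<open>t\<close>, so it tends to \<open>t\<close> from below and stays in [0, u].\<close>
    define i where "i m = nat \<lfloor>t * 2 ^ m / u\<rfloor>" for m :: nat
    define s where "s m = real (i m) * (u / 2 ^ m)" for m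
    have i_real: "real (i m) = of_int \<lfloor>t * 2 ^ m / u\<rfloor>" for m using t u by (simp add: i_def)
    have i_le: "i m \<le> 2 ^ m" for m
    proof -
      have "real (i m) \<le> t * 2 ^ m / u" unfolding i_real by (rule of_int_floor_le)
      also have "\<dots> \<le> 2 ^ m" using t u by (simp add: field_simps)
      finally have "real (i m) \<le> real (2 ^ m)" by simp
      then show ?thesis by (simp only: of_nat_le_iff)
    qed
    have s: "t - u / 2 ^ m \<le> s m" "s m \<le> t" for m
    proof -
      have "real (i m) \<le> t * 2 ^ m / u" "t * 2 ^ m / u \<le> real (i m) + 1" unfolding i_real by linarith+
      then have "t * 2 ^ m \<le> real (i m) * u + u" "real (i m) * u \<le> t * 2 ^ m"
        using u by (simp_all add: field_simps)
      then have "t \<le> (real (i m) * u + u) / 2 ^ m" "real (i m) * u / 2 ^ m \<le> t"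
        by (simp_all add: pos_le_divide_eq pos_divide_le_eq)
      then show "t - u / 2 ^ m \<le> s m" "s m \<le> t" by (simp_all add: s_def add_divide_distrib)
    qed
    have "(\<lambda>m. t - u * (1 / 2) ^ m) \<longlonglongrightarrow> t - u * 0"
      by (intro tendsto_intros LIMSEQ_realpow_zero) auto
    then have "s \<longlonglongrightarrow> t"
      by (intro tendsto_sandwich[OF _ _ _ tendsto_const, of _ s]) (use s in \<open>auto simp: power_divide\<close>)
    moreover have "s m \<in> {0..u}" for m using s(2)[of m] t u by (auto simp: s_def)
    ultimately have "(\<lambda>m. infdist (f (s m)) (- D)) \<longlonglongrightarrow> infdist (f t) (- D)"
      using t f by (intro tendsto_infdist continuous_on_tendsto_compose[OF f]) auto
    then have "inverse (real (Suc k)) \<le> infdist (f t) (- D)"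
      by (rule tendsto_lowerbound) (use k[OF i_le] in \<open>auto simp: s_def inner_set_def\<close>)
    moreover have "0 < inverse (real (Suc k))" by simp
    ultimately have "infdist (f t) (- D) \<noteq> 0" by linarith
    then show "f t \<in> D" using infdist_zero[of "f t" "- D"] by (cases "f t \<in> D") simp_all
  qed
qed

text \<open>Time 0 is included, whereas \<open>exit_time\<close> looks at positive times only; for a
  start in an open \<open>D\<close> the two descriptions agree almost surely. For negative
  \<open>u\<close> the event is the whole space.\<close>

definition surv :: "'w measure \<Rightarrow> (real \<Rightarrow> 'w \<Rightarrow> 'a) \<Rightarrow> 'a set \<Rightarrow> real \<Rightarrow> real" where
  "surv M X D u = measure M (stays M X D u)"

definition grid_event :: "'w measure \<Rightarrow> (real \<Rightarrow> 'w \<Rightarrow> 'a::metric_space) \<Rightarrow> 'a set \<Rightarrow> real \<Rightarrow> nat \<Rightarrow> nat \<Rightarrow> 'w set" where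
  "grid_event M X D u k m = {w\<in>space M. \<forall>i\<in>{..2 ^ m}. X (real i * (u / 2 ^ m)) w \<in> inner_set D k}"

lemma grid_event_incseq: "incseq (\<lambda>k. grid_event M X D u k m)"
  unfolding grid_event_def incseq_def using inner_set_mono by fastforce

lemma grid_event_decseq: "decseq (grid_event M X D u k)"
proof (rule decseq_SucI, rule subsetI)
  fix m w assume w: "w \<in> grid_event M X D u k (Suc m)"
  have "X (real i * (u / 2 ^ m)) w \<in> inner_set D k" if "i \<le> 2 ^ m" for i
  proof -
    have "real (2 * i) * (u / 2 ^ Suc m) = real i * (u / 2 ^ m)" by simp
    moreover have "2 * i \<in> {..2 ^ Suc m}" using that by simp
    ultimately show ?thesis using w unfolding grid_event_def by (metis (mono_tags, lifting) mem_Collect_eq)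
  qed
  then show "w \<in> grid_event M X D u k m" using w by (simp add: grid_event_def)
qed

lemma grid_event_measurable:
  assumes "\<And>t. t \<ge> 0 \<Longrightarrow> X t \<in> borel_measurable M" "u \<ge> 0"
  shows "grid_event M X D u k m \<in> sets M"
  unfolding grid_event_def using assms
  by (intro sets.sets_Collect_finite_All measurable_sets_Collect[OF assms(1)]) auto

lemma stays_eq_grid_events:
  fixes X :: "real \<Rightarrow> 'w \<Rightarrow> 'a::euclidean_space"
  assumes "\<And>w. w \<in> space M \<Longrightarrow> continuous_on {0..} (\<lambda>t. X t w)"
    and "u > 0" "open D" "D \<noteq> UNIV"
  shows "stays M X D u = (\<Union>k. \<Inter>m. grid_event M X D u k m)"
proof -
  have "(\<forall>t\<in>{0..u}. X t w \<in> D) \<longleftrightarrow> (\<exists>k. \<forall>m. w \<in> grid_event M X D u k m)" if "w \<in> space M" for w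
    using that path_stays_iff_grid[OF continuous_on_subset[OF assms(1)[OF that]] assms(2-)]
    by (auto simp: grid_event_def)
  then show ?thesis by (auto simp: grid_event_def)
qed

lemma stays_measurable:
  fixes X :: "real \<Rightarrow> 'w \<Rightarrow> 'a::euclidean_space"
  assumes X: "\<And>t. t \<ge> 0 \<Longrightarrow> X t \<in> borel_measurable M"
    and cont: "\<And>w. w \<in> space M \<Longrightarrow> continuous_on {0..} (\<lambda>t. X t w)"
    and D: "open D" "D \<noteq> UNIV"
  shows "stays M X D u \<in> sets M"
proof -
  consider "u < 0" | "u = 0" | "u > 0" by linarith
  then show ?thesis
  proof cases
    case 2
    have "{w \<in> space M. X 0 w \<in> D} \<in> sets M"
      using measurable_sets_Collect[OF X[of 0], of "\<lambda>y. y \<in> D"] D by auto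
    then show ?thesis using 2 by simp
  next
    case 3
    then show ?thesis using stays_eq_grid_events[where X=X and M=M, OF cont 3 D] grid_event_measurable[where X=X and M=M and u=u, OF X]
      by (auto intro!: sets.countable_UN sets.countable_INT simp: image_subset_iff)
  qed auto
qed

context
  fixes M :: "'w measure" and x :: "'a::euclidean_space" and X :: "real \<Rightarrow> 'w \<Rightarrow> 'a"
  assumes BM: "brownian_motion M x X"
begin

lemma surv_lim:
  assumes "u > 0" "open D" "D \<noteq> UNIV"
  shows "(\<lambda>m. measure M (grid_event M X D u k m)) \<longlonglongrightarrow> measure M (\<Inter>m. grid_event M X D u k m)"
    and "(\<lambda>k. measure M (\<Inter>m. grid_event M X D u k m)) \<longlonglongrightarrow> surv M X D u"
proof -
  interpret prob_space M by (rule bm_prob_space[OF BM])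
  have G: "grid_event M X D u k m \<in> sets M" for k m
    using grid_event_measurable[of X M u] bm_measurable[OF BM] assms by auto
  then show "(\<lambda>m. measure M (grid_event M X D u k m)) \<longlonglongrightarrow> measure M (\<Inter>m. grid_event M X D u k m)"
    by (intro finite_Lim_measure_decseq grid_event_decseq) auto
  have "incseq (\<lambda>k. \<Inter>m. grid_event M X D u k m)"
    using grid_event_incseq[of M X D u] unfolding incseq_def by blast
  moreover have "stays M X D u = (\<Union>k. \<Inter>m. grid_event M X D u k m)"
    by (rule stays_eq_grid_events[OF _ assms]) (rule bm_continuous[OF BM])
  ultimately show "(\<lambda>k. measure M (\<Inter>m. grid_event M X D u k m)) \<longlonglongrightarrow> surv M X D u"
    unfolding surv_def using G
    by (simp only:, intro finite_Lim_measure_incseq) (auto intro!: sets.countable_INT)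
qed

lemma surv_0: "open D \<Longrightarrow> surv M X D 0 = indicator D x"
proof -
  assume D: "open D"
  interpret prob_space M by (rule bm_prob_space[OF BM])
  have "measure M {w \<in> space M. X 0 w \<in> D} = measure M (if x \<in> D then space M else {})"
    using measurable_sets_Collect[OF bm_measurable[OF BM, of 0], of "\<lambda>y. y \<in> D"] D bm_start[OF BM]
    by (intro finite_measure_eq_AE) (auto elim!: AE_mp)
  then show ?thesis by (simp add: surv_def prob_space)
qed

end

text \<open>Survival is a double monotone limit of grid probabilities, first in the mesh and then in
  the inner set. Each of these depends on the starting point alone.\<close>

lemma surv_law:
  assumes "brownian_motion M x X" "brownian_motion M' x Y" and u: "u \<ge> 0" and D: "open D" "D \<noteq> UNIV"
  shows "surv M X D u = surv M' Y D u"
proof (cases "u = 0")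
  case True
  then show ?thesis using assms by (simp add: surv_0)
next
  case False
  with u have u: "u > 0" by simp
  have eq: "measure M (grid_event M X D u k m) = measure M' (grid_event M' Y D u k m)" for k m
  proof -
    obtain n where n: "2 ^ m = Suc n" using not0_implies_Suc[of "2 ^ m"] by auto
    have "u / 2 ^ m > 0" using u by simp
    from bm_grid_law[OF assms(1) this, of _ n] bm_grid_law[OF assms(2) this, of _ n]
    show ?thesis unfolding grid_event_def n by simp
  qed
  have "measure M (\<Inter>m. grid_event M X D u k m) = measure M' (\<Inter>m. grid_event M' Y D u k m)" for k
    using surv_lim(1)[OF assms(1) u D, of k] surv_lim(1)[OF assms(2) u D, of k] unfolding eq
    by (rule LIMSEQ_unique)
  then show ?thesis
    using surv_lim(2)[OF assms(1) u D] surv_lim(2)[OF assms(2) u D] by (simp add: LIMSEQ_unique)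
qed

lemma surv_antimono:
  assumes BM: "brownian_motion M x X" and D: "open D" "D \<noteq> UNIV"
  shows "antimono (surv M X D)"
proof (rule antimonoI)
  fix s t :: real assume "s \<le> t"
  interpret prob_space M by (rule bm_prob_space[OF BM])
  show "surv M X D t \<le> surv M X D s"
    unfolding surv_def using \<open>s \<le> t\<close>
    by (intro finite_measure_mono stays_measurable[OF bm_measurable[OF BM] bm_continuous[OF BM] D]) auto
qed

lemma surv_measurable:
  assumes BM: "brownian_motion M x X" and D: "open D" "D \<noteq> UNIV"
  shows "surv M X D \<in> borel_measurable borel"
proof -
  have "mono (\<lambda>t. - surv M X D t)" using surv_antimono[OF assms] by (auto simp: mono_def antimono_def)
  from borel_measurable_uminus[OF borel_measurable_mono[OF this]] show ?thesis by simp
qed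

lemma surv_bounds:
  assumes "brownian_motion M x X"
  shows "0 \<le> surv M X D u" "surv M X D u \<le> 1"
  using prob_space.prob_le_1[OF bm_prob_space[OF assms]] by (auto simp: surv_def)

section \<open>Recentring and similitude scaling of Brownian motion\<close>

lemma bm_recenter:
  fixes X :: "real \<Rightarrow> 'w \<Rightarrow> 'a::euclidean_space"
  assumes BM: "brownian_motion M x X"
  shows "brownian_motion M y (\<lambda>t w. y + (X t w - X 0 w))"
proof -
  have eq: "(y + (a - c)) - (y + (b - c)) = a - b" for a b c :: 'a by (simp add: algebra_simps)
  have [measurable]: "t \<ge> 0 \<Longrightarrow> X t \<in> borel_measurable M" for t by (rule bm_measurable[OF BM])
  show ?thesis
    using BM unfolding brownian_motion_def independent_increments_def eq
    by (auto intro!: continuous_intros)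
qed

lemma gauss_similitude:
  fixes T :: "'a::euclidean_space \<Rightarrow> 'a"
  assumes T: "similitude q T" "T 0 = 0" and v: "v > 0"
  shows "distr (density lborel (\<lambda>y. ennreal (gauss (v / q\<^sup>2) y))) borel T = density lborel (\<lambda>y. ennreal (gauss v y))"
proof (rule measure_eqI)
  have q: "q > 0" using T by (simp add: similitude_pos)
  note [measurable] = similitude_measurable[OF T(1)]
  have norm: "norm (T y) = q * norm y" for y
    using similitude_dist[OF T(1), of y 0] T(2) by simp
  \<comment> \<open>The factor q^d is the Jacobian of \<open>T\<close>: the change of variables
    cancels it and carries variance v / q^2 to variance v.\<close>
  have gauss: "gauss (v / q\<^sup>2) y = q ^ DIM('a) * gauss v (T y)" for y
  proof -
    have "(2 * pi * (v / q\<^sup>2)) powr (- real DIM('a) / 2) = (2 * pi * v) powr (- real DIM('a) / 2) * (q\<^sup>2) powr (real DIM('a) / 2)"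
      using v q by (simp add: powr_divide powr_minus field_simps)
    also have "(q\<^sup>2) powr (real DIM('a) / 2) = q ^ DIM('a)"
      using q by (simp add: powr_powr powr_realpow flip: powr_numeral)
    finally show ?thesis using q v by (simp add: gauss_def norm power_mult_distrib field_simps)
  qed
  fix A assume "A \<in> sets (distr (density lborel (\<lambda>y. ennreal (gauss (v / q\<^sup>2) y))) borel T)"
  then have [measurable]: "A \<in> sets borel" by simp
  have [measurable]: "T -` A \<in> sets borel"
    using measurable_sets[OF similitude_measurable[OF T(1)], of A] by simp
  have "emeasure (distr (density lborel (\<lambda>y. ennreal (gauss (v / q\<^sup>2) y))) borel T) A =
      (\<integral>\<^sup>+y. ennreal (gauss (v / q\<^sup>2) y) * indicator A (T y) \<partial>lborel)"
    by (subst emeasure_distr) (auto simp: emeasure_density indicator_def intro!: nn_integral_cong)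
  also have "\<dots> = ennreal (q ^ DIM('a)) * (\<integral>\<^sup>+y. ennreal (gauss v (T y)) * indicator A (T y) \<partial>lborel)"
    using q by (subst nn_integral_cmult[symmetric]) (auto simp: gauss ennreal_mult gauss_nonneg mult.assoc)
  also have "\<dots> = (\<integral>\<^sup>+y. ennreal (gauss v y) * indicator A y \<partial>lborel)"
    by (rule nn_integral_similitude[OF T(1), symmetric]) simp
  also have "\<dots> = emeasure (density lborel (\<lambda>y. ennreal (gauss v y))) A"
    by (simp add: emeasure_density)
  finally show "emeasure (distr (density lborel (\<lambda>y. ennreal (gauss (v / q\<^sup>2) y))) borel T) A = \<dots>" .
qed simp

text \<open>Increments see only the linear part \<open>L\<close> of the similitude. Rotation
  invariance of the Gaussian density and the scaling of its variance by q^2, undone by the clock t /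
  q^2, give a Brownian motion again.\<close>

lemma bm_similitude:
  fixes T :: "'a::euclidean_space \<Rightarrow> 'a"
  assumes BM: "brownian_motion M x X" and T: "similitude q T"
  shows "brownian_motion M (T x) (\<lambda>t w. T (X (t / q\<^sup>2) w))"
proof -
  interpret prob_space M by (rule bm_prob_space[OF BM])
  have q: "q > 0" using T by (rule similitude_pos)
  obtain Q where Q: "orthogonal_transformation Q" "\<And>x. T x = T 0 + q *\<^sub>R Q x"
    using similitude_affine[OF T] by metis
  define L where "L x = q *\<^sub>R Q x" for x
  have L: "similitude q L" "L 0 = 0"
    using q Q(1) by (auto simp: similitude_def L_def orthogonal_transformation_isometry dist_norm simp flip: scaleR_diff_right)
  have diff: "T a - T b = L (a - b)" for a b
    using linear_diff[OF orthogonal_transformation_linear[OF Q(1)], of a b]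
    by (subst (1 2) Q(2)) (simp add: L_def scaleR_diff_right)
  note [measurable] = similitude_measurable[OF T] similitude_measurable[OF L(1)]
  have X [measurable]: "t \<ge> 0 \<Longrightarrow> X t \<in> borel_measurable M" for t by (rule bm_measurable[OF BM])
  show ?thesis
    unfolding brownian_motion_def
  proof (intro conjI allI ballI impI)
    show "prob_space M" by (rule prob_space_axioms)
    show "(\<lambda>w. T (X (t / q\<^sup>2) w)) \<in> borel_measurable M" if "t \<ge> 0" for t
      using that by simp
    show "AE w in M. T (X (0 / q\<^sup>2) w) = T x"
      using bm_start[OF BM] by eventually_elim simp
    show "continuous_on {0..} (\<lambda>t. T (X (t / q\<^sup>2) w))" if "w \<in> space M" for w
    proof -
      have "continuous_on {0..} (\<lambda>t. X (t / q\<^sup>2) w)"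
        by (rule continuous_on_compose2[OF bm_continuous[OF BM that]]) (auto intro!: continuous_intros simp: q less_imp_neq[OF q, symmetric])
      then show ?thesis by (rule continuous_on_compose2[OF similitude_continuous[OF T, of UNIV]]) auto
    qed
    show "independent_increments M (\<lambda>t w. T (X (t / q\<^sup>2) w))"
      unfolding independent_increments_def diff
    proof (intro allI impI)
      fix n and s :: "nat \<Rightarrow> real" assume s: "0 \<le> s 0 \<and> (\<forall>i<n. s i \<le> s (Suc i))"
      have "indep_vars (\<lambda>_. borel) (\<lambda>i w. X (s (Suc i) / q\<^sup>2) w - X (s i / q\<^sup>2) w) {..<n}"
        using bm_indep[OF BM, unfolded independent_increments_def, rule_format, of "\<lambda>i. s i / q\<^sup>2" n] s
        by (simp add: divide_right_mono)
      then show "indep_vars (\<lambda>_. borel) (\<lambda>i w. L (X (s (Suc i) / q\<^sup>2) w - X (s i / q\<^sup>2) w)) {..<n}"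
        by (rule indep_vars_compose2) simp
    qed
    fix s t :: real assume st: "0 \<le> s \<and> s < t"
    then have st': "0 \<le> s / q\<^sup>2" "s / q\<^sup>2 < t / q\<^sup>2" using q by (auto simp: divide_strict_right_mono)
    then have [measurable]: "X (s / q\<^sup>2) \<in> borel_measurable M" "X (t / q\<^sup>2) \<in> borel_measurable M" by auto
    have "distr M lborel (\<lambda>w. L (X (t / q\<^sup>2) w - X (s / q\<^sup>2) w)) =
        distr (distr M borel (\<lambda>w. X (t / q\<^sup>2) w - X (s / q\<^sup>2) w)) borel L"
      by (subst distr_distr) (auto simp: comp_def cong: distr_cong)
    also have "\<dots> = density lborel (\<lambda>y. ennreal (gauss (t - s) y))"
      using st q gauss_similitude[OF L, of "t - s"] unfolding bm_increment_distr[OF BM st']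
      by (simp add: diff_divide_distrib)
    finally have "distributed M lborel (\<lambda>w. L (X (t / q\<^sup>2) w - X (s / q\<^sup>2) w)) (\<lambda>y. ennreal (gauss (t - s) y))"
      by (simp add: distributed_def)
    then show "distributed M lborel (\<lambda>w. T (X (t / q\<^sup>2) w) - T (X (s / q\<^sup>2) w))
          (\<lambda>y. ennreal ((2 * pi * (t - s)) powr (- real DIM('a) / 2) * exp (- (norm y)\<^sup>2 / (2 * (t - s)))))"
      unfolding diff gauss_def .
  qed
qed

section \<open>Displacement bounds and the maximal inequality\<close>

lemma bm_increment_tail:
  fixes X :: "real \<Rightarrow> 'w \<Rightarrow> 'a::euclidean_space"
  assumes BM: "brownian_motion M x X" and st: "0 \<le> s" "s < t" and a: "a > 0"
  shows "measure M {w \<in> space M. a \<le> norm (X t w - X s w)} \<le> 2 * 2 powr (real DIM('a) / 2) * (t - s) / a\<^sup>2"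
proof -
  interpret prob_space M by (rule bm_prob_space[OF BM])
  define v where "v = t - s"
  have v: "v > 0" using st by (simp add: v_def)
  define K where "K = 2 * 2 powr (real DIM('a) / 2) * v / a\<^sup>2"
  have K: "K \<ge> 0" using v by (simp add: K_def)
  have X [measurable]: "X s \<in> borel_measurable M" "X t \<in> borel_measurable M" "X 0 \<in> borel_measurable M" "X (2 * v) \<in> borel_measurable M"
    using st v by (auto intro!: bm_measurable[OF BM])
  \<comment> \<open>That the density has mass 1 is read off from the law of an actual increment over
    a time interval of length 2 v; no Gaussian integral is computed.\<close>
  have total: "(\<integral>\<^sup>+y. ennreal (gauss (2 * v) (y::'a)) \<partial>lborel) = 1"
  proof -
    have "(\<integral>\<^sup>+y. ennreal (gauss (2 * v) (y::'a)) \<partial>lborel) = emeasure (density lborel (\<lambda>y::'a. ennreal (gauss (2 * v - 0) y))) UNIV"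
      by (simp add: emeasure_density)
    also have "\<dots> = emeasure (distr M borel (\<lambda>w. X (2 * v) w - X 0 w)) UNIV"
      using v by (subst bm_increment_distr[OF BM]) auto
    also have "\<dots> = 1" by (subst emeasure_distr) (auto simp: emeasure_space_1)
    finally show ?thesis .
  qed
  \<comment> \<open>Far from the origin the density of variance v is compared pointwise with the one
    of variance 2 v. Half of the exponent pays for the factor v / a^2, and 2^(d/2) is the quotient
    of the normalising constants.\<close>
  have pw: "gauss v y \<le> K * gauss (2 * v) y" if y: "a \<le> norm y" for y :: 'a
  proof -
    define z where "z = (norm y)\<^sup>2 / (2 * v)"
    have "a\<^sup>2 \<le> (norm y)\<^sup>2" using y a by (intro power_mono) auto
    then have z: "a\<^sup>2 / (2 * v) \<le> z" using v by (simp add: z_def divide_right_mono)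
    have "0 < a\<^sup>2 / (2 * v)" using a v by simp
    with z have z0: "z > 0" by linarith
    have "z \<le> exp (z / 2)"
    proof -
      have "0 \<le> (z - 2)\<^sup>2 + 4" by simp
      then have "z \<le> 1 + z / 2 + (z / 2)\<^sup>2 / 2" by (simp add: power2_eq_square field_simps)
      also have "\<dots> \<le> exp (z / 2)" using z0 by (intro exp_lower_Taylor_quadratic) auto
      finally show ?thesis .
    qed
    then have "a\<^sup>2 / (2 * v) \<le> exp (z / 2)" using z by linarith
    then have "1 \<le> 2 * v / a\<^sup>2 * exp (z / 2)" using v a by (simp add: field_simps)
    then have "exp (- z) * 1 \<le> exp (- z) * (2 * v / a\<^sup>2 * exp (z / 2))" by (intro mult_left_mono) auto
    also have "\<dots> = 2 * v / a\<^sup>2 * exp (- (z / 2))" by (simp add: mult_exp_exp[symmetric] field_simps flip: exp_add)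
    finally have e: "exp (- z) \<le> 2 * v / a\<^sup>2 * exp (- (z / 2))" by simp
    have p: "(2 * pi * v) powr (- real DIM('a) / 2) = 2 powr (real DIM('a) / 2) * (2 * pi * (2 * v)) powr (- real DIM('a) / 2)"
    proof -
      have "(2 * pi * (2 * v)) powr (- real DIM('a) / 2) = 2 powr (- real DIM('a) / 2) * (2 * pi * v) powr (- real DIM('a) / 2)"
        using v powr_mult[of 2 "2 * pi * v" "- real DIM('a) / 2"] by (simp add: mult_ac)
      then show ?thesis by (simp flip: powr_add)
    qed
    have "gauss v y = (2 * pi * v) powr (- real DIM('a) / 2) * exp (- z)" by (simp add: gauss_def z_def)
    also have "\<dots> \<le> (2 * pi * v) powr (- real DIM('a) / 2) * (2 * v / a\<^sup>2 * exp (- (z / 2)))"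
      using e by (intro mult_left_mono) auto
    also have "\<dots> = K * gauss (2 * v) y"
      unfolding p by (simp add: gauss_def z_def K_def)
    finally show ?thesis .
  qed
  have "emeasure M {w \<in> space M. a \<le> norm (X t w - X s w)} =
      emeasure (distr M borel (\<lambda>w. X t w - X s w)) {y. a \<le> norm y}"
    by (subst emeasure_distr) (auto intro!: arg_cong2[where f=emeasure])
  also have "\<dots> = (\<integral>\<^sup>+y. ennreal (gauss v (y::'a)) * indicator {y. a \<le> norm y} y \<partial>lborel)"
    unfolding bm_increment_distr[OF BM st] by (subst emeasure_density) (auto simp: v_def)
  also have "\<dots> \<le> (\<integral>\<^sup>+y. ennreal (K * gauss (2 * v) (y::'a)) \<partial>lborel)"
    using pw by (intro nn_integral_mono) (auto split: split_indicator intro!: ennreal_leI)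
  also have "\<dots> = ennreal K"
    using K by (simp add: ennreal_mult gauss_nonneg nn_integral_cmult total)
  finally show ?thesis unfolding K_def v_def[symmetric] emeasure_eq_measure
    using K by (simp add: K_def)
qed

text \<open>Ottaviani's maximal inequality, decomposing by the first index at which the path exceeds \<open>2 a\<close>.\<close>

lemma ottaviani_step:
  fixes X :: "real \<Rightarrow> 'w \<Rightarrow> 'a::euclidean_space"
  assumes BM: "brownian_motion M x X" and h: "h > 0" and k: "0 < k" "k < n" and a: "a > 0"
  defines "A \<equiv> {w \<in> space M. 2 * a \<le> norm (X (real k * h) w - X 0 w) \<and> (\<forall>i\<in>{..<k}. norm (X (real i * h) w - X 0 w) < 2 * a)}"
  shows "measure M (A \<inter> {w \<in> space M. norm (X (real n * h) w - X (real k * h) w) < a}) =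
    measure M A * measure M {w \<in> space M. norm (X (real n * h) w - X (real k * h) w) < a}"
proof -
  interpret prob_space M by (rule bm_prob_space[OF BM])
  have [measurable]: "X (real i * h) \<in> borel_measurable M" for i
    using h by (intro bm_measurable[OF BM]) simp
  \<comment> \<open>The time grid runs through the first k steps and then jumps to step n, so its
    last increment is the remaining one from k to n, independent of the first k increments.\<close>
  define s where "s i = (if i \<le> k then real i * h else real n * h)" for i
  define \<Delta> where "\<Delta> i w = X (s (Suc i)) w - X (s i) w" for i w
  have "indep_vars (\<lambda>_. borel) \<Delta> {..<Suc k}"
    unfolding \<Delta>_def
  proof (rule bm_indep[OF BM, unfolded independent_increments_def, rule_format], intro conjI allI impI)
    show "s i \<le> s (Suc i)" if "i < Suc k" for i
      unfolding s_def using that h k by (auto intro!: mult_right_mono)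
  qed (use h in \<open>simp add: s_def\<close>)
  then have ind: "indep_var (PiM {..<k} (\<lambda>_. borel)) (\<lambda>w. \<lambda>i\<in>{..<k}. \<Delta> i w) (PiM {k} (\<lambda>_. borel)) (\<lambda>w. \<lambda>i\<in>{k}. \<Delta> i w)"
    by (rule indep_var_restrict) auto
  define p where "p i f = (\<Sum>j<i. f j)" for i :: nat and f :: "nat \<Rightarrow> 'a"
  define F where "F = {f \<in> space (PiM {..<k} (\<lambda>_. borel :: 'a measure)). 2 * a \<le> norm (p k f) \<and> (\<forall>i\<in>{..<k}. norm (p i f) < 2 * a)}"
  define H where "H = {f \<in> space (PiM {k} (\<lambda>_. borel :: 'a measure)). norm (f k) < a}"
  have sums: "p i \<in> borel_measurable (PiM {..<k} (\<lambda>_. borel :: 'a measure))" if "i \<le> k" for i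
    unfolding p_def[abs_def] using that by (intro borel_measurable_sum measurable_component_singleton) auto
  have F: "F \<in> sets (PiM {..<k} (\<lambda>_. borel))"
    unfolding F_def
  proof (intro sets.sets_Collect_conj sets.sets_Collect_finite_All)
    note [measurable] = sums[OF order_refl]
    show "{f \<in> space (PiM {..<k} (\<lambda>_. borel)). 2 * a \<le> norm (p k f)} \<in> sets (PiM {..<k} (\<lambda>_. borel))"
      by measurable
    fix i assume "i \<in> {..<k}"
    then have [measurable]: "p i \<in> borel_measurable (PiM {..<k} (\<lambda>_. borel :: 'a measure))"
      by (intro sums) simp
    show "{f \<in> space (PiM {..<k} (\<lambda>_. borel)). norm (p i f) < 2 * a} \<in> sets (PiM {..<k} (\<lambda>_. borel))"
      by measurable
  qed simp
  have H: "H \<in> sets (PiM {k} (\<lambda>_. borel))"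
    unfolding H_def by measurable
  have tele: "p i (\<lambda>i\<in>{..<k}. \<Delta> i w) = X (real i * h) w - X 0 w" if "i \<le> k" for i w
  proof -
    have "p i (\<lambda>i\<in>{..<k}. \<Delta> i w) = (\<Sum>j<i. X (real (Suc j) * h) w - X (real j * h) w)"
      unfolding p_def using that by (intro sum.cong) (auto simp: \<Delta>_def s_def)
    also have "\<dots> = X (real i * h) w - X (real 0 * h) w" by (rule sum_lessThan_telescope)
    finally show ?thesis by simp
  qed
  have A: "A = (\<lambda>w. \<lambda>i\<in>{..<k}. \<Delta> i w) -` F \<inter> space M"
    by (auto simp: A_def F_def tele space_PiM)
  have B: "{w \<in> space M. norm (X (real n * h) w - X (real k * h) w) < a} = (\<lambda>w. \<lambda>i\<in>{k}. \<Delta> i w) -` H \<inter> space M"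
    by (auto simp: H_def \<Delta>_def s_def space_PiM)
  have eq: "A \<inter> {w \<in> space M. norm (X (real n * h) w - X (real k * h) w) < a} =
      (\<lambda>w. (\<lambda>i\<in>{..<k}. \<Delta> i w, \<lambda>i\<in>{k}. \<Delta> i w)) -` (F \<times> H) \<inter> space M"
    unfolding A B by auto
  show ?thesis
    unfolding eq by (subst indep_varD[OF ind F H]) (simp add: A B)
qed

text \<open>If the path first exceeds 2 a at index k, the remaining increment is below a with
  probability at least 1/2, independently of the past, and then the endpoint is still at distance at
  least a. So the maximum costs at most twice the tail of the endpoint.\<close>

lemma bm_grid_maximal:
  fixes X :: "real \<Rightarrow> 'w \<Rightarrow> 'a::euclidean_space"
  assumes BM: "brownian_motion M x X" and h: "h > 0" and n: "n > 0" and a: "a > 0"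
  shows "measure M {w \<in> space M. \<exists>i\<in>{..n}. 2 * a \<le> norm (X (real i * h) w - X 0 w)}
    \<le> 4 * 2 powr (real DIM('a) / 2) * (real n * h) / a\<^sup>2"
proof -
  let ?inc = "\<lambda>k w. norm (X (real n * h) w - X (real k * h) w)"
  let ?d = "\<lambda>i w. norm (X (real i * h) w - X 0 w)"
  interpret prob_space M by (rule bm_prob_space[OF BM])
  have [measurable]: "X (real i * h) \<in> borel_measurable M" "X 0 \<in> borel_measurable M" for i
    using h by (auto intro!: bm_measurable[OF BM])
  define C where "C = 2 * 2 powr (real DIM('a) / 2)"
  have C: "C > 0" by (simp add: C_def)
  define q where "q = C * (real n * h) / a\<^sup>2"
  show ?thesis
  proof (cases "q \<le> 1 / 2")
    \<comment> \<open>Here the claimed bound is at least 1.\<close>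
    case False
    then have "1 \<le> 2 * q" by simp
    with prob_le_1 have "measure M {w \<in> space M. \<exists>i\<in>{..n}. 2 * a \<le> ?d i w} \<le> 2 * q"
      by (rule order_trans)
    then show ?thesis by (simp add: q_def C_def)
  next
    case q: True
    define A where "A k = {w \<in> space M. 2 * a \<le> ?d k w \<and> (\<forall>i\<in>{..<k}. ?d i w < 2 * a)}" for k
    define B where "B k = {w \<in> space M. ?inc k w < a}" for k
    have AB [measurable]: "A k \<in> sets M" "B k \<in> sets M" for k unfolding A_def B_def by measurable
    have tail: "measure M {w \<in> space M. a \<le> ?inc k w} \<le> q" if "k < n" for k
    proof -
      have kn: "real k * h < real n * h" using that h by simp
      have "measure M {w \<in> space M. a \<le> ?inc k w} \<le> C * (real n * h - real k * h) / a\<^sup>2"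
        unfolding C_def by (rule bm_increment_tail[OF BM _ kn a]) (use h in simp)
      also have "\<dots> \<le> q" unfolding q_def using C h by (intro divide_right_mono mult_left_mono) auto
      finally show ?thesis .
    qed
    \<comment> \<open>Independence is used for 0 < k < n only. At k = 0 the displacement vanishes
      and \<open>A 0\<close> is empty; at k = n the remaining increment vanishes and
      \<open>B n\<close> is everything.\<close>
    have half: "measure M (A k) / 2 \<le> measure M (A k \<inter> B k)" if k: "k \<in> {..n}" for k
    proof -
      consider "k = 0" | "k = n" | "0 < k" "k < n" using k by fastforce
      then show ?thesis
      proof cases
        case 1
        then have "A k = {}" using a by (auto simp: A_def)
        then show ?thesis by simp
      next
        case 2
        then have "B k = space M" using a by (auto simp: B_def)
        then show ?thesis using sets.sets_into_space[OF AB(1)[of k]] by (simp add: Int_absorb2)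
      next
        case 3
        have "{w \<in> space M. a \<le> ?inc k w} = space M - B k"
          by (auto simp: B_def)
        then have "1 - measure M (B k) \<le> q" using tail[OF 3(2)] prob_compl[OF AB(2)[of k]] by simp
        then have "1 / 2 \<le> measure M (B k)" using q by simp
        then have "measure M (A k) * (1 / 2) \<le> measure M (A k) * measure M (B k)" by (intro mult_left_mono) auto
        then show ?thesis using ottaviani_step[OF BM h 3 a] by (simp add: A_def B_def)
      qed
    qed
    have disj: "disjoint_family_on A {..n}"
    proof (unfold disjoint_family_on_def, intro ballI impI)
      have "A k \<inter> A l = {}" if "k < l" for k l
      proof -
        have "?d k w < 2 * a" if "w \<in> A l" for w
          using that \<open>k < l\<close> by (simp add: A_def)
        moreover have "2 * a \<le> ?d k w" if "w \<in> A k" for w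
          using that by (simp add: A_def)
        ultimately show ?thesis using not_le by blast
      qed
      then show "A k \<inter> A l = {}" if "k \<noteq> l" for k l using that by (metis Int_commute linorder_neqE_nat)
    qed
    have cover: "{w \<in> space M. \<exists>i\<in>{..n}. 2 * a \<le> ?d i w} = (\<Union>k\<in>{..n}. A k)"
    proof (intro equalityI subsetI)
      fix w assume "w \<in> {w \<in> space M. \<exists>i\<in>{..n}. 2 * a \<le> ?d i w}"
      then obtain i where i: "w \<in> space M" "i \<le> n" "2 * a \<le> ?d i w" by auto
      define k where "k = (LEAST i. 2 * a \<le> ?d i w)"
      have "2 * a \<le> ?d k w" unfolding k_def using i(3) by (rule LeastI)
      moreover have "k \<le> i" unfolding k_def using i(3) by (rule Least_le)
      moreover have "?d j w < 2 * a" if "j < k" for j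
        using not_less_Least[of j "\<lambda>i. 2 * a \<le> ?d i w"] that unfolding k_def by simp
      ultimately show "w \<in> (\<Union>k\<in>{..n}. A k)" using i by (auto simp: A_def intro!: bexI[of _ k])
    qed (auto simp: A_def)
    have "measure M (\<Union>k\<in>{..n}. A k) = (\<Sum>k\<in>{..n}. measure M (A k))"
      using disj by (intro finite_measure_finite_Union) auto
    also have "\<dots> = 2 * (\<Sum>k\<in>{..n}. measure M (A k) / 2)" by (simp add: sum_distrib_left)
    also have "\<dots> \<le> 2 * (\<Sum>k\<in>{..n}. measure M (A k \<inter> B k))"
      by (intro mult_left_mono sum_mono half) auto
    also have "(\<Sum>k\<in>{..n}. measure M (A k \<inter> B k)) = measure M (\<Union>k\<in>{..n}. A k \<inter> B k)"
      using disj by (intro finite_measure_finite_Union[symmetric]) (auto simp: disjoint_family_on_def)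
    also have "\<dots> \<le> measure M {w \<in> space M. a \<le> ?inc 0 w}"
    proof (rule finite_measure_mono)
      show "(\<Union>k\<in>{..n}. A k \<inter> B k) \<subseteq> {w \<in> space M. a \<le> ?inc 0 w}"
      proof clarify
        fix w k assume "w \<in> A k" "w \<in> B k"
        then have "2 * a \<le> ?d k w" "?inc k w < a" "w \<in> space M"
          by (auto simp: A_def B_def)
        moreover have "?d k w \<le> norm (X (real n * h) w - X 0 w) + ?inc k w"
          using norm_triangle_ineq4[of "X (real n * h) w - X 0 w" "X (real n * h) w - X (real k * h) w"] by simp
        ultimately show "w \<in> space M \<and> a \<le> ?inc 0 w" by simp
      qed
    qed measurable
    also have "\<dots> \<le> q" using n by (rule tail)
    finally show ?thesis unfolding cover by (simp add: q_def C_def)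
  qed
qed

text \<open>A displacement below \<delta> / 2 leaves the distance to the complement above \<delta> /
  2. The grid inequality with a = \<delta> / 4 gives the constant 4 * 16 = 64; on each dyadic grid
  the total time is u, so the bound is uniform in the mesh and passes to the limit.\<close>

lemma bm_exit_bound:
  fixes X :: "real \<Rightarrow> 'w \<Rightarrow> 'a::euclidean_space"
  assumes BM: "brownian_motion M x X" and u: "u > 0" and D: "open D" "D \<noteq> UNIV" and \<delta>: "\<delta> > 0" "\<delta> \<le> infdist x (- D)"
  shows "1 - surv M X D u \<le> 64 * 2 powr (real DIM('a) / 2) * u / \<delta>\<^sup>2"
proof -
  interpret prob_space M by (rule bm_prob_space[OF BM])
  define c where "c = 64 * 2 powr (real DIM('a) / 2) * u / \<delta>\<^sup>2"
  obtain k where k: "inverse (real (Suc k)) < \<delta> / 2" using reals_Archimedean[of "\<delta> / 2"] \<delta> by auto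
  have G: "grid_event M X D u k m \<in> sets M" for m
    using grid_event_measurable[of X M u] bm_measurable[OF BM] u by auto
  have [measurable]: "X 0 \<in> borel_measurable M" "X (real i * (u / 2 ^ m)) \<in> borel_measurable M" for i m
    using u by (auto intro!: bm_measurable[OF BM])
  have "1 - c \<le> measure M (grid_event M X D u k m)" for m
  proof -
    define E where "E = {w \<in> space M. \<exists>i\<in>{..2 ^ m}. 2 * (\<delta> / 4) \<le> norm (X (real i * (u / 2 ^ m)) w - X 0 w)}"
    have E [measurable]: "E \<in> sets M" unfolding E_def by measurable
    have "measure M E \<le> 4 * 2 powr (real DIM('a) / 2) * (real (2 ^ m) * (u / 2 ^ m)) / (\<delta> / 4)\<^sup>2"
      unfolding E_def using u \<delta> by (intro bm_grid_maximal[OF BM]) auto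
    also have "\<dots> = c" by (simp add: c_def power_divide)
    finally have "1 - c \<le> measure M (space M - E)" by (simp add: prob_compl)
    also have "\<dots> \<le> measure M (grid_event M X D u k m)"
    proof (rule finite_measure_mono_AE)
      show "AE w in M. w \<in> space M - E \<longrightarrow> w \<in> grid_event M X D u k m"
        using bm_start[OF BM]
      proof eventually_elim
        case (elim w)
        show ?case
        proof
          assume w: "w \<in> space M - E"
          have "X (real i * (u / 2 ^ m)) w \<in> inner_set D k" if "i \<in> {..2 ^ m}" for i
          proof -
            have "norm (X (real i * (u / 2 ^ m)) w - x) < \<delta> / 2" using w that elim by (force simp: E_def)
            moreover have "infdist x (- D) \<le> infdist (X (real i * (u / 2 ^ m)) w) (- D) + dist x (X (real i * (u / 2 ^ m)) w)"
              by (rule infdist_triangle)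
            ultimately have "inverse (real (Suc k)) \<le> infdist (X (real i * (u / 2 ^ m)) w) (- D)"
              using k \<delta>(2) by (simp add: dist_norm norm_minus_commute)
            then show ?thesis by (simp add: inner_set_def)
          qed
          then show "w \<in> grid_event M X D u k m" using w by (simp add: grid_event_def)
        qed
      qed
    qed (rule G)
    finally show ?thesis .
  qed
  then have "1 - c \<le> measure M (\<Inter>m. grid_event M X D u k m)"
    by (intro LIMSEQ_le_const[OF surv_lim(1)[OF BM u D]]) auto
  also have "\<dots> \<le> surv M X D u"
    unfolding surv_def
  proof (rule finite_measure_mono)
    show "(\<Inter>m. grid_event M X D u k m) \<subseteq> stays M X D u"
      using stays_eq_grid_events[where X=X and M=M, OF _ u D] bm_continuous[OF BM] by blast
    show "stays M X D u \<in> sets M"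
      by (rule stays_measurable[OF _ _ D]) (auto intro: bm_measurable[OF BM] bm_continuous[OF BM])
  qed
  finally show ?thesis by (simp add: c_def)
qed

section \<open>Exit times: measurability, relation to survival, independent random times\<close>

lemma exit_time_nonneg: "0 \<le> exit_time X D w"
  unfolding exit_time_def by (rule INF_greatest) auto

text \<open>For the strict inequality the path must remain in \<open>D\<close> a little beyond
  \<open>s\<close>, which openness of \<open>D\<close> and continuity at \<open>s\<close> provide.
  At s = 0 the interval on the right is empty, so membership at time 0 has to be assumed
  there.\<close>

lemma exit_time_gt_iff_open:
  fixes X :: "real \<Rightarrow> 'w \<Rightarrow> 'a::euclidean_space"
  assumes cont: "continuous_on {0..} (\<lambda>t. X t w)" and D: "open D" and s: "0 \<le> s" "0 < s \<or> X s w \<in> D"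
  shows "ereal s < exit_time X D w \<longleftrightarrow> (\<forall>t\<in>{0<..s}. X t w \<in> D)"
proof
  assume *: "ereal s < exit_time X D w"
  show "\<forall>t\<in>{0<..s}. X t w \<in> D"
  proof (rule ballI, rule ccontr)
    fix t assume t: "t \<in> {0<..s}" "X t w \<notin> D"
    then have "exit_time X D w \<le> ereal t" unfolding exit_time_def by (intro INF_lower) auto
    also have "\<dots> \<le> ereal s" using t by simp
    finally show False using * by simp
  qed
next
  assume *: "\<forall>t\<in>{0<..s}. X t w \<in> D"
  then have "X s w \<in> D" using s by auto
  then obtain B where "openin (top_of_set {0..}) B" "s \<in> B" and B: "\<And>t. t \<in> B \<Longrightarrow> X t w \<in> D"
    using continuous_openin_preimage_gen[OF cont D(1)] s that[of "{0..} \<inter> (\<lambda>t. X t w) -` D"] by auto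
  then obtain e where e: "e > 0" "\<And>t. t \<in> {0..} \<Longrightarrow> dist t s < e \<Longrightarrow> t \<in> B"
    unfolding openin_euclidean_subtopology_iff by blast
  have "ereal (s + e) \<le> exit_time X D w"
    unfolding exit_time_def
  proof (rule INF_greatest)
    fix t assume t: "t \<in> {t. 0 < t \<and> X t w \<notin> D}"
    have "\<not> t < s + e"
    proof
      assume "t < s + e"
      show False
      proof (cases "t \<le> s")
        case True
        then show ?thesis using * t by auto
      next
        case False
        then have "t \<in> B" using e(2)[of t] t \<open>t < s + e\<close> by (auto simp: dist_real_def)
        then show ?thesis using B t by auto
      qed
    qed
    then show "ereal (s + e) \<le> ereal t" by simp
  qed
  then show "ereal s < exit_time X D w" using e less_le_trans[of "ereal s" "ereal (s + e)"] by simp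
qed

lemma exit_time_gt_iff:
  fixes X :: "real \<Rightarrow> 'w \<Rightarrow> 'a::euclidean_space"
  assumes "continuous_on {0..} (\<lambda>t. X t w)" "open D" "X 0 w \<in> D" "0 \<le> s"
  shows "ereal s < exit_time X D w \<longleftrightarrow> (\<forall>t\<in>{0..s}. X t w \<in> D)"
proof -
  have "0 < s \<or> X s w \<in> D" using assms by (cases "s = 0") auto
  moreover have "{0..s} = insert 0 {0<..s}" using assms(4) by auto
  ultimately show ?thesis using exit_time_gt_iff_open[where X=X and w=w, OF assms(1,2,4)] assms(3) by simp
qed

text \<open>Nothing is assumed about the start, so (0, s] is exhausted by intervals [a n, s], each
  reduced to \<open>stays_measurable\<close> by shifting time. The measurable space is arbitrary
  because the lemma is applied to the \<sigma>-algebra generated by the process and to a product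
  space as well.\<close>

lemma exit_time_measurable:
  fixes X :: "real \<Rightarrow> 'w \<Rightarrow> 'a::euclidean_space"
  assumes X: "\<And>t. t \<ge> 0 \<Longrightarrow> X t \<in> borel_measurable N"
    and cont: "\<And>w. w \<in> space N \<Longrightarrow> continuous_on {0..} (\<lambda>t. X t w)"
    and D: "open D" "D \<noteq> UNIV"
  shows "exit_time X D \<in> borel_measurable N"
  unfolding borel_measurable_ereal_iff_Ioi
proof
  have pos: "{w \<in> space N. ereal s < exit_time X D w} \<in> sets N" if s: "s > 0" for s
  proof -
    define a where "a n = s * inverse (real (Suc n))" for n
    have a: "0 < a n" "a n \<le> s" for n using s by (auto simp: a_def field_simps)
    have iff: "(\<forall>t\<in>{0<..s}. X t w \<in> D) \<longleftrightarrow> (\<forall>n. \<forall>t\<in>{0..s - a n}. X (t + a n) w \<in> D)" for w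
    proof (intro iffI allI ballI)
      fix n t assume "\<forall>t\<in>{0<..s}. X t w \<in> D" "t \<in> {0..s - a n}"
      then show "X (t + a n) w \<in> D" using a[of n] by auto
    next
      fix t assume *: "\<forall>n. \<forall>t\<in>{0..s - a n}. X (t + a n) w \<in> D" and t: "t \<in> {0<..s}"
      then obtain n where "inverse (real (Suc n)) < t / s" using reals_Archimedean[of "t / s"] s by auto
      then have "a n < t" using s by (simp add: a_def pos_less_divide_eq mult.commute del: of_nat_Suc)
      then have "t - a n \<in> {0..s - a n}" using t by auto
      then have "X (t - a n + a n) w \<in> D" using * by blast
      then show "X t w \<in> D" by simp
    qed
    have "{w \<in> space N. \<forall>t\<in>{0..s - a n}. X (t + a n) w \<in> D} \<in> sets N" for n
    proof (rule stays_measurable[OF _ _ D])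
      show "X (t + a n) \<in> borel_measurable N" if "t \<ge> 0" for t using a[of n] that by (intro X) auto
      show "continuous_on {0..} (\<lambda>t. X (t + a n) w)" if "w \<in> space N" for w
        by (rule continuous_on_compose2[OF cont[OF that]]) (use a[of n] in \<open>auto intro!: continuous_intros\<close>)
    qed
    then have "{w \<in> space N. \<forall>n. \<forall>t\<in>{0..s - a n}. X (t + a n) w \<in> D} \<in> sets N"
      by (rule sets.sets_Collect_countable_All)
    also have "{w \<in> space N. \<forall>n. \<forall>t\<in>{0..s - a n}. X (t + a n) w \<in> D} = {w \<in> space N. ereal s < exit_time X D w}"
      using exit_time_gt_iff_open[where X=X and s=s, OF cont D(1)] s by (auto simp: iff)
    finally show ?thesis .
  qed
  fix a :: ereal
  show "exit_time X D -` {a<..} \<inter> space N \<in> sets N"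
  proof (cases "a < 0")
    case True
    then have "a < exit_time X D w" for w using less_le_trans[OF True exit_time_nonneg[of X D w]] by simp
    then have "exit_time X D -` {a<..} \<inter> space N = space N" by auto
    then show ?thesis by simp
  next
    case False
    then have a: "0 \<le> a" by simp
    have "exit_time X D -` {a<..} \<inter> space N = (\<Union>q\<in>{q\<in>\<rat>. 0 < q \<and> a \<le> ereal q}. {w \<in> space N. ereal q < exit_time X D w})"
    proof (intro equalityI subsetI)
      fix w assume w: "w \<in> exit_time X D -` {a<..} \<inter> space N"
      then obtain z where z: "a < z" "z < exit_time X D w" using dense by auto
      obtain z' where z': "z = ereal z'" using z a by (cases z) auto
      obtain y where y: "z < ereal y" "ereal y < exit_time X D w" using ereal_dense2 z(2) by blast
      then obtain q where q: "q \<in> \<rat>" "z' < q" "q < y" using Rats_dense_in_real[of z' y] z' by auto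
      have "0 < q" using q z z' a by (cases a) auto
      moreover have "ereal q < exit_time X D w" using q y less_trans[of "ereal q" "ereal y"] by simp
      moreover have "a \<le> ereal q" using z q z' order.trans[of a "ereal z'" "ereal q"] by simp
      ultimately show "w \<in> (\<Union>q\<in>{q\<in>\<rat>. 0 < q \<and> a \<le> ereal q}. {w \<in> space N. ereal q < exit_time X D w})" using w q by auto
    qed (auto intro: le_less_trans)
    moreover have "countable {q\<in>\<rat>. 0 < q \<and> a \<le> ereal q}" using countable_rat by (rule countable_subset[rotated]) auto
    ultimately show ?thesis using pos by (auto intro!: sets.countable_UN')
  qed
qed

lemma surv_eq_exit_time:
  fixes X :: "real \<Rightarrow> 'w \<Rightarrow> 'a::euclidean_space"
  assumes BM: "brownian_motion M x X" and D: "open D" "D \<noteq> UNIV" "x \<in> D" and s: "s \<ge> 0"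
  shows "measure M {w \<in> space M. exit_time X D w > ereal s} = surv M X D s"
  unfolding surv_def
proof -
  interpret prob_space M by (rule bm_prob_space[OF BM])
  have [measurable]: "exit_time X D \<in> borel_measurable M"
    by (rule exit_time_measurable[OF _ _ D(1,2)]) (auto intro: bm_measurable[OF BM] bm_continuous[OF BM])
  show "prob {w \<in> space M. exit_time X D w > ereal s} = prob (stays M X D s)"
  proof (rule finite_measure_eq_AE)
    show "AE w in M. w \<in> {w \<in> space M. exit_time X D w > ereal s} \<longleftrightarrow> w \<in> stays M X D s"
      using bm_start[OF BM] AE_space
    proof eventually_elim
      case (elim w)
      then show ?case
        using exit_time_gt_iff[where X=X and w=w and s=s, OF bm_continuous[OF BM] D(1)] D(3) s by auto
    qed
    show "stays M X D s \<in> sets M"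
      by (rule stays_measurable[OF _ _ D(1,2)]) (auto intro: bm_measurable[OF BM] bm_continuous[OF BM])
  qed measurable
qed

text \<open>The exit time is measurable for the \<sigma>-algebra generated by \<open>W\<close>,
  hence independent of \<open>S t\<close>. The joint law is a product, and integrating out the exit
  time first leaves the survival function evaluated at the independent time.\<close>

lemma exit_after_independent_time:
  fixes W :: "real \<Rightarrow> 'w \<Rightarrow> 'a::euclidean_space" and S :: "real \<Rightarrow> 'w \<Rightarrow> real"
  assumes BM: "brownian_motion M x W" and ind: "independent_processes M W S"
    and t: "t \<ge> 0" and S: "S t \<in> borel_measurable M" "AE w in M. 0 \<le> S t w"
    and D: "open D" "D \<noteq> UNIV" "x \<in> D"
  shows "measure M {w \<in> space M. exit_time W D w > ereal (S t w)} = (\<integral>s. surv M W D s \<partial>distr M borel (S t))"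
proof -
  interpret prob_space M by (rule bm_prob_space[OF BM])
  define F where "F = sigma (space M) {W t -` A \<inter> space M | t A. 0 \<le> t \<and> A \<in> sets borel}"
  have gen: "{W t -` A \<inter> space M | t A. 0 \<le> t \<and> A \<in> sets borel} \<subseteq> Pow (space M)" by auto
  have F: "space F = space M" "sets F = process_events M W"
    using gen by (auto simp: F_def process_events_def)
  have WF: "W s \<in> borel_measurable F" if "s \<ge> 0" for s
  proof (rule measurableI)
    fix A :: "'a set" assume "A \<in> sets borel"
    then show "W s -` A \<inter> space F \<in> sets F" using that F by (auto simp: process_events_def)
  qed auto
  have TF: "exit_time W D \<in> borel_measurable F"
    by (rule exit_time_measurable[OF WF _ D(1,2)]) (use F bm_continuous[OF BM] in auto)
  have T [measurable]: "exit_time W D \<in> borel_measurable M"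
    by (rule exit_time_measurable[OF _ _ D(1,2)]) (auto intro: bm_measurable[OF BM] bm_continuous[OF BM])
  note [measurable] = S(1)
  define Y where "Y w = ereal (S t w)" for w
  have Y [measurable]: "Y \<in> borel_measurable M" unfolding Y_def by measurable
  have "indep_set (sigma_sets (space M) {exit_time W D -` A \<inter> space M | A. A \<in> sets borel})
        (sigma_sets (space M) {Y -` A \<inter> space M | A. A \<in> sets borel})"
  proof -
    have "sigma_sets (space M) {exit_time W D -` A \<inter> space M | A. A \<in> sets borel} \<subseteq> process_events M W"
    proof -
      have "sigma_sets (space F) {exit_time W D -` A \<inter> space M | A. A \<in> sets borel} \<subseteq> sets F"
        using measurable_sets[OF TF] by (intro sets.sigma_sets_subset) (auto simp flip: F(1))
      then show ?thesis by (simp add: F)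
    qed
    moreover have "{Y -` A \<inter> space M | A. A \<in> sets borel} \<subseteq> {S t -` A \<inter> space M | t A. 0 \<le> t \<and> A \<in> sets borel}"
    proof clarify
      fix A :: "ereal set" assume A: "A \<in> sets borel"
      have "(ereal -` A :: real set) \<in> sets borel" using measurable_sets[OF borel_measurable_ereal[OF measurable_ident] A] by simp
      then show "\<exists>t' A'. Y -` A \<inter> space M = S t' -` A' \<inter> space M \<and> 0 \<le> t' \<and> A' \<in> sets borel"
        using t by (intro exI[of _ t] exI[of _ "ereal -` A"]) (auto simp: Y_def)
    qed
    then have "sigma_sets (space M) {Y -` A \<inter> space M | A. A \<in> sets borel} \<subseteq> process_events M S"
      unfolding process_events_def by (rule sigma_sets_mono')
    ultimately show ?thesis
      using ind unfolding independent_processes_def indep_set_def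
      by (elim indep_sets_mono_sets) (auto split: bool.split)
  qed
  then have iv: "indep_var borel (exit_time W D) borel Y"
    unfolding indep_var_eq using T Y by simp
  interpret T: prob_space "distr M borel (exit_time W D)" by (rule prob_space_distr) simp
  interpret Y: prob_space "distr M borel Y" by (rule prob_space_distr) simp
  interpret S: prob_space "distr M borel (S t)" by (rule prob_space_distr) simp
  \<comment> \<open>Measurability of this strict order relation comes from a countable union of
    rectangles separated by rational levels.\<close>
  define Q where "Q = {p :: ereal \<times> ereal. snd p < fst p}"
  have Q [measurable]: "Q \<in> sets (borel \<Otimes>\<^sub>M borel)"
  proof -
    have "Q = (\<Union>q\<in>\<rat>. {ereal q<..} \<times> {..<ereal q})"
      using ereal_dense3 less_trans by (fastforce simp: Q_def Rats_def)
    then show ?thesis using countable_rat by (auto intro!: sets.countable_UN')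
  qed
  have "emeasure M {w \<in> space M. exit_time W D w > ereal (S t w)} =
      emeasure (distr M (borel \<Otimes>\<^sub>M borel) (\<lambda>w. (exit_time W D w, Y w))) Q"
    by (subst emeasure_distr[OF _ Q]) (auto simp: Q_def Y_def intro!: arg_cong2[where f=emeasure])
  also have "\<dots> = emeasure (distr M borel (exit_time W D) \<Otimes>\<^sub>M distr M borel Y) Q"
    using iv by (simp add: indep_var_distribution_eq)
  also have "\<dots> = (\<integral>\<^sup>+s. emeasure (distr M borel (exit_time W D)) ((\<lambda>a. (a, s)) -` Q) \<partial>distr M borel Y)"
    by (rule pair_sigma_finite.emeasure_pair_measure_alt2)
      (auto simp: pair_sigma_finite_def T.sigma_finite_measure_axioms Y.sigma_finite_measure_axioms cong: sets_pair_measure_cong)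
  also have "\<dots> = (\<integral>\<^sup>+s. emeasure M {w \<in> space M. s < exit_time W D w} \<partial>distr M borel Y)"
  proof (rule nn_integral_cong)
    fix s
    have "(\<lambda>a. (a, s)) -` Q = {s<..}" by (auto simp: Q_def)
    then show "emeasure (distr M borel (exit_time W D)) ((\<lambda>a. (a, s)) -` Q) = emeasure M {w \<in> space M. s < exit_time W D w}"
      by (subst emeasure_distr) (auto intro!: arg_cong2[where f=emeasure])
  qed
  also have "\<dots> = (\<integral>\<^sup>+w. emeasure M {w' \<in> space M. Y w < exit_time W D w'} \<partial>M)"
    by (rule nn_integral_distr) measurable
  also have "\<dots> = (\<integral>\<^sup>+w. ennreal (surv M W D (S t w)) \<partial>M)"
    using S(2)
    by (intro nn_integral_cong_AE) (auto simp: Y_def emeasure_eq_measure surv_eq_exit_time[OF BM D] elim!: eventually_mono)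
  also have "\<dots> = (\<integral>\<^sup>+s. ennreal (surv M W D s) \<partial>distr M borel (S t))"
    using surv_measurable[OF BM D(1,2)] by (subst nn_integral_distr) auto
  also have "\<dots> = ennreal (\<integral>s. surv M W D s \<partial>distr M borel (S t))"
    using surv_measurable[OF BM D(1,2)] surv_bounds[OF BM]
    by (intro nn_integral_eq_integral S.integrable_const_bound[where B=1]) auto
  finally show ?thesis
    using surv_bounds[OF BM] by (simp add: emeasure_eq_measure integral_nonneg)
qed

section \<open>Boundary layers of C11 open sets\<close>

lemma frontier_point_between:
  fixes x y :: "'a::euclidean_space"
  assumes "x \<in> D" "y \<notin> D"
  obtains z where "z \<in> frontier D" "dist x z \<le> dist x y" "dist z y \<le> dist x y"
proof -
  have "closed_segment x y \<inter> frontier D \<noteq> {}"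
    using assms by (intro connected_Int_frontier) auto
  then obtain z where z: "z \<in> closed_segment x y" "z \<in> frontier D" by auto
  then show thesis using that[of z] segment_bound[of z x y] by (auto simp: dist_norm norm_minus_commute)
qed

text \<open>The translates of the slab by multiples of \<open>\<eta> e\<close> are disjoint, and about \<open>\<rho> / \<eta>\<close> of them fit into the larger ball.\<close>

lemma graph_slab_measure:
  fixes \<phi> :: "'a::euclidean_space \<Rightarrow> real"
  assumes \<phi>: "continuous_on UNIV \<phi>" "\<And>y s. \<phi> (y + s *\<^sub>R e) = \<phi> y" and e: "norm e = 1"
    and \<rho>: "\<rho> > 0" and \<eta>: "\<eta> > 0"
  shows "measure lborel {y \<in> ball z \<rho>. 0 < (y - z) \<bullet> e - \<phi> (y - z) \<and> (y - z) \<bullet> e - \<phi> (y - z) < \<eta>}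
    \<le> measure lborel (ball z (2 * \<rho>)) / \<rho> * \<eta>"
proof -
  define A where "A = {y \<in> ball z \<rho>. 0 < (y - z) \<bullet> e - \<phi> (y - z) \<and> (y - z) \<bullet> e - \<phi> (y - z) < \<eta>}"
  \<comment> \<open>Since \<open>K * \<eta> \<le> \<rho>\<close>, all translates up to index K stay
    in the ball of radius 2 \<rho>; since \<open>\<rho> \<le> (K + 1) * \<eta>\<close>, their K + 1
    equal volumes add up to at least \<rho> / \<eta> times the volume of the slab.\<close>
  define K where "K = nat \<lfloor>\<rho> / \<eta>\<rfloor>"
  define T where "T k = (+) ((real k * \<eta>) *\<^sub>R e) ` A" for k :: nat
  have cont: "continuous_on UNIV (\<lambda>y. \<phi> (y - z))"
    by (rule continuous_on_compose2[OF \<phi>(1)]) (auto intro!: continuous_intros)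
  have "A = ball z \<rho> \<inter> ({y. 0 < (y - z) \<bullet> e - \<phi> (y - z)} \<inter> {y. (y - z) \<bullet> e - \<phi> (y - z) < \<eta>})"
    by (auto simp: A_def)
  moreover have "open \<dots>"
    by (intro open_Int open_ball open_Collect_less continuous_intros cont)
  ultimately have A: "open A" by simp
  have T_open: "open (T k)" for k unfolding T_def by (rule open_translation[OF A])
  have T_iff: "y \<in> T k \<Longrightarrow> real k * \<eta> < (y - z) \<bullet> e - \<phi> (y - z) \<and> (y - z) \<bullet> e - \<phi> (y - z) < real (Suc k) * \<eta>" for y k
  proof -
    assume "y \<in> T k"
    then obtain x where x: "x \<in> A" "y = (real k * \<eta>) *\<^sub>R e + x" by (auto simp: T_def)
    have eq: "y - z = (x - z) + (real k * \<eta>) *\<^sub>R e" using x by simp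
    have "\<phi> (y - z) = \<phi> (x - z)" unfolding eq by (rule \<phi>(2))
    moreover have "(y - z) \<bullet> e = (x - z) \<bullet> e + real k * \<eta>"
      unfolding eq using e by (simp add: inner_add_left norm_eq_1)
    ultimately show ?thesis using x by (auto simp: A_def algebra_simps)
  qed
  have disj: "disjoint_family_on T {..K}"
  proof (unfold disjoint_family_on_def, intro ballI impI)
    have "T k \<inter> T l = {}" if "k < l" for k l
    proof -
      have "real (Suc k) * \<eta> \<le> real l * \<eta>" using that \<eta> by (intro mult_right_mono) auto
      then show ?thesis using T_iff[of _ k] T_iff[of _ l] by fastforce
    qed
    then show "T k \<inter> T l = {}" if "k \<noteq> l" for k l using that by (metis Int_commute linorder_neqE_nat)
  qed
  have K: "real K * \<eta> \<le> \<rho>" "\<rho> \<le> real (Suc K) * \<eta>"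
  proof -
    have "real K = of_int \<lfloor>\<rho> / \<eta>\<rfloor>" using \<rho> \<eta> by (simp add: K_def)
    then have "real K \<le> \<rho> / \<eta>" "\<rho> / \<eta> \<le> real K + 1" by linarith+
    then show "real K * \<eta> \<le> \<rho>" "\<rho> \<le> real (Suc K) * \<eta>" using \<eta> by (simp_all add: field_simps)
  qed
  have sub: "(\<Union>k\<in>{..K}. T k) \<subseteq> ball z (2 * \<rho>)"
  proof (clarsimp simp: T_def)
    fix k x assume kx: "k \<le> K" "x \<in> A"
    have "real k * \<eta> \<le> real K * \<eta>" using kx \<eta> by (intro mult_right_mono) auto
    moreover have "norm ((real k * \<eta>) *\<^sub>R e) = real k * \<eta>" using e \<eta> by simp
    ultimately have *: "norm ((real k * \<eta>) *\<^sub>R e) \<le> \<rho>" using K by linarith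
    have "dist z ((real k * \<eta>) *\<^sub>R e + x) = norm ((z - x) - (real k * \<eta>) *\<^sub>R e)"
      by (simp add: dist_norm algebra_simps)
    also have "\<dots> \<le> norm (z - x) + norm ((real k * \<eta>) *\<^sub>R e)" by (rule norm_triangle_ineq4)
    also have "\<dots> < 2 * \<rho>" using kx * by (auto simp: A_def dist_norm)
    finally show "dist z ((k * \<eta>) *\<^sub>R e + x) < 2 * \<rho>" .
  qed
  have meas: "measure lborel (T k) = measure lborel A" for k
  proof -
    define c where "c = - (real k * \<eta>) *\<^sub>R e"
    have Tk: "T k = (+) c -` A"
    proof (intro equalityI subsetI)
      fix y assume "y \<in> (+) c -` A"
      then show "y \<in> T k" unfolding T_def by (intro image_eqI[of _ _ "c + y"]) (auto simp: c_def)
    qed (auto simp: T_def c_def)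
    have "measure lborel (T k) = measure (distr lborel borel ((+) c)) A"
      unfolding Tk using A by (subst measure_distr) auto
    then show ?thesis by (simp only: lborel_distr_plus)
  qed
  have fin: "emeasure lborel (T k) \<noteq> \<infinity>" if "k \<in> {..K}" for k
  proof -
    have "emeasure lborel (T k) \<le> emeasure lborel (ball z (2 * \<rho>))"
      using sub that by (intro emeasure_mono) auto
    also have "\<dots> < \<infinity>" by (rule emeasure_lborel_ball_finite)
    finally show ?thesis by simp
  qed
  have "\<rho> * measure lborel A \<le> real (Suc K) * \<eta> * measure lborel A"
    using K by (intro mult_right_mono) auto
  also have "\<dots> = \<eta> * (\<Sum>k\<in>{..K}. measure lborel (T k))" by (simp add: meas)
  also have "(\<Sum>k\<in>{..K}. measure lborel (T k)) = measure lborel (\<Union>k\<in>{..K}. T k)"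
    using T_open disj fin by (intro measure_finite_Union[symmetric]) auto
  also have "\<dots> \<le> measure lborel (ball z (2 * \<rho>))"
    using sub T_open by (intro measure_mono_fmeasurable) (auto intro!: fmeasurableI emeasure_lborel_ball_finite)
  finally show ?thesis using \<rho> \<eta> by (simp add: A_def field_simps)
qed

text \<open>In a chart the gradient bound makes the graph \<Lambda>-Lipschitz, so a point of
  \<open>D\<close> within \<epsilon> of a point outside has height below (1 + \<Lambda>) \<epsilon>
  over it and lies in a thin slab. Compactness of the frontier leaves finitely many slabs.\<close>

lemma boundary_layer:
  fixes D :: "'a::euclidean_space set"
  assumes D: "bounded D" "C11_open D"
  shows "\<exists>K\<ge>0. \<forall>\<epsilon>>0. measure lborel {x \<in> D. infdist x (- D) < \<epsilon>} \<le> K * \<epsilon>"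
proof -
  have "open D" using D by (simp add: C11_open_def)
  have D_ne: "- D \<noteq> {}" using D(1) by (metis Compl_UNIV_eq compl_eq_compl_iff not_bounded_UNIV)
  obtain \<rho> \<Lambda> where \<rho>: "\<rho> > 0" and \<Lambda>: "\<Lambda> > 0"
    and chart: "\<forall>z\<in>frontier D. \<exists>e \<phi> g.
        norm e = 1 \<and>
        (\<forall>y s. \<phi> (y + s *\<^sub>R e) = \<phi> y) \<and>
        (\<forall>y. GDERIV \<phi> y :> g y) \<and>
        \<phi> 0 = 0 \<and> g 0 = 0 \<and>
        (\<forall>y. norm (g y) \<le> \<Lambda>) \<and>
        (\<forall>y w. norm (g y - g w) \<le> \<Lambda> * norm (y - w)) \<and>
        ball z \<rho> \<inter> D = ball z \<rho> \<inter> {y. (y - z) \<bullet> e > \<phi> (y - z)}"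
    using D(2) unfolding C11_open_def by (elim conjE exE) (rule that; assumption)
  \<comment> \<open>The set \<open>A\<close> contains every point of \<open>D\<close> in the chart
    ball that is \<epsilon>-close to a point outside \<open>D\<close> in the same ball; both points
    must be visible in the chart.\<close>
  let ?catches = "\<lambda>z \<epsilon> A. \<forall>x y. x \<in> D \<longrightarrow> y \<notin> D \<longrightarrow> dist x y < \<epsilon> \<longrightarrow> x \<in> ball z \<rho> \<longrightarrow> y \<in> ball z \<rho> \<longrightarrow> x \<in> A"
  have slab: "\<exists>C\<ge>0. \<forall>\<epsilon>>0. \<exists>A. A \<in> fmeasurable lborel \<and> measure lborel A \<le> C * \<epsilon> \<and>
      ?catches z \<epsilon> A"
    if z: "z \<in> frontier D" for z
  proof -
    from bspec[OF chart z] obtain e \<phi> g where e: "norm e = 1" and "\<forall>y s. \<phi> (y + s *\<^sub>R e) = \<phi> y"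
      and "\<forall>y. GDERIV \<phi> y :> g y" and "\<forall>y. norm (g y) \<le> \<Lambda>"
      and loc: "ball z \<rho> \<inter> D = ball z \<rho> \<inter> {y. (y - z) \<bullet> e > \<phi> (y - z)}"
      by (elim conjE exE) (rule that; assumption)
    then have \<phi>: "\<And>y s. \<phi> (y + s *\<^sub>R e) = \<phi> y" and grad: "\<And>y. GDERIV \<phi> y :> g y"
      and g: "\<And>y. norm (g y) \<le> \<Lambda>" by simp_all
    have der: "(\<phi> has_derivative (\<lambda>h. h \<bullet> g y)) (at y)" for y
      using grad[of y] by (simp add: gderiv_def)
    have cont: "continuous_on UNIV \<phi>"
      using der by (meson continuous_at_imp_continuous_on has_derivative_continuous)
    have lip: "\<bar>\<phi> x - \<phi> y\<bar> \<le> \<Lambda> * norm (x - y)" for x y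
    proof -
      have "norm (\<phi> x - \<phi> y) \<le> \<Lambda> * norm (x - y)"
      proof (rule differentiable_bound[of UNIV \<phi> "\<lambda>y h. h \<bullet> g y"])
        show "onorm (\<lambda>h. h \<bullet> g y) \<le> \<Lambda>" for y
        proof (rule onorm_le)
          fix h
          have "norm (h \<bullet> g y) \<le> norm h * norm (g y)" by (simp add: Cauchy_Schwarz_ineq2)
          also have "\<dots> \<le> norm h * \<Lambda>" using g by (intro mult_left_mono) auto
          finally show "norm (h \<bullet> g y) \<le> \<Lambda> * norm h" by (simp add: mult.commute)
        qed
      qed (use der in auto)
      then show ?thesis by simp
    qed
    define C where "C = measure lborel (ball z (2 * \<rho>)) / \<rho> * (1 + \<Lambda>)"
    show ?thesis
    proof (intro exI[of _ C] conjI allI impI)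
      show "C \<ge> 0" using \<rho> \<Lambda> by (simp add: C_def)
      fix \<epsilon> :: real assume \<epsilon>: "\<epsilon> > 0"
      define A where "A = {y \<in> ball z \<rho>. 0 < (y - z) \<bullet> e - \<phi> (y - z) \<and> (y - z) \<bullet> e - \<phi> (y - z) < (1 + \<Lambda>) * \<epsilon>}"
      have "A = ball z \<rho> \<inter> ({y. 0 < (y - z) \<bullet> e - \<phi> (y - z)} \<inter> {y. (y - z) \<bullet> e - \<phi> (y - z) < (1 + \<Lambda>) * \<epsilon>})"
        by (auto simp: A_def)
      moreover have "open \<dots>"
        by (intro open_Int open_ball open_Collect_less continuous_intros continuous_on_compose2[OF cont]) auto
      ultimately have "open A" by simp
      moreover have "emeasure lborel A < \<infinity>"
        by (rule le_less_trans[OF emeasure_mono emeasure_lborel_ball_finite[of z \<rho>]]) (auto simp: A_def)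
      ultimately have 1: "A \<in> fmeasurable lborel" by (intro fmeasurableI) auto
      have 2: "measure lborel A \<le> C * \<epsilon>"
      proof -
        have "0 < (1 + \<Lambda>) * \<epsilon>" using \<epsilon> \<Lambda> by simp
        from graph_slab_measure[where \<phi>=\<phi> and e=e and z=z, OF cont \<phi> e \<rho> this]
        show ?thesis unfolding A_def[symmetric] C_def by (simp only: mult.assoc)
      qed
      have 3: "x \<in> A" if xy: "x \<in> D" "y \<notin> D" "dist x y < \<epsilon>" "x \<in> ball z \<rho>" "y \<in> ball z \<rho>" for x y
      proof -
        have "x \<in> ball z \<rho> \<inter> D" "y \<notin> ball z \<rho> \<inter> D" using xy by simp_all
        then have x: "\<phi> (x - z) < (x - z) \<bullet> e" and y: "(y - z) \<bullet> e \<le> \<phi> (y - z)"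
          using xy(5) unfolding loc by simp_all
        have "(x - z) \<bullet> e - (y - z) \<bullet> e = (x - y) \<bullet> e" by (simp add: inner_diff_left)
        also have "\<dots> \<le> norm (x - y)" using norm_cauchy_schwarz[of "x - y" e] e by simp
        finally have "(x - z) \<bullet> e - \<phi> (x - z) \<le> norm (x - y) + \<bar>\<phi> (x - z) - \<phi> (y - z)\<bar>" using y by linarith
        also have "\<dots> \<le> norm (x - y) + \<Lambda> * norm (x - y)" using lip[of "x - z" "y - z"] by simp
        also have "\<dots> = (1 + \<Lambda>) * dist x y" by (simp add: dist_norm algebra_simps)
        also have "\<dots> < (1 + \<Lambda>) * \<epsilon>" using xy \<Lambda> by (intro mult_strict_left_mono) auto
        finally show ?thesis using x xy by (simp add: A_def)
      qed
      show "\<exists>A. A \<in> fmeasurable lborel \<and> measure lborel A \<le> C * \<epsilon> \<and>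
        ?catches z \<epsilon> A"
        using 1 2 3 by (intro exI[of _ A]) simp
    qed
  qed
  from bchoice[OF ballI[OF slab]] obtain C where "\<forall>z\<in>frontier D. C z \<ge> 0 \<and> (\<forall>\<epsilon>>0. \<exists>A. A \<in> fmeasurable lborel \<and> measure lborel A \<le> C z * \<epsilon> \<and>
      ?catches z \<epsilon> A)" ..
  then have C: "\<And>z. z \<in> frontier D \<Longrightarrow> C z \<ge> 0"
    and slabs: "\<And>z \<epsilon>. z \<in> frontier D \<Longrightarrow> \<epsilon> > 0 \<Longrightarrow> \<exists>A. A \<in> fmeasurable lborel \<and> measure lborel A \<le> C z * \<epsilon> \<and>
      ?catches z \<epsilon> A"
    by blast+
  have "compact (frontier D)" using D(1) by (rule compact_frontier_bounded)
  \<comment> \<open>Half the chart radius is used for the cover, so a point closer than \<epsilon> <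
    \<rho> / 2 to a covered frontier point still lies in the full chart ball.\<close>
  then obtain F where F: "F \<subseteq> frontier D" "finite F" "frontier D \<subseteq> (\<Union>z\<in>F. ball z (\<rho> / 2))"
  proof (rule compactE_image)
    show "open (ball z (\<rho> / 2))" for z :: 'a by (rule open_ball)
    show "frontier D \<subseteq> (\<Union>z\<in>frontier D. ball z (\<rho> / 2))" using \<rho> by auto
  qed
  define V where "V = measure lborel D"
  have D_fm: "D \<in> fmeasurable lborel"
    using \<open>open D\<close> emeasure_bounded_finite[OF D(1)] by (intro fmeasurableI) auto
  \<comment> \<open>The second summand serves \<epsilon> \<ge> \<rho> / 2, where the layer is
    bounded by the whole volume.\<close>
  define K where "K = (\<Sum>z\<in>F. C z) + 2 * V / \<rho>"
  show ?thesis
  proof (intro exI[of _ K] conjI allI impI)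
    show "K \<ge> 0" unfolding K_def using C F \<rho> by (intro add_nonneg_nonneg sum_nonneg) (auto simp: V_def)
    fix \<epsilon> :: real assume \<epsilon>: "\<epsilon> > 0"
    have layer_meas: "{x \<in> D. infdist x (- D) < \<epsilon>} \<in> sets lborel"
    proof -
      have "open (D \<inter> {x. infdist x (- D) < \<epsilon>})"
        using \<open>open D\<close> by (intro open_Int open_Collect_less continuous_intros) auto
      then show ?thesis by (simp add: Int_def)
    qed
    show "measure lborel {x \<in> D. infdist x (- D) < \<epsilon>} \<le> K * \<epsilon>"
    proof (cases "\<epsilon> < \<rho> / 2")
      case True
      have "\<forall>z\<in>F. \<exists>A. A \<in> fmeasurable lborel \<and> measure lborel A \<le> C z * \<epsilon> \<and>
        ?catches z \<epsilon> A"
        using slabs[OF _ \<epsilon>] F(1) by (intro ballI) (drule subsetD, assumption, simp)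
      from bchoice[OF this] obtain A where "\<forall>z\<in>F. A z \<in> fmeasurable lborel \<and> measure lborel (A z) \<le> C z * \<epsilon> \<and>
        ?catches z \<epsilon> (A z)" ..
      then have A: "\<And>z. z \<in> F \<Longrightarrow> A z \<in> fmeasurable lborel" "\<And>z. z \<in> F \<Longrightarrow> measure lborel (A z) \<le> C z * \<epsilon>"
        "\<And>z x y. z \<in> F \<Longrightarrow> x \<in> D \<Longrightarrow> y \<notin> D \<Longrightarrow> dist x y < \<epsilon> \<Longrightarrow> x \<in> ball z \<rho> \<Longrightarrow> y \<in> ball z \<rho> \<Longrightarrow> x \<in> A z"
        by blast+
      have "{x \<in> D. infdist x (- D) < \<epsilon>} \<subseteq> (\<Union>z\<in>F. A z)"
      proof clarify
        fix x assume x: "x \<in> D" "infdist x (- D) < \<epsilon>"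
        obtain y where y: "y \<in> - D" "dist x y < \<epsilon>"
          using x(2) D_ne by (auto simp: infdist_def cINF_less_iff)
        obtain w where w: "w \<in> frontier D" "dist x w \<le> dist x y"
          using frontier_point_between[of x D y] x y by auto
        then obtain z where z: "z \<in> F" "dist z w < \<rho> / 2" using F by auto
        have "w \<notin> D" using w \<open>open D\<close> by (simp add: frontier_def interior_open)
        moreover have "dist z x < \<rho>" using dist_triangle[of z x w] z w y True by (simp add: dist_commute)
        ultimately show "x \<in> (\<Union>z\<in>F. A z)" using A(3)[OF z(1) x(1), of w] w y z \<rho> by auto
      qed
      then have "measure lborel {x \<in> D. infdist x (- D) < \<epsilon>} \<le> measure lborel (\<Union>z\<in>F. A z)"
        using layer_meas A F by (intro measure_mono_fmeasurable fmeasurable.finite_UN) auto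
      also have "\<dots> \<le> (\<Sum>z\<in>F. measure lborel (A z))"
        using fmeasurableD[OF A(1)] F(2) by (intro measure_UNION_le) auto
      also have "\<dots> \<le> (\<Sum>z\<in>F. C z * \<epsilon>)" by (intro sum_mono A)
      also have "\<dots> \<le> K * \<epsilon>"
        using \<epsilon> \<rho> unfolding K_def by (simp add: sum_distrib_right[symmetric] V_def)
      finally show ?thesis .
    next
      case False
      have "measure lborel {x \<in> D. infdist x (- D) < \<epsilon>} \<le> V"
        unfolding V_def using layer_meas D_fm by (intro measure_mono_fmeasurable) auto
      also have "V \<le> 2 * V / \<rho> * \<epsilon>"
      proof -
        have "V * (\<rho> / 2) \<le> V * \<epsilon>" using False by (intro mult_left_mono) (auto simp: V_def)
        then show ?thesis using \<rho> by (simp add: field_simps)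
      qed
      also have "\<dots> \<le> K * \<epsilon>"
        unfolding K_def using \<epsilon> C F by (intro mult_right_mono) (auto intro!: sum_nonneg)
      finally show ?thesis .
    qed
  qed
qed

text \<open>On a line a function constant along the axis is constant, so \<phi> = 0 and the axis
  points into the interval. The length of the interval is a valid radius, because within it the
  other endpoint is not reached. This lets dimension one share the boundary layer estimate.\<close>

lemma C11_open_interval:
  fixes p q :: "'a::euclidean_space"
  assumes dim: "DIM('a) = 1"
  shows "C11_open (box p q)"
proof (cases "box p q = {}")
  case True
  then show ?thesis unfolding C11_open_def by (auto intro!: exI[of _ "1::real"])
next
  case False
  obtain b :: 'a where B: "Basis = {b}" using dim card_1_singletonE by blast
  have bB: "b \<in> Basis" unfolding B by (rule singletonI)
  have b: "b \<bullet> b = 1" "norm b = 1" using bB by simp_all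
  have rep: "x = (x \<bullet> b) *\<^sub>R b" for x :: 'a using euclidean_representation[of x] unfolding B by simp
  define l where "l = q \<bullet> b - p \<bullet> b"
  have l: "l > 0" using False unfolding box_ne_empty B by (simp add: l_def)
  have fr: "frontier (box p q) \<subseteq> {p, q}"
  proof
    fix z assume "z \<in> frontier (box p q)"
    then have "z \<in> cbox p q - box p q" using frontier_box[of p q] False by auto
    then have "z \<bullet> b = p \<bullet> b \<or> z \<bullet> b = q \<bullet> b" unfolding box_def cbox_def B by auto
    then show "z \<in> {p, q}" using rep by (metis insert_iff)
  qed
  have dist: "dist x y = \<bar>x \<bullet> b - y \<bullet> b\<bar>" for x y :: 'a
  proof -
    have "dist x y = norm (((x - y) \<bullet> b) *\<^sub>R b)" unfolding dist_norm by (subst rep) simp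
    then show ?thesis by (simp add: b inner_diff_left)
  qed
  show ?thesis unfolding C11_open_def
  proof (rule conjI[OF open_box], rule exI[of _ l], rule conjI[OF l], rule exI[of _ 1],
      rule conjI[OF zero_less_one], rule ballI)
    fix z assume "z \<in> frontier (box p q)"
    then have "z = p \<or> z = q" using fr by auto
    then have "ball z l \<inter> box p q = ball z l \<inter> {y. (y - z) \<bullet> (if z = p then b else - b) > 0}"
      unfolding box_def B using l by (auto simp: dist l_def inner_diff_left split: if_splits)
    then show "\<exists>e \<phi> g. norm e = 1 \<and> (\<forall>y s. \<phi> (y + s *\<^sub>R e) = \<phi> y) \<and> (\<forall>y. GDERIV \<phi> y :> g y) \<and>
        \<phi> 0 = 0 \<and> g 0 = 0 \<and> (\<forall>y. norm (g y) \<le> 1) \<and> (\<forall>y w. norm (g y - g w) \<le> 1 * norm (y - w)) \<and>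
        ball z l \<inter> box p q = ball z l \<inter> {y. (y - z) \<bullet> e > \<phi> (y - z)}"
      by (intro exI[of _ "if z = p then b else - b"] exI[of _ "\<lambda>_. 0"])
        (auto simp: b gderiv_def)
  qed
qed

section \<open>Heat loss\<close>

text \<open>
  The laws \<open>P x\<close> of the theorem live on unrelated probability spaces. Translating one Brownian motion
  realises all starting points on a single space, which is what makes the survival probability
  measurable in the starting point.
\<close>

definition shifted :: "(real \<Rightarrow> 'w \<Rightarrow> 'a::real_vector) \<Rightarrow> 'a \<Rightarrow> real \<Rightarrow> 'w \<Rightarrow> 'a" where
  "shifted W x t w = x + (W t w - W 0 w)"

lemma shifted_bm:
  fixes W :: "real \<Rightarrow> 'w \<Rightarrow> 'a::euclidean_space"
  shows "brownian_motion M z W \<Longrightarrow> brownian_motion M x (shifted W x)"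
  using bm_recenter[of M z W x] unfolding shifted_def[abs_def] .

definition heat_loss :: "'w measure \<Rightarrow> (real \<Rightarrow> 'w \<Rightarrow> 'a::euclidean_space) \<Rightarrow> 'a set \<Rightarrow> real \<Rightarrow> real" where
  "heat_loss M W D s = (LINT x:D|lborel. 1 - surv M (shifted W x) D s)"

lemma bounded_not_UNIV: "bounded (D :: 'a::euclidean_space set) \<Longrightarrow> D \<noteq> UNIV"
  using not_bounded_UNIV by blast

lemma fmeasurable_bounded_open:
  "open (D :: 'a::euclidean_space set) \<Longrightarrow> bounded D \<Longrightarrow> D \<in> fmeasurable lborel"
  using emeasure_bounded_finite[of D] by (intro fmeasurableI) auto

lemma indicator_integrable:
  "open (D :: 'a::euclidean_space set) \<Longrightarrow> bounded D \<Longrightarrow> integrable lborel (indicator D :: 'a \<Rightarrow> real)"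
  using fmeasurable_bounded_open[of D] by (simp add: fmeasurable_def less_top[symmetric])

context
  fixes M :: "'w measure" and z :: "'a::euclidean_space" and W :: "real \<Rightarrow> 'w \<Rightarrow> 'a"
  assumes BM: "brownian_motion M z W"
begin

text \<open>Shifting turns the starting point into a coordinate, so the exit time is jointly
  measurable in point and path, and survival is the measure of a section of a measurable
  set.\<close>

lemma surv_shifted_measurable:
  assumes D: "open D" "D \<noteq> UNIV"
  shows "(\<lambda>(s, x). surv M (shifted W x) D s) \<in> borel_measurable (borel \<Otimes>\<^sub>M borel)"
proof -
  interpret prob_space M by (rule bm_prob_space[OF BM])
  have [measurable]: "D \<in> sets borel" using D by simp
  have W [measurable]: "t \<ge> 0 \<Longrightarrow> W t \<in> borel_measurable M" for t by (rule bm_measurable[OF BM])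
  define X where "X t p = fst p + (W t (snd p) - W 0 (snd p))" for t :: real and p :: "'a \<times> 'w"
  have T [measurable]: "exit_time X D \<in> borel_measurable (borel \<Otimes>\<^sub>M M)"
  proof (rule exit_time_measurable[OF _ _ D])
    show "X t \<in> borel_measurable (borel \<Otimes>\<^sub>M M)" if "t \<ge> 0" for t
      unfolding X_def using that by measurable
    show "continuous_on {0..} (\<lambda>t. X t p)" if "p \<in> space (borel \<Otimes>\<^sub>M M)" for p
      unfolding X_def using that by (intro continuous_intros bm_continuous[OF BM]) (auto simp: space_pair_measure)
  qed
  define Q where "Q = {p \<in> space ((borel \<Otimes>\<^sub>M borel) \<Otimes>\<^sub>M M). ereal (fst (fst p)) < exit_time X D (snd (fst p), snd p)}"
  have Q: "Q \<in> sets ((borel \<Otimes>\<^sub>M borel) \<Otimes>\<^sub>M M)" unfolding Q_def by measurable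
  have "(\<lambda>q. measure M (Pair q -` Q)) \<in> borel_measurable (borel \<Otimes>\<^sub>M borel)"
    unfolding measure_def by (intro borel_measurable_enn2real measurable_emeasure_Pair[OF Q])
  note [measurable] = this
  \<comment> \<open>The exit time describes survival only for a nonnegative time and a start in
    \<open>D\<close>. Otherwise survival is 1 for negative times and 0 for a start outside
    \<open>D\<close>, since it includes time 0.\<close>
  have "(\<lambda>q. if fst q < 0 then 1 else if snd q \<in> D then measure M (Pair q -` Q) else 0) \<in> borel_measurable (borel \<Otimes>\<^sub>M borel)"
    by measurable
  also have "(\<lambda>q. if fst q < 0 then 1 else if snd q \<in> D then measure M (Pair q -` Q) else 0) =
    (\<lambda>(s, x). surv M (shifted W x) D s)"
  proof (rule ext, clarify)
    fix s :: real and x :: 'a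
    have eq: "exit_time X D (x, w) = exit_time (shifted W x) D w" for w
      by (simp add: exit_time_def X_def shifted_def)
    have "Pair (s, x) -` Q = {w \<in> space M. ereal s < exit_time (shifted W x) D w}"
      by (auto simp: Q_def eq space_pair_measure)
    then have "measure M (Pair (s, x) -` Q) = surv M (shifted W x) D s" if "s \<ge> 0" "x \<in> D"
      using surv_eq_exit_time[OF shifted_bm[OF BM] D that(2,1)] by simp
    moreover have "surv M (shifted W x) D s = 1" if "s < 0" using that by (simp add: surv_def prob_space)
    moreover have "surv M (shifted W x) D s = 0" if "s \<ge> 0" "x \<notin> D"
    proof -
      have "{w \<in> space M. \<forall>t\<in>{0..s}. shifted W x t w \<in> D} = {}"
        using that by (auto simp: shifted_def intro!: bexI[of _ 0])
      then show ?thesis unfolding surv_def by (simp only: measure_empty)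
    qed
    ultimately show "(if fst (s, x) < 0 then 1 else if snd (s, x) \<in> D then measure M (Pair (s, x) -` Q) else 0) = surv M (shifted W x) D s"
      by auto
  qed
  finally show ?thesis .
qed

lemma surv_shifted_bounds: "0 \<le> surv M (shifted W x) D s" "surv M (shifted W x) D s \<le> 1"
  using surv_bounds[OF shifted_bm[OF BM]] by auto

lemma heat_loss_integrable:
  assumes D: "open D" "bounded D"
  shows "integrable lborel (\<lambda>x. indicator D x *\<^sub>R (1 - surv M (shifted W x) D s))"
proof (rule integrableI_bounded_set[where A=D and B=1])
  have "(\<lambda>x. (\<lambda>(s, x). surv M (shifted W x) D s) (s, x)) \<in> borel_measurable borel"
    by (rule measurable_compose[OF _ surv_shifted_measurable[OF D(1) bounded_not_UNIV[OF D(2)]]]) simp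
  then have "(\<lambda>x. surv M (shifted W x) D s) \<in> borel_measurable borel" by simp
  then have "(\<lambda>x. indicator D x *\<^sub>R (1 - surv M (shifted W x) D s)) \<in> borel_measurable borel"
    using D by (intro borel_measurable_scaleR borel_measurable_indicator borel_measurable_diff borel_measurable_const) auto
  then show "(\<lambda>x. indicator D x *\<^sub>R (1 - surv M (shifted W x) D s)) \<in> borel_measurable lborel"
    by simp
  show "emeasure lborel D < \<infinity>" using D by (intro emeasure_bounded_finite)
  show "AE x\<in>D in lborel. norm (indicator D x *\<^sub>R (1 - surv M (shifted W x) D s)) \<le> 1"
    using surv_shifted_bounds by (auto simp: indicator_def)
qed (use D in \<open>auto simp: indicator_def\<close>)

lemma heat_loss_nonneg: "0 \<le> heat_loss M W D s"
  unfolding heat_loss_def set_lebesgue_integral_def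
  using surv_shifted_bounds by (intro Bochner_Integration.integral_nonneg) auto

lemma heat_loss_le:
  assumes D: "open D" "bounded D"
  shows "heat_loss M W D s \<le> measure lborel D"
proof -
  have "heat_loss M W D s \<le> (\<integral>x. indicator D x \<partial>lborel)"
    unfolding heat_loss_def set_lebesgue_integral_def
    using surv_shifted_bounds
    by (intro integral_mono heat_loss_integrable D indicator_integrable) (auto simp: indicator_def)
  then show ?thesis by simp
qed

lemma heat_loss_mono:
  assumes D: "open D" "bounded D"
  shows "mono (heat_loss M W D)"
proof (rule monoI)
  fix s t :: real assume "s \<le> t"
  then have "surv M (shifted W x) D t \<le> surv M (shifted W x) D s" for x
    using surv_antimono[OF shifted_bm[OF BM] D(1) bounded_not_UNIV[OF D(2)]] by (rule antimonoD[rotated])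
  then show "heat_loss M W D s \<le> heat_loss M W D t"
    unfolding heat_loss_def set_lebesgue_integral_def
    by (intro integral_mono heat_loss_integrable D) (auto simp: indicator_def)
qed

lemma heat_loss_nonpos:
  assumes D: "open D" and s: "s \<le> 0"
  shows "heat_loss M W D s = 0"
proof -
  interpret prob_space M by (rule bm_prob_space[OF BM])
  have "surv M (shifted W x) D s = 1" if "x \<in> D" for x
  proof (cases "s = 0")
    case True
    then show ?thesis using surv_0[OF shifted_bm[OF BM] D] that by simp
  qed (use s in \<open>simp add: surv_def prob_space\<close>)
  then show ?thesis
    unfolding heat_loss_def set_lebesgue_integral_def
    by (intro integral_eq_zero_AE) (auto simp: indicator_def)
qed

text \<open>The image of a path on [0, s] is connected, so a path inside the union of two disjoint
  open sets never leaves the one in which it starts.\<close>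

lemma heat_loss_union:
  assumes A: "open A" "bounded A" and B: "open B" "bounded B" and disj: "A \<inter> B = {}"
  shows "heat_loss M W (A \<union> B) s = heat_loss M W A s + heat_loss M W B s"
proof -
  have surv: "surv M (shifted W x) (A \<union> B) s = surv M (shifted W x) A s"
    if A: "open A" and B: "open B" and disj: "A \<inter> B = {}" and x: "x \<in> A" for x and A B :: "'a set"
  proof -
    have "(\<forall>t\<in>{0..s}. shifted W x t w \<in> A \<union> B) \<longleftrightarrow> (\<forall>t\<in>{0..s}. shifted W x t w \<in> A)"
      if w: "w \<in> space M" for w
    proof
      assume *: "\<forall>t\<in>{0..s}. shifted W x t w \<in> A \<union> B"
      have "continuous_on {0..s} (\<lambda>t. shifted W x t w)"
        by (rule continuous_on_subset[OF bm_continuous[OF shifted_bm[OF BM] w]]) auto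
      then have "connected ((\<lambda>t. shifted W x t w) ` {0..s})"
        by (rule connected_continuous_image) simp
      moreover have "(\<lambda>t. shifted W x t w) ` {0..s} \<subseteq> A \<union> B" using * by auto
      ultimately have "A \<inter> (\<lambda>t. shifted W x t w) ` {0..s} = {} \<or> B \<inter> (\<lambda>t. shifted W x t w) ` {0..s} = {}"
        using disj A B unfolding connected_def by blast
      moreover have "A \<inter> (\<lambda>t. shifted W x t w) ` {0..s} \<noteq> {}" if "0 \<le> s"
      proof -
        have "shifted W x 0 w \<in> A" using x by (simp add: shifted_def)
        then show ?thesis using that by auto
      qed
      ultimately show "\<forall>t\<in>{0..s}. shifted W x t w \<in> A" using * by fastforce
    qed auto
    then have "{w \<in> space M. \<forall>t\<in>{0..s}. shifted W x t w \<in> A \<union> B} = {w \<in> space M. \<forall>t\<in>{0..s}. shifted W x t w \<in> A}"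
      by blast
    then show ?thesis unfolding surv_def by (simp only:)
  qed
  have "indicator (A \<union> B) x *\<^sub>R (1 - surv M (shifted W x) (A \<union> B) s) =
      indicator A x *\<^sub>R (1 - surv M (shifted W x) A s) + indicator B x *\<^sub>R (1 - surv M (shifted W x) B s)" for x
    using surv[of A B x] surv[of B A x] A B disj by (auto simp: indicator_def Un_commute)
  note eq = this
  show ?thesis
    unfolding heat_loss_def set_lebesgue_integral_def eq
    by (rule Bochner_Integration.integral_add) (intro heat_loss_integrable A B)+
qed

lemma heat_loss_UN:
  assumes "finite J" "\<And>j. j \<in> J \<Longrightarrow> open (D j)" "\<And>j. j \<in> J \<Longrightarrow> bounded (D j)" "disjoint_family_on D J"
  shows "heat_loss M W (\<Union>j\<in>J. D j) s = (\<Sum>j\<in>J. heat_loss M W (D j) s)"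
  using assms
proof (induction J rule: finite_induct)
  case empty
  then show ?case by (simp only: heat_loss_def set_lebesgue_integral_def) simp
next
  case (insert j J)
  have "D j \<inter> (\<Union>j\<in>J. D j) = {}"
    using insert.prems(3) insert.hyps(2) unfolding disjoint_family_on_def by fastforce
  moreover have "disjoint_family_on D J"
    using insert.prems(3) by (rule disjoint_family_on_mono[rotated]) auto
  moreover have "open (D j)" "bounded (D j)" "open (\<Union>j\<in>J. D j)" "bounded (\<Union>j\<in>J. D j)"
    using insert.prems(1,2) insert.hyps(1) by (auto intro!: bounded_UN)
  ultimately show ?case
    using insert.IH insert.prems(1,2) insert.hyps by (simp add: heat_loss_union)
qed

text \<open>Pulling the path from R x back by the inverse of R gives a Brownian motion from x whose
  clock runs r^2 times as fast, so the horizon s becomes s / r^2. \<open>surv_law\<close> replaces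
  it by the shifted path, and the change of variables contributes r^d.\<close>

lemma heat_loss_similitude:
  assumes R: "similitude r R" and D: "open D" "bounded D"
  shows "heat_loss M W (R ` D) s = r ^ DIM('a) * heat_loss M W D (s / r\<^sup>2)"
proof -
  have r: "r > 0" using R by (rule similitude_pos)
  have bij: "bij R" using R by (rule similitude_bij)
  have D': "open (R ` D)" using R D(1) by (rule similitude_open_image)
  have bdd: "bounded (R ` D)"
  proof -
    obtain e where "\<forall>y\<in>D. dist 0 y \<le> e" using D(2) by (auto simp: bounded_any_center[of _ 0])
    then have "\<forall>y\<in>R ` D. dist (R 0) y \<le> r * e" using r by (auto simp: similitude_dist[OF R])
    then show ?thesis unfolding bounded_def by blast
  qed
  have surv: "surv M (shifted W (R x)) (R ` D) s = surv M (shifted W x) D (s / r\<^sup>2)" for x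
  proof (cases "s < 0")
    case True
    then show ?thesis using r by (simp add: surv_def divide_neg_pos)
  next
    case False
    define Y where "Y t w = inv R (shifted W (R x) (t / (1 / r)\<^sup>2) w)" for t w
    have "brownian_motion M (inv R (R x)) Y"
      unfolding Y_def[abs_def] by (rule bm_similitude[OF shifted_bm[OF BM] similitude_inv[OF R]])
    then have Y: "brownian_motion M x Y" using bij by (simp add: bij_is_inj)
    have "(\<forall>t\<in>{0..s}. shifted W (R x) t w \<in> R ` D) \<longleftrightarrow> (\<forall>t\<in>{0..s / r\<^sup>2}. Y t w \<in> D)" for w
    proof -
      have "(\<forall>t\<in>{0..s}. P t) \<longleftrightarrow> (\<forall>t\<in>{0..s / r\<^sup>2}. P (t / (1 / r)\<^sup>2))" for P
      proof (intro iffI ballI)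
        fix t assume "\<forall>t\<in>{0..s}. P t" "t \<in> {0..s / r\<^sup>2}"
        then show "P (t / (1 / r)\<^sup>2)" using r by (auto simp: power_divide field_simps)
      next
        fix t assume P: "\<forall>t\<in>{0..s / r\<^sup>2}. P (t / (1 / r)\<^sup>2)" and t: "t \<in> {0..s}"
        have "t / r\<^sup>2 \<in> {0..s / r\<^sup>2}" using t r by (auto simp: divide_right_mono)
        with P have "P (t / r\<^sup>2 / (1 / r)\<^sup>2)" by blast
        then show "P t" using r by (simp add: power_divide)
      qed
      then show ?thesis by (simp add: Y_def similitude_image_eq_vimage[OF R])
    qed
    then have "surv M (shifted W (R x)) (R ` D) s = surv M Y D (s / r\<^sup>2)" by (simp add: surv_def)
    also have "\<dots> = surv M (shifted W x) D (s / r\<^sup>2)"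
      using False r by (intro surv_law[OF Y shifted_bm[OF BM] _ D(1) bounded_not_UNIV[OF D(2)]]) auto
    finally show ?thesis .
  qed
  have "heat_loss M W (R ` D) s = (\<integral>y. indicator (R ` D) y *\<^sub>R (1 - surv M (shifted W y) (R ` D) s) \<partial>lborel)"
    by (simp add: heat_loss_def set_lebesgue_integral_def)
  also have "\<dots> = r ^ DIM('a) * (\<integral>x. indicator (R ` D) (R x) *\<^sub>R (1 - surv M (shifted W (R x)) (R ` D) s) \<partial>lborel)"
    using heat_loss_integrable[OF D' bdd] by (intro lborel_integral_similitude[OF R]) auto
  also have "(\<integral>x. indicator (R ` D) (R x) *\<^sub>R (1 - surv M (shifted W (R x)) (R ` D) s) \<partial>lborel) = heat_loss M W D (s / r\<^sup>2)"
    unfolding heat_loss_def set_lebesgue_integral_def surv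
    by (intro Bochner_Integration.integral_cong) (auto simp: indicator_def inj_image_mem_iff[OF bij_is_inj[OF bij]])
  finally show ?thesis .
qed

end

text \<open>Points closer to the complement than r = sqrt s lose at most 1 each. In the shell
  between 2^k r and 2^(k+1) r the loss is at most C / 4^k by \<open>bm_exit_bound\<close>, and the
  volume at most K 2^(k+1) r. The geometric sum is 4 C K r with C = 64 * 2^(d/2), whence
  256.\<close>

lemma heat_loss_sqrt_bound:
  fixes W :: "real \<Rightarrow> 'w \<Rightarrow> 'a::euclidean_space"
  assumes BM: "brownian_motion M z W" and D: "open D" "bounded D" and K: "K \<ge> 0"
    and layer: "\<And>\<epsilon>. \<epsilon> > 0 \<Longrightarrow> measure lborel {x \<in> D. infdist x (- D) < \<epsilon>} \<le> K * \<epsilon>"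
    and s: "s > 0"
  shows "heat_loss M W D s \<le> K * (1 + 256 * 2 powr (real DIM('a) / 2)) * sqrt s"
proof -
  let ?l = "\<lambda>x. ennreal (indicator D x * (1 - surv M (shifted W x) D s))"
  define C where "C = 64 * 2 powr (real DIM('a) / 2)"
  have C: "C > 0" by (simp add: C_def)
  define L where "L \<epsilon> = {x \<in> D. infdist x (- D) < \<epsilon>}" for \<epsilon>
  have D_ne: "- D \<noteq> {}" "D \<noteq> UNIV" using bounded_not_UNIV[OF D(2)] by auto
  have L_sets [measurable]: "L \<epsilon> \<in> sets borel" for \<epsilon>
  proof -
    have "open (D \<inter> {x. infdist x (- D) < \<epsilon>})"
      using D by (intro open_Int open_Collect_less continuous_intros) auto
    then show ?thesis by (simp add: L_def Int_def)
  qed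
  have L_emeasure: "emeasure lborel (L \<epsilon>) \<le> ennreal (K * \<epsilon>)" if "\<epsilon> > 0" for \<epsilon>
  proof -
    have "emeasure lborel (L \<epsilon>) = measure lborel (L \<epsilon>)"
      using emeasure_bounded_finite[of "L \<epsilon>"] bounded_subset[OF D(2), of "L \<epsilon>"]
      by (intro emeasure_eq_ennreal_measure) (auto simp: L_def)
    then show ?thesis using layer[OF that] by (simp add: L_def ennreal_leI)
  qed
  define r where "r = sqrt s"
  have r: "r > 0" "r\<^sup>2 = s" using s by (auto simp: r_def)
  have pw: "?l x \<le>
      indicator (L r) x + (\<Sum>k. ennreal (C * (1 / 4) ^ k) * indicator (L (2 ^ Suc k * r)) x)" for x
  proof (cases "x \<in> D")
    case True
    define \<delta> where "\<delta> = infdist x (- D)"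
    have "\<delta> \<noteq> 0" using in_closed_iff_infdist_zero[of "- D" x] D D_ne True by (auto simp: \<delta>_def)
    then have \<delta>: "\<delta> > 0" using infdist_nonneg[of x "- D"] by (simp add: \<delta>_def)
    show ?thesis
    proof (cases "\<delta> < r")
      case less: True
      have "?l x \<le> 1"
        using surv_shifted_bounds[OF BM, of x D s] True by simp
      also have "1 = indicator (L r) x" using less True by (simp add: L_def \<delta>_def)
      finally show ?thesis by (simp add: add_increasing2)
    next
      case False
      define k where "k = (LEAST k. \<delta> < 2 ^ Suc k * r)"
      have "\<exists>k. \<delta> < 2 ^ Suc k * r"
      proof -
        obtain n where "\<delta> / r < 2 ^ n" using real_arch_pow[of 2 "\<delta> / r"] by auto
        then have "\<delta> < 2 ^ n * r" using r by (simp add: field_simps)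
        also have "\<dots> \<le> 2 ^ Suc n * r" using r by simp
        finally show ?thesis by blast
      qed
      then have k: "\<delta> < 2 ^ Suc k * r" unfolding k_def by (rule LeastI_ex)
      have k': "2 ^ k * r \<le> \<delta>"
      proof (cases k)
        case 0
        then show ?thesis using False by simp
      next
        case (Suc l)
        then show ?thesis using not_less_Least[of l "\<lambda>k. \<delta> < 2 ^ Suc k * r"] unfolding k_def by simp
      qed
      have "1 - surv M (shifted W x) D s \<le> C * s / \<delta>\<^sup>2"
        unfolding C_def using \<delta> by (intro bm_exit_bound[OF shifted_bm[OF BM] s D(1) D_ne(2)]) (auto simp: \<delta>_def)
      also have "\<dots> \<le> C * s / (2 ^ k * r)\<^sup>2"
        using C s r k' \<delta> by (intro divide_left_mono power_mono mult_nonneg_nonneg mult_pos_pos) auto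
      also have "\<dots> = C * (1 / 4) ^ k"
      proof -
        have "(2 ^ k)\<^sup>2 = (4::real) ^ k"
          using power_mult_distrib[of 2 "2::real" k] by (simp add: power2_eq_square)
        then show ?thesis using s by (simp add: power_mult_distrib r power_divide)
      qed
      finally have "?l x \<le> ennreal (C * (1 / 4) ^ k)"
        using True by (intro ennreal_leI) simp
      also have "\<dots> = (\<Sum>j\<in>{k}. ennreal (C * (1 / 4) ^ j) * indicator (L (2 ^ Suc j * r)) x)"
        using k True by (simp add: L_def \<delta>_def)
      also have "\<dots> \<le> (\<Sum>k. ennreal (C * (1 / 4) ^ k) * indicator (L (2 ^ Suc k * r)) x)"
        by (rule sum_le_suminf) auto
      finally show ?thesis by (simp add: add_increasing)
    qed
  qed simp
  have geo: "(\<Sum>k. ennreal (C * (1 / 4) ^ k * (K * (2 ^ Suc k * r)))) = ennreal (4 * C * K * r)"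
  proof (rule suminf_ennreal_eq)
    have "(\<lambda>k. 2 * C * K * r * (1 / 2) ^ k) sums (2 * C * K * r * (1 / (1 - 1 / 2)))"
      by (intro sums_mult geometric_sums) simp
    moreover have "2 * C * K * r * (1 / 2) ^ k = C * (1 / 4) ^ k * (K * (2 ^ Suc k * r))" for k
      using power_mult_distrib[of "1 / 4" "2 :: real" k] by simp
    moreover have "2 * C * K * r * (1 / (1 - 1 / 2)) = 4 * C * K * r" by simp
    ultimately show "(\<lambda>k. C * (1 / 4) ^ k * (K * (2 ^ Suc k * r))) sums (4 * C * K * r)" by (simp only:)
  qed (use C K r in auto)
  have "ennreal (heat_loss M W D s) = (\<integral>\<^sup>+x. ?l x \<partial>lborel)"
    unfolding heat_loss_def set_lebesgue_integral_def
    using heat_loss_integrable[OF BM D, of s] surv_shifted_bounds[OF BM]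
    by (subst nn_integral_eq_integral) auto
  also have "\<dots> \<le> (\<integral>\<^sup>+x. indicator (L r) x + (\<Sum>k. ennreal (C * (1 / 4) ^ k) * indicator (L (2 ^ Suc k * r)) x) \<partial>lborel)"
    by (intro nn_integral_mono pw)
  also have "\<dots> = emeasure lborel (L r) + (\<Sum>k. ennreal (C * (1 / 4) ^ k) * emeasure lborel (L (2 ^ Suc k * r)))"
    by (subst nn_integral_add) (auto simp: nn_integral_suminf nn_integral_cmult simp del: power_Suc)
  also have "\<dots> \<le> ennreal (K * r) + (\<Sum>k. ennreal (C * (1 / 4) ^ k * (K * (2 ^ Suc k * r))))"
  proof (intro add_mono suminf_le)
    fix k
    have "ennreal (C * (1 / 4) ^ k) * emeasure lborel (L (2 ^ Suc k * r)) \<le>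
        ennreal (C * (1 / 4) ^ k) * ennreal (K * (2 ^ Suc k * r))"
      using r by (intro mult_left_mono L_emeasure) auto
    then show "ennreal (C * (1 / 4) ^ k) * emeasure lborel (L (2 ^ Suc k * r)) \<le> ennreal (C * (1 / 4) ^ k * (K * (2 ^ Suc k * r)))"
      using C K r by (simp add: ennreal_mult')
  qed (use r in \<open>auto intro: L_emeasure\<close>)
  also have "\<dots> = ennreal (K * r + 4 * C * K * r)"
    unfolding geo using K r C by (intro ennreal_plus[symmetric]) auto
  finally have "heat_loss M W D s \<le> K * r + 4 * C * K * r"
    using K r C by (subst (asm) ennreal_le_iff) auto
  then show ?thesis by (simp add: C_def r_def algebra_simps)
qed

section \<open>The two heat contents expressed by the heat loss under a single law\<close>

lemma heat_content_BM_eq: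
  fixes W :: "real \<Rightarrow> 'w \<Rightarrow> 'a::euclidean_space"
  assumes BM: "\<And>x. brownian_motion (P x) x W" and D: "open D" "bounded D" and s: "s \<ge> 0"
  shows "measure lborel D - heat_content_BM P W D s = heat_loss (P z) W D s"
proof -
  have [measurable]: "D \<in> sets borel" using D by simp
  have "heat_content_BM P W D s = (LINT x:D|lborel. surv (P z) (shifted W x) D s)"
    unfolding heat_content_BM_def
  proof (rule set_lebesgue_integral_cong)
    show "\<forall>x. x \<in> D \<longrightarrow> measure (P x) {w \<in> space (P x). ereal s < exit_time W D w} = surv (P z) (shifted W x) D s"
      using surv_eq_exit_time[OF BM D(1) bounded_not_UNIV[OF D(2)] _ s]
        surv_law[OF BM shifted_bm[OF BM] s D(1) bounded_not_UNIV[OF D(2)]] by simp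
  qed simp
  also have "\<dots> = (\<integral>x. indicator D x - indicator D x *\<^sub>R (1 - surv (P z) (shifted W x) D s) \<partial>lborel)"
    unfolding set_lebesgue_integral_def by (intro Bochner_Integration.integral_cong) (auto simp: indicator_def)
  also have "\<dots> = measure lborel D - heat_loss (P z) W D s"
    unfolding heat_loss_def set_lebesgue_integral_def
    by (subst Bochner_Integration.integral_diff) (auto intro: heat_loss_integrable[OF BM D, simplified] indicator_integrable[OF D])
  finally show ?thesis by simp
qed

text \<open>For each starting point the independent time is integrated out, and survival under
  \<open>P x\<close> is replaced by survival of the shifted path under \<open>P z\<close>. The loss
  is bounded and supported on \<open>D\<close>, a set of finite measure, so Fubini exchanges space
  and random time.\<close>

lemma heat_content_SKBM_eq:
  fixes W :: "real \<Rightarrow> 'w \<Rightarrow> 'a::euclidean_space" and S :: "real \<Rightarrow> 'w \<Rightarrow> real"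
  assumes BM: "\<And>x. brownian_motion (P x) x W" and ind: "\<And>x. independent_processes (P x) W S"
    and D: "open D" "bounded D" and t: "t \<ge> 0"
    and S: "\<And>x. S t \<in> borel_measurable (P x)" "\<And>x. AE w in P x. 0 \<le> S t w" "\<And>x. distr (P x) borel (S t) = \<mu>"
  shows "measure lborel D - heat_content_SKBM P W S D t = (\<integral>s. heat_loss (P z) W D s \<partial>\<mu>)"
proof -
  let ?q = "\<lambda>x. measure (P x) {w \<in> space (P x). exit_time W D w > ereal (S t w)}"
  have [measurable]: "D \<in> sets borel" using D by simp
  have D': "D \<noteq> UNIV" using D by (intro bounded_not_UNIV)
  interpret Pz: prob_space "P z" by (rule bm_prob_space[OF BM])
  interpret \<mu>: prob_space \<mu> unfolding S(3)[of z, symmetric] using S(1) by (rule Pz.prob_space_distr)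
  have sets\<mu> [measurable_cong, simp]: "sets \<mu> = sets borel" by (simp add: S(3)[of z, symmetric])
  have pos: "AE s in \<mu>. 0 \<le> s"
    unfolding S(3)[of z, symmetric] using S(1,2)[of z] by (subst AE_distr_iff) auto
  interpret pair: pair_sigma_finite "lborel :: 'a measure" \<mu> ..
  define p where "p x s = surv (P z) (shifted W x) D s" for x s
  have "(\<lambda>q. (\<lambda>(s, x). p x s) (snd q, fst q)) \<in> borel_measurable (borel \<Otimes>\<^sub>M borel)"
    unfolding p_def by (rule measurable_compose[OF _ surv_shifted_measurable[OF BM D(1) D']]) simp
  then have p_meas [measurable]: "(\<lambda>(x, s). p x s) \<in> borel_measurable (borel \<Otimes>\<^sub>M borel)"
    by (simp add: case_prod_beta')
  have p_bounds: "0 \<le> p x s" "p x s \<le> 1" for x s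
    using surv_shifted_bounds[OF BM] by (auto simp: p_def)
  have p_meas1: "p x \<in> borel_measurable \<mu>" for x
    using measurable_compose[OF measurable_Pair1' p_meas, of x] by (simp cong: measurable_cong_sets)
  have p_int: "integrable \<mu> (p x)" for x
    using p_bounds p_meas1 by (intro \<mu>.integrable_const_bound[where B=1]) auto
  define F where "F x s = indicator D x *\<^sub>R (1 - p x s)" for x s
  have F_int: "integrable (lborel \<Otimes>\<^sub>M \<mu>) (\<lambda>(x, s). F x s)"
  proof (rule integrableI_bounded_set[where A="D \<times> UNIV" and B=1])
    show "D \<times> UNIV \<in> sets (lborel \<Otimes>\<^sub>M \<mu>)" by (intro pair_measureI) auto
    show "(\<lambda>(x, s). F x s) \<in> borel_measurable (lborel \<Otimes>\<^sub>M \<mu>)"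
      unfolding F_def by measurable
    have "emeasure (lborel \<Otimes>\<^sub>M \<mu>) (D \<times> UNIV) = emeasure lborel D * emeasure \<mu> (space \<mu>)"
      using \<mu>.emeasure_pair_measure_Times[of D lborel UNIV] sets_eq_imp_space_eq[OF sets\<mu>] by simp
    also have "\<dots> < \<infinity>" using D emeasure_bounded_finite[of D] by (simp add: \<mu>.emeasure_space_1)
    finally show "emeasure (lborel \<Otimes>\<^sub>M \<mu>) (D \<times> UNIV) < \<infinity>" .
  qed (use p_bounds in \<open>auto simp: F_def indicator_def\<close>)
  have exit: "?q x = (\<integral>s. p x s \<partial>\<mu>)" if "x \<in> D" for x
  proof -
    have "?q x = (\<integral>s. surv (P x) W D s \<partial>\<mu>)"
      using exit_after_independent_time[OF BM ind t S(1,2) D(1) D' that] by (simp add: S(3))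
    also have "\<dots> = (\<integral>s. p x s \<partial>\<mu>)"
    proof (rule integral_cong_AE)
      show "AE s in \<mu>. surv (P x) W D s = p x s"
        using pos by eventually_elim (simp add: p_def surv_law[OF BM shifted_bm[OF BM] _ D(1) D'])
      show "surv (P x) W D \<in> borel_measurable \<mu>"
        using surv_measurable[OF BM D(1) D'] by (simp cong: measurable_cong_sets)
    qed (rule p_meas1)
    finally show ?thesis .
  qed
  have "measure lborel D - heat_content_SKBM P W S D t = (\<integral>x. (\<integral>s. F x s \<partial>\<mu>) \<partial>lborel)"
  proof -
    have inner: "(\<integral>s. F x s \<partial>\<mu>) = indicator D x - indicator D x *\<^sub>R ?q x" for x
      using p_int[of x] exit[of x] \<mu>.prob_space by (auto simp: F_def indicator_def)
    have "integrable lborel (\<lambda>x. \<integral>s. F x s \<partial>\<mu>)" using pair.integrable_fst'[OF F_int] by simp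
    then have "integrable lborel (\<lambda>x. indicator D x - (\<integral>s. F x s \<partial>\<mu>))"
      by (intro Bochner_Integration.integrable_diff indicator_integrable[OF D])
    then have i: "integrable lborel (\<lambda>x. indicator D x *\<^sub>R ?q x)"
      by (simp add: inner)
    show ?thesis
      unfolding inner heat_content_SKBM_def set_lebesgue_integral_def
      by (subst Bochner_Integration.integral_diff) (auto intro: i[simplified] indicator_integrable[OF D])
  qed
  also have "\<dots> = (\<integral>s. (\<integral>x. F x s \<partial>lborel) \<partial>\<mu>)"
    by (rule pair.Fubini_integral[OF F_int, symmetric])
  also have "\<dots> = (\<integral>s. heat_loss (P z) W D s \<partial>\<mu>)"
    by (simp add: heat_loss_def set_lebesgue_integral_def F_def p_def)
  finally show ?thesis .
qed

section \<open>The self-similar set\<close>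

lemma word_map_simps: "word_map R [] = id" "word_map R (j # js) = R j \<circ> word_map R js"
  by (simp_all add: word_map_def)

text \<open>The separate piece \<open>G0\<close> is the contribution of the empty word, which makes
  induction on words possible.\<close>

lemma self_similar_set_eq_UN:
  "self_similar_set N R G0 = (\<Union>js\<in>{js. set js \<subseteq> {1..N}}. word_map R js ` G0)"
proof (intro equalityI subsetI)
  fix x assume "x \<in> self_similar_set N R G0"
  then show "x \<in> (\<Union>js\<in>{js. set js \<subseteq> {1..N}}. word_map R js ` G0)"
    unfolding self_similar_set_def by (auto intro: exI[of _ "[]"] simp: word_map_simps)
next
  fix x assume "x \<in> (\<Union>js\<in>{js. set js \<subseteq> {1..N}}. word_map R js ` G0)"
  then obtain js where js: "set js \<subseteq> {1..N}" "x \<in> word_map R js ` G0" by auto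
  show "x \<in> self_similar_set N R G0"
  proof (cases js)
    case Nil
    then show ?thesis using js by (simp add: self_similar_set_def word_map_simps)
  next
    case (Cons j ks)
    then have "length js \<in> {1..}" by simp
    then show ?thesis using js unfolding self_similar_set_def by blast
  qed
qed

lemma self_similar_set_fixpoint:
  "self_similar_set N R G0 = (\<Union>j\<in>{1..N}. R j ` self_similar_set N R G0) \<union> G0"
proof (intro equalityI subsetI)
  fix x assume "x \<in> self_similar_set N R G0"
  then obtain js where js: "set js \<subseteq> {1..N}" "x \<in> word_map R js ` G0" by (auto simp: self_similar_set_eq_UN)
  show "x \<in> (\<Union>j\<in>{1..N}. R j ` self_similar_set N R G0) \<union> G0"
  proof (cases js)
    case Nil
    then show ?thesis using js by (simp add: word_map_simps)
  next
    case (Cons j ks)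
    then have "j \<in> {1..N}" "set ks \<subseteq> {1..N}" "x \<in> R j ` word_map R ks ` G0"
      using js by (auto simp: word_map_simps)
    then show ?thesis unfolding self_similar_set_eq_UN by blast
  qed
next
  fix x assume "x \<in> (\<Union>j\<in>{1..N}. R j ` self_similar_set N R G0) \<union> G0"
  then consider "x \<in> G0" | j js where "j \<in> {1..N}" "set js \<subseteq> {1..N}" "x \<in> R j ` word_map R js ` G0"
    by (auto simp: self_similar_set_eq_UN)
  then show "x \<in> self_similar_set N R G0"
  proof cases
    case 1
    then show ?thesis by (simp add: self_similar_set_def)
  next
    case 2
    then have "set (j # js) \<subseteq> {1..N}" "x \<in> word_map R (j # js) ` G0"
      by (auto simp: word_map_simps)
    then show ?thesis unfolding self_similar_set_eq_UN by blast
  qed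
qed

lemma self_similar_set_open:
  assumes "\<And>j. j \<in> {1..N} \<Longrightarrow> similitude (r j) (R j)" "open G0"
  shows "open (self_similar_set N R G0)"
proof -
  have "open (word_map R js ` G0)" if "set js \<subseteq> {1..N}" for js
    using that
  proof (induction js)
    case (Cons j js)
    then have "open (R j ` word_map R js ` G0)" by (intro similitude_open_image[OF assms(1)]) auto
    then show ?case by (simp add: word_map_simps image_comp)
  qed (simp add: word_map_simps assms)
  then show ?thesis unfolding self_similar_set_eq_UN by auto
qed

lemma self_similar_set_bounded:
  fixes R :: "nat \<Rightarrow> 'a::euclidean_space \<Rightarrow> 'a"
  assumes R: "\<And>j. j \<in> {1..N} \<Longrightarrow> similitude (r j) (R j)" and r: "\<And>j. j \<in> {1..N} \<Longrightarrow> r j < 1" and G0: "bounded G0"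
  shows "bounded (self_similar_set N R G0)"
proof -
  obtain B where B: "B > 0" "\<And>x. x \<in> G0 \<Longrightarrow> norm x \<le> B" using G0 bounded_pos by blast
  \<comment> \<open>The ball of this radius contains \<open>G0\<close> and is mapped into itself by
    each \<open>R j\<close>: \<rho> is at least |R j 0| / (1 - r j), so |R j 0| + r j \<rho> \<le>
    \<rho>. Hence it contains the images under all words.\<close>
  define \<rho> where "\<rho> = B + (\<Sum>j=1..N. norm (R j 0) / (1 - r j))"
  have nonneg: "0 \<le> norm (R j 0) / (1 - r j)" if "j \<in> {1..N}" for j using r[OF that] by simp
  have step: "norm (R j x) \<le> \<rho>" if j: "j \<in> {1..N}" and x: "norm x \<le> \<rho>" for j x
  proof -
    have "norm (R j 0) / (1 - r j) \<le> (\<Sum>j=1..N. norm (R j 0) / (1 - r j))"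
      using nonneg j by (intro member_le_sum) auto
    then have "norm (R j 0) / (1 - r j) \<le> \<rho>" using B by (simp add: \<rho>_def)
    then have "norm (R j 0) \<le> \<rho> * (1 - r j)" using r[OF j] by (simp add: pos_divide_le_eq)
    moreover have "norm (R j x) \<le> norm (R j 0) + r j * norm x"
      using norm_triangle_ineq2[of "R j x" "R j 0"] similitude_dist[OF R[OF j], of x 0] by (simp add: dist_norm)
    moreover have "r j * norm x \<le> r j * \<rho>" using x similitude_pos[OF R[OF j]] by (intro mult_left_mono) auto
    ultimately show ?thesis by (simp add: algebra_simps)
  qed
  have "norm x \<le> \<rho>" if "set js \<subseteq> {1..N}" "x \<in> word_map R js ` G0" for js x
    using that
  proof (induction js arbitrary: x)
    case Nil
    then have "norm x \<le> B" using B by (simp add: word_map_simps)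
    moreover have "0 \<le> (\<Sum>j=1..N. norm (R j 0) / (1 - r j))" by (rule sum_nonneg) (rule nonneg)
    then have "B \<le> \<rho>" by (simp add: \<rho>_def)
    ultimately show ?case by simp
  next
    case (Cons j js)
    then show ?case using step[of j] by (auto simp: word_map_simps)
  qed
  then show ?thesis unfolding bounded_iff self_similar_set_eq_UN by blast
qed

section \<open>Laws of the stable subordinator at fixed times\<close>

context
  fixes M :: "'w measure" and \<gamma> :: real and S :: "real \<Rightarrow> 'w \<Rightarrow> real"
  assumes S: "stable_subordinator M \<gamma> S"
begin

lemma stable_subordinator_measurable: "t \<ge> 0 \<Longrightarrow> S t \<in> borel_measurable M"
  using S by (simp add: stable_subordinator_def)

lemma stable_subordinator_nonneg: "t \<ge> 0 \<Longrightarrow> AE w in M. 0 \<le> S t w"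
proof -
  assume t: "t \<ge> 0"
  have "AE w in M. S 0 w = 0" using S by (simp add: stable_subordinator_def)
  then show ?thesis using AE_space
  proof eventually_elim
    case (elim w)
    have "mono_on {0..} (\<lambda>t. S t w)" using S elim(2) by (simp add: stable_subordinator_def)
    from mono_onD[OF this, of 0 t] show ?case using t elim(1) by simp
  qed
qed

lemma stable_subordinator_distr: "t \<ge> 0 \<Longrightarrow> real_distribution (distr M borel (S t))"
  using S stable_subordinator_measurable
  by (auto simp: stable_subordinator_def real_distribution_def real_distribution_axioms_def intro!: prob_space.prob_space_distr)

lemma stable_subordinator_distr_nonneg: "t \<ge> 0 \<Longrightarrow> AE s in distr M borel (S t). 0 \<le> s"
  using stable_subordinator_nonneg stable_subordinator_measurable by (subst AE_distr_iff) auto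

lemma stable_subordinator_laplace:
  "t \<ge> 0 \<Longrightarrow> \<theta> > 0 \<Longrightarrow> (\<integral>x. exp (- \<theta> * x) \<partial>distr M borel (S t)) = exp (- t * \<theta> powr \<gamma>)"
  using S stable_subordinator_measurable by (subst integral_distr) (auto simp: stable_subordinator_def)

text \<open>Dividing by c replaces \<theta> by \<theta> / c in the Laplace transform, and the factor
  c^(- \<gamma>) can be moved into the time.\<close>

lemma stable_subordinator_scaling:
  assumes c: "c > 0" and t: "t \<ge> 0"
  shows "distr M borel (\<lambda>w. S t w / c) = distr M borel (S (t * c powr (- \<gamma>)))"
proof -
  have t': "t * c powr (- \<gamma>) \<ge> 0" using t by simp
  note [measurable] = stable_subordinator_measurable[OF t]
  have "prob_space M" using S by (simp add: stable_subordinator_def)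
  show ?thesis
  proof (rule laplace_unique)
    show "real_distribution (distr M borel (\<lambda>w. S t w / c))"
      using \<open>prob_space M\<close> by (auto simp: real_distribution_def real_distribution_axioms_def intro!: prob_space.prob_space_distr)
    have "AE w in M. 0 \<le> S t w / c"
      using stable_subordinator_nonneg[OF t] by eventually_elim (use c in simp)
    then show "AE x in distr M borel (\<lambda>w. S t w / c). 0 \<le> x" by (subst AE_distr_iff) auto
    fix \<theta> :: real assume \<theta>: "\<theta> > 0"
    have "(\<integral>x. exp (- \<theta> * x) \<partial>distr M borel (\<lambda>w. S t w / c)) = (\<integral>x. exp (- (\<theta> / c) * x) \<partial>distr M borel (S t))"
      by (subst (1 2) integral_distr) auto
    also have "\<dots> = exp (- t * (\<theta> / c) powr \<gamma>)"
      using \<theta> c by (intro stable_subordinator_laplace t) simp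
    also have "\<dots> = exp (- (t * c powr (- \<gamma>)) * \<theta> powr \<gamma>)"
      using \<theta> c by (simp add: powr_divide powr_minus field_simps)
    also have "\<dots> = (\<integral>x. exp (- \<theta> * x) \<partial>distr M borel (S (t * c powr (- \<gamma>))))"
      by (rule stable_subordinator_laplace[OF t' \<theta>, symmetric])
    finally show "(\<integral>x. exp (- \<theta> * x) \<partial>distr M borel (\<lambda>w. S t w / c)) =
      (\<integral>x. exp (- \<theta> * x) \<partial>distr M borel (S (t * c powr (- \<gamma>))))" .
  qed (use t' stable_subordinator_distr stable_subordinator_distr_nonneg in auto)
qed

end

lemma stable_subordinator_law:
  assumes "stable_subordinator M \<gamma> S" "stable_subordinator M' \<gamma> S'" "t \<ge> 0"
  shows "distr M borel (S t) = distr M' borel (S' t)"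
  using stable_subordinator_distr[OF assms(1,3)] stable_subordinator_distr[OF assms(2,3)]
    stable_subordinator_distr_nonneg[OF assms(1,3)] stable_subordinator_distr_nonneg[OF assms(2,3)]
    stable_subordinator_laplace[OF assms(1,3)] stable_subordinator_laplace[OF assms(2,3)]
  by (intro laplace_unique) auto

section \<open>The renewal equation of the heat loss and the resulting limit\<close>

theorem theorem3p5:
  fixes G0 G :: "'a::euclidean_space set"
    and N :: nat
    and R :: "nat \<Rightarrow> 'a \<Rightarrow> 'a"
    and r :: "nat \<Rightarrow> real"
    and b :: real
    and P :: "'a \<Rightarrow> 'w measure"
    and W :: "real \<Rightarrow> 'w \<Rightarrow> 'a"
    and S :: "real \<Rightarrow> 'w \<Rightarrow> real"
  assumes G0_interval: "DIM('a) = 1 \<Longrightarrow> \<exists>p q. G0 = box p q"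
    and G0_C11: "DIM('a) \<ge> 2 \<Longrightarrow> bounded G0 \<and> C11_open G0"
    and R: "\<And>j. j \<in> {1..N} \<Longrightarrow> similitude (r j) (R j)"
    and r_sum: "(\<Sum>j=1..N. r j ^ DIM('a)) < 1" "1 < (\<Sum>j=1..N. r j ^ (DIM('a) - 1))"
    and G: "G = self_similar_set N R G0"
    and disj: "disjoint_family_on (\<lambda>j. R j ` G) {1..N}"
    and disj0: "\<And>j. j \<in> {1..N} \<Longrightarrow> R j ` G \<inter> G0 = {}"
    and b: "real DIM('a) - 1 < b" "b < real DIM('a)" "(\<Sum>j=1..N. r j powr b) = 1"
    and non_arith: "\<not> arithmetic ((\<lambda>j. ln (1 / r j)) ` {1..N})"
    and BM: "\<And>x. brownian_motion (P x) x W"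
    and subord: "\<And>x. stable_subordinator (P x) ((real DIM('a) - b) / 2) S"
    and indep: "\<And>x. independent_processes (P x) W S"
  shows "((\<lambda>t. (measure lborel G - heat_content_SKBM P W S G t) / (t * ln (1 / t)))
           \<longlongrightarrow> 1 / (2 * Gamma (1 - (real DIM('a) - b) / 2) *
                     (\<Sum>j=1..N. r j powr b * ln (1 / r j))) *
                (LINT u:{0<..}|lborel.
                   (measure lborel G0 - heat_content_BM P W G0 u) *
                   u powr (- 1 - (real DIM('a) - b) / 2)))
         (at_right 0)"
proof -
  define d where "d = DIM('a)"
  have d: "d \<ge> 1" using DIM_positive[where 'a='a] by (simp add: d_def Suc_le_eq)
  define \<gamma> where "\<gamma> = (real d - b) / 2"
  have \<gamma>: "0 < \<gamma>" "\<gamma> < 1 / 2" using b(1,2) by (auto simp: \<gamma>_def d_def)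
  \<comment> \<open>This identity turns the volume factor r^d into the renewal weight r^b times the
    time change r^(2 \<gamma>).\<close>
  have bd: "b + 2 * \<gamma> = real d" by (simp add: \<gamma>_def field_simps)
  have sub: "stable_subordinator (P x) \<gamma> S" for x using subord[of x] by (simp add: \<gamma>_def d_def)
  define J where "J = {1..N}"
  have J: "finite J" "J \<noteq> {}" using b(3) by (auto simp: J_def intro: ccontr)
  have R: "similitude (r j) (R j)" if "j \<in> J" for j using R that by (simp add: J_def)
  have r_pos: "r j > 0" if "j \<in> J" for j using R[OF that] by (rule similitude_pos)
  have r_lt: "r j < 1" if j: "j \<in> J" for j
  proof -
    have "r j ^ d \<le> (\<Sum>j\<in>J. r j ^ d)"
      using r_pos j J by (intro member_le_sum) (auto intro: less_imp_le)
    then have "r j ^ d < 1" using r_sum(1) by (simp add: d_def J_def)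
    then show ?thesis using d r_pos[OF j] by (metis linorder_not_less one_le_power)
  qed
  have G0: "bounded G0" "C11_open G0"
  proof -
    have "bounded G0 \<and> C11_open G0"
    proof (cases "d = 1")
      case True
      then obtain p q where "G0 = box p q" using G0_interval by (auto simp: d_def)
      then show ?thesis using C11_open_interval[of p q] True by (simp add: d_def bounded_box)
    next
      case False
      then have "2 \<le> d" using d by linarith
      then show ?thesis using G0_C11 by (simp add: d_def)
    qed
    then show "bounded G0" "C11_open G0" by auto
  qed
  have G0_open: "open G0" using G0(2) by (simp add: C11_open_def)
  have G_open: "open G" and G_bdd: "bounded G"
    unfolding G using self_similar_set_open[of N r R G0] self_similar_set_bounded[of N r R G0] R r_lt G0 G0_open
    by (auto simp: J_def)
  \<comment> \<open>One law is fixed to carry the Brownian heat loss. Under every other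
    \<open>P x\<close> the variable \<open>S t\<close> has the same law by
    \<open>stable_subordinator_law\<close>.\<close>
  define M where "M = P 0"
  have BM0: "brownian_motion M 0 W" using BM[of 0] by (simp add: M_def)
  have S0: "stable_subordinator M \<gamma> S" using sub[of 0] by (simp add: M_def)
  define L where "L = heat_loss M W"
  define \<mu> where "\<mu> t = distr M borel (S t)" for t
  have \<mu>: "real_distribution (\<mu> t)" "AE s in \<mu> t. 0 \<le> s" if "t > 0" for t
    unfolding \<mu>_def using that stable_subordinator_distr[OF S0, of t] stable_subordinator_distr_nonneg[OF S0, of t] by simp_all
  have L_mono: "mono (L D)" and L_nonneg: "0 \<le> L D s" and L_le: "L D s \<le> measure lborel D"
    if "open D" "bounded D" for D s
    using that heat_loss_mono[OF BM0] heat_loss_nonneg[OF BM0] heat_loss_le[OF BM0] by (auto simp: L_def)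
  have L_meas: "L D \<in> borel_measurable borel" if "open D" "bounded D" for D
    using L_mono[OF that] by (rule borel_measurable_mono)
  have L_int: "integrable (\<mu> t) (\<lambda>s. L D (s / c))" if "open D" "bounded D" "t > 0" for D t and c :: real
  proof -
    interpret real_distribution "\<mu> t" using \<mu>(1)[OF that(3)] .
    have "(\<lambda>s. L D (s / c)) \<in> borel_measurable borel"
      by (rule measurable_compose[OF _ L_meas[OF that(1,2)]]) simp
    then have "(\<lambda>s. L D (s / c)) \<in> borel_measurable (\<mu> t)" by (simp cong: measurable_cong_sets)
    then show ?thesis
      using L_nonneg[OF that(1,2)] L_le[OF that(1,2)]
      by (intro integrable_const_bound[where B="measure lborel D"]) auto
  qed
  \<comment> \<open>Self-similarity is used for Brownian motion, at a fixed time and before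
    subordination, because the killed Brownian path is continuous and cannot jump between the
    pieces.\<close>
  have L_G: "L G s = (\<Sum>j\<in>J. r j ^ d * L G (s / (r j)\<^sup>2)) + L G0 s" for s
  proof -
    have RG: "open (R j ` G)" "bounded (R j ` G)" if "j \<in> J" for j
    proof -
      show "open (R j ` G)" by (rule similitude_open_image[OF R[OF that] G_open])
      have "R j ` G \<subseteq> G"
        using self_similar_set_fixpoint[of N R G0] that unfolding G J_def by blast
      then show "bounded (R j ` G)" by (rule bounded_subset[OF G_bdd])
    qed
    have "G = (\<Union>j\<in>J. R j ` G) \<union> G0"
      using self_similar_set_fixpoint[of N R G0] unfolding G J_def .
    then have "L G s = L ((\<Union>j\<in>J. R j ` G) \<union> G0) s" by simp
    also have "\<dots> = L (\<Union>j\<in>J. R j ` G) s + L G0 s"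
    proof -
      have "(\<Union>j\<in>J. R j ` G) \<inter> G0 = {}" using disj0 unfolding J_def by blast
      moreover have "open (\<Union>j\<in>J. R j ` G)" "bounded (\<Union>j\<in>J. R j ` G)" using RG J by auto
      ultimately show ?thesis
        unfolding L_def using G0_open G0(1) by (intro heat_loss_union[OF BM0])
    qed
    also have "L (\<Union>j\<in>J. R j ` G) s = (\<Sum>j\<in>J. L (R j ` G) s)"
      unfolding L_def using RG J disj by (intro heat_loss_UN[OF BM0]) (auto simp: J_def)
    also have "\<dots> = (\<Sum>j\<in>J. r j ^ d * L G (s / (r j)\<^sup>2))"
      unfolding L_def d_def by (intro sum.cong refl heat_loss_similitude[OF BM0 R G_open G_bdd])
    finally show ?thesis .
  qed
  define H where "H D t = (\<integral>s. L D s \<partial>\<mu> t)" for D t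
  \<comment> \<open>Averaging over the random time converts the spatial rescaling into a rescaling
    of t: \<open>S t\<close> divided by (r j)^2 has the law of the subordinator at time t (r j)^(- 2
    \<gamma>).\<close>
  have H_G: "H G t = (\<Sum>j\<in>J. r j ^ d * H G (t * r j powr (- 2 * \<gamma>))) + H G0 t" if t: "t > 0" for t
  proof -
    have scale: "(\<integral>s. L G (s / (r j)\<^sup>2) \<partial>\<mu> t) = H G (t * r j powr (- 2 * \<gamma>))" if j: "j \<in> J" for j
    proof -
      note [measurable] = L_meas[OF G_open G_bdd] stable_subordinator_measurable[OF S0, of t]
      have [measurable]: "S t \<in> borel_measurable M" using t by (intro stable_subordinator_measurable[OF S0]) simp
      have pw: "((r j)\<^sup>2) powr (- \<gamma>) = r j powr (- 2 * \<gamma>)"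
        using r_pos[OF j] by (simp add: powr_powr flip: powr_numeral)
      have "(\<integral>s. L G (s / (r j)\<^sup>2) \<partial>\<mu> t) = (\<integral>w. L G (S t w / (r j)\<^sup>2) \<partial>M)"
        unfolding \<mu>_def by (subst integral_distr) auto
      also have "\<dots> = (\<integral>s. L G s \<partial>distr M borel (\<lambda>w. S t w / (r j)\<^sup>2))"
        by (subst integral_distr) auto
      also have "distr M borel (\<lambda>w. S t w / (r j)\<^sup>2) = \<mu> (t * r j powr (- 2 * \<gamma>))"
        unfolding \<mu>_def pw[symmetric] using t r_pos[OF j] by (intro stable_subordinator_scaling[OF S0]) auto
      finally show ?thesis by (simp add: H_def)
    qed
    have "H G t = (\<integral>s. (\<Sum>j\<in>J. r j ^ d * L G (s / (r j)\<^sup>2)) + L G0 s \<partial>\<mu> t)"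
      unfolding H_def by (rule Bochner_Integration.integral_cong[OF refl L_G])
    also have "\<dots> = (\<integral>s. (\<Sum>j\<in>J. r j ^ d * L G (s / (r j)\<^sup>2)) \<partial>\<mu> t) + H G0 t"
      unfolding H_def using L_int[OF G_open G_bdd t] L_int[OF G0_open G0(1) t, of 1]
      by (intro Bochner_Integration.integral_add Bochner_Integration.integrable_sum) auto
    also have "(\<integral>s. (\<Sum>j\<in>J. r j ^ d * L G (s / (r j)\<^sup>2)) \<partial>\<mu> t) = (\<Sum>j\<in>J. r j ^ d * (\<integral>s. L G (s / (r j)\<^sup>2) \<partial>\<mu> t))"
      using L_int[OF G_open G_bdd t] by (subst Bochner_Integration.integral_sum) auto
    also have "\<dots> = (\<Sum>j\<in>J. r j ^ d * H G (t * r j powr (- 2 * \<gamma>)))"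
      by (simp add: scale)
    finally show ?thesis .
  qed
  have H_bound: "\<bar>H G t\<bar> \<le> measure lborel G" if "t > 0" for t
  proof -
    interpret real_distribution "\<mu> t" using \<mu>(1)[OF that] .
    have "H G t \<le> (\<integral>s. measure lborel G \<partial>\<mu> t)"
      unfolding H_def using L_int[OF G_open G_bdd that, of 1] L_le[OF G_open G_bdd]
      by (intro Bochner_Integration.integral_mono) auto
    moreover have "0 \<le> H G t" unfolding H_def by (intro Bochner_Integration.integral_nonneg L_nonneg[OF G_open G_bdd])
    ultimately show ?thesis using prob_space by simp
  qed
  have heat: "measure lborel G - heat_content_SKBM P W S G t = H G t" if "t > 0" for t
    unfolding H_def L_def M_def
  proof (rule heat_content_SKBM_eq[OF BM indep G_open G_bdd])
    show "distr (P x) borel (S t) = \<mu> t" for x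
      unfolding \<mu>_def using stable_subordinator_law[OF sub S0] that by simp
  qed (use that stable_subordinator_measurable[OF sub] stable_subordinator_nonneg[OF sub] in auto)
  define I where "I = (LINT u:{0<..}|lborel. L G0 u * u powr (- 1 - \<gamma>))"
  define c0 where "c0 = \<gamma> / Gamma (1 - \<gamma>) * I"
  have H0_lim: "((\<lambda>t. H G0 t / t) \<longlongrightarrow> c0) (at_right 0)"
  proof -
    obtain K where K: "K \<ge> 0" "\<And>\<epsilon>. \<epsilon> > 0 \<Longrightarrow> measure lborel {x \<in> G0. infdist x (- G0) < \<epsilon>} \<le> K * \<epsilon>"
      using boundary_layer[OF G0] by blast
    \<comment> \<open>A single constant for both bounds on the loss of \<open>G0\<close>: its volume
      for large times, the boundary layer estimate for small ones.\<close>
    define C where "C = max (measure lborel G0) (K * (1 + 256 * 2 powr (real DIM('a) / 2)))"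
    have sqrt: "L G0 x \<le> C * sqrt x" if "x \<ge> 0" for x
    proof (cases "x = 0")
      case True
      then show ?thesis using heat_loss_nonpos[OF BM0 G0_open] by (simp add: L_def)
    next
      case False
      then have "L G0 x \<le> K * (1 + 256 * 2 powr (real DIM('a) / 2)) * sqrt x"
        unfolding L_def using that by (intro heat_loss_sqrt_bound[OF BM0 G0_open G0(1) K]) auto
      also have "\<dots> \<le> C * sqrt x" using that by (intro mult_right_mono) (auto simp: C_def)
      finally show ?thesis .
    qed
    show ?thesis
      unfolding H_def c0_def I_def
    proof (rule stable_small_time[OF \<gamma> \<mu>, where C=C])
      show "(\<integral>x. exp (- \<theta> * x) \<partial>\<mu> t) = exp (- t * \<theta> powr \<gamma>)" if "t > 0" "\<theta> > 0" for t \<theta>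
        unfolding \<mu>_def using that by (intro stable_subordinator_laplace[OF S0]) auto
      show "mono (L G0)" by (rule L_mono[OF G0_open G0(1)])
      show "L G0 x = 0" if "x \<le> 0" for x using heat_loss_nonpos[OF BM0 G0_open that] by (simp add: L_def)
      show "L G0 x \<le> C" for x using L_le[OF G0_open G0(1), of x] by (simp add: C_def)
    qed (use sqrt in auto)
  qed
  define p where "p j = r j powr b" for j
  \<comment> \<open>In the variable x = ln (1 / t), multiplying t by (r j)^(- 2 \<gamma>) subtracts
    this delay. It is positive because r j < 1.\<close>
  define a where "a j = 2 * \<gamma> * ln (1 / r j)" for j
  define g where "g x = exp x * H G (exp (- x))" for x
  define g0 where "g0 x = exp x * H G0 (exp (- x))" for x
  have g_lim: "((\<lambda>x. g x / x) \<longlongrightarrow> c0 / (\<Sum>j\<in>J. p j * a j)) at_top"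
  proof (rule renewal_linear_growth[OF J])
    show "p j > 0" if "j \<in> J" for j using r_pos[OF that] by (simp add: p_def)
    show "(\<Sum>j\<in>J. p j) = 1" using b(3) by (simp add: p_def J_def)
    show "a j > 0" if "j \<in> J" for j
      using r_pos[OF that] r_lt[OF that] \<gamma> by (simp add: a_def)
    show "g x = (\<Sum>j\<in>J. p j * g (x - a j)) + g0 x" for x
    proof -
      \<comment> \<open>Dividing by t costs exp x instead of exp (x - a j); the surplus factor exp
        (a j) = (r j)^(- 2 \<gamma>) turns the weight (r j)^b + 2 \<gamma> exponents into r^d, as in
        \<open>bd\<close>.\<close>
      have "exp x * (r j ^ d * H G (exp (- x) * r j powr (- 2 * \<gamma>))) = p j * g (x - a j)" if j: "j \<in> J" for j
      proof -
        note rj = r_pos[OF j]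
        have ea: "exp (a j) = r j powr (- 2 * \<gamma>)" using rj by (simp add: a_def powr_def ln_div)
        then have 1: "exp (- (x - a j)) = exp (- x) * r j powr (- 2 * \<gamma>)"
          by (simp add: exp_diff exp_minus field_simps)
        have "p j * exp (x - a j) = exp x * (r j powr b / r j powr (- 2 * \<gamma>))"
          by (simp add: p_def exp_diff ea)
        also have "r j powr b / r j powr (- 2 * \<gamma>) = r j powr (b + 2 * \<gamma>)"
          by (simp add: powr_diff[symmetric])
        also have "\<dots> = r j ^ d" using rj by (simp add: bd powr_realpow)
        finally show ?thesis unfolding g_def 1 by (simp add: mult.assoc[symmetric])
      qed
      then show ?thesis
        unfolding g_def g0_def by (subst H_G) (simp_all add: distrib_left sum_distrib_left g_def)
    qed
    have e0: "filterlim (\<lambda>x::real. exp (- x)) (at_right 0) at_top"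
      by (auto simp: filterlim_at intro!: filterlim_compose[OF exp_at_bot] filterlim_uminus_at_bot_at_top)
    have "((\<lambda>x. H G0 (exp (- x)) / exp (- x)) \<longlongrightarrow> c0) at_top"
      by (rule filterlim_compose[OF H0_lim e0])
    then show "(g0 \<longlongrightarrow> c0) at_top" by (simp add: g0_def[abs_def] exp_minus field_simps)
    show "\<exists>K. \<forall>u\<in>{x..y}. \<bar>g u\<bar> \<le> K" for x y
    proof (intro exI ballI)
      fix u assume u: "u \<in> {x..y}"
      have "\<bar>g u\<bar> = exp u * \<bar>H G (exp (- u))\<bar>" by (simp add: g_def abs_mult)
      also have "\<dots> \<le> exp y * measure lborel G" using u by (intro mult_mono H_bound) auto
      finally show "\<bar>g u\<bar> \<le> exp y * measure lborel G" .
    qed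
  qed
  have ln_lim: "filterlim (\<lambda>t::real. ln (1 / t)) at_top (at_right 0)"
  proof -
    have "filterlim (\<lambda>t::real. - ln t) at_top (at_right 0)"
      using ln_at_0 by (simp add: filterlim_uminus_at_top)
    then show ?thesis
      by (rule filterlim_cong[THEN iffD1, rotated -1])
        (auto simp: ln_div eventually_at_right_less intro: eventually_mono[OF eventually_at_right_less])
  qed
  have "((\<lambda>t. g (ln (1 / t)) / ln (1 / t)) \<longlongrightarrow> c0 / (\<Sum>j\<in>J. p j * a j)) (at_right 0)"
    by (rule filterlim_compose[OF g_lim ln_lim])
  moreover have "eventually (\<lambda>t. g (ln (1 / t)) / ln (1 / t) =
      (measure lborel G - heat_content_SKBM P W S G t) / (t * ln (1 / t))) (at_right 0)"
    using eventually_at_right_less[of "0::real"]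
    by eventually_elim (simp add: heat g_def exp_minus)
  ultimately have lim: "((\<lambda>t. (measure lborel G - heat_content_SKBM P W S G t) / (t * ln (1 / t)))
      \<longlongrightarrow> c0 / (\<Sum>j\<in>J. p j * a j)) (at_right 0)"
    by (rule Lim_transform_eventually)
  have I: "(LINT u:{0<..}|lborel. (measure lborel G0 - heat_content_BM P W G0 u) * u powr (- 1 - (real DIM('a) - b) / 2)) = I"
    unfolding I_def
  proof (rule set_lebesgue_integral_cong)
    show "\<forall>u. u \<in> {0<..} \<longrightarrow> (measure lborel G0 - heat_content_BM P W G0 u) * u powr (- 1 - (real DIM('a) - b) / 2) =
        L G0 u * u powr (- 1 - \<gamma>)"
      using heat_content_BM_eq[OF BM G0_open G0(1), where z=0] by (simp add: L_def M_def \<gamma>_def d_def)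
  qed simp
  \<comment> \<open>The mean delay carries the factor 2 \<gamma>, whose \<gamma> cancels against the
    Levy constant in \<open>c0\<close>.\<close>
  have "(\<Sum>j\<in>J. p j * a j) = 2 * \<gamma> * (\<Sum>j=1..N. r j powr b * ln (1 / r j))"
    by (simp add: p_def a_def J_def sum_distrib_left mult_ac)
  then have "c0 / (\<Sum>j\<in>J. p j * a j) = 1 / (2 * Gamma (1 - \<gamma>) * (\<Sum>j=1..N. r j powr b * ln (1 / r j))) * I"
    using \<gamma> by (simp add: c0_def)
  then show ?thesis using lim unfolding I by (simp add: \<gamma>_def d_def)
qed

end
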